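(* Assume the basic framework described in the context for $(T,\mathcal A,\phi)$, $X$, $K$, $d$, with $M_*\ge1$ such that $d$ is $M_*$-adapted. Let $M_1\in\mathbb N$ and $p>0$. Let $m_0\in\mathbb N$ be such that for any $m\ge m_0$ and $w\in T$ there is $v\in S^m(w)$ with $\Gamma_1(v)\subseteq S^m(w)$, and for $M\in\{M_1,M_*\}$ let $k_M\ge1$ be such that $\pi^k(\Gamma_{M+M_*}(v))\subseteq\Gamma_{M_*}(\pi^k(v))$ for all $v\in T$ and $k\ge k_M$ (such $m_0,k_{M_1},k_{M_*}$ exist). Assume that $k\ge\max\{m_0,k_{M_1},k_{M_*}\}$. If there exists $\varphi:T^{(k)}\to(0,1]$ such that $$\sum_{i=1}^m\varphi(w(i))\ge1$$ for any $w\in T^{(k)}$ and any $(w(1),\ldots,w(m))\in\mathcal C_{w,k}(0,M_1,M_1)$, and $$\sum_{v\in S^k(w)}\varphi(v)^p<\tfrac12(L_* )^{-2(M_1+2M_* )}$$ for any $w\in T^{(k)}$, then there exist a metric $\rho\in\mathcal D_{A,e}(X,\mathcal O)$ and a Borel regular probability measure $\mu$ on $X$ such that $\rho$ is quasisymmetric to $d$ and $\mu$ is $p$-Ahlfors regular with respect to $\rho$.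
   Context: Setting. $T$ is a countably infinite set, $\mathcal A:T\times T\to\{0,1\}$ is symmetric and vanishes on the diagonal, the graph on $T$ with edges $\{(w,v):\mathcal A(w,v)=1\}$ is a locally finite tree, and $\phi\in T$ is a fixed root. For $w\in T$: $|w|$ is the tree distance from $\phi$ to $w$; $(T)_m=\{w:|w|=m\}$; $\pi(w)$ is the neighbour of $w$ on the geodesic from $\phi$ to $w$ ($\pi(\phi)=\phi$), $\pi^k$ its $k$-th iterate; $S(w)$ is the set of neighbours of $w$ other than $\pi(w)$; $T_w$ is the set of $v$ such that $w$ lies on the geodesic from $\phi$ to $v$; $S^k(w)=\{v\in T_w:|v|=|w|+k\}$, and $S^k(A)=\bigcup_{w\in A}S^k(w)$ for $A\subseteq T$. $\Sigma$ is the set of infinite geodesic rays $([\omega]_0=\phi,[\omega]_1,\ldots)$ of the tree from $\phi$. $(X,\mathcal O)$ is a compact metrizable space with no isolated point. A partition $K$ assigns to each $w\in T$ a nonempty compact $K_w\subseteq X$ with $K_\phi=X$, $K_w=\bigcup_{v\in S(w)}K_v$, and $\bigcap_mK_{[\omega]_m}$ a single point for all $\omega\in\Sigma$. It is minimal if $K_w\setminus\bigcup_{v\in(T)_{|w|},v\ne w}K_v\ne\emptyset$ for all $w$. Weight functions. A weight function is $g:T\to(0,1]$ with $g(\phi)=1$, $g(\pi(w))\ge g(w)$, $\lim_m\sup_{(T)_m}g=0$. $\Lambda^g_s=\{w:g(\pi(w))>s\ge g(w)\}$ for $s\in(0,1)$, $\Lambda^g_s=\{\phi\}$ for $s\ge1$.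 $U^g_M(x,s)$ is the set of $y$ for which there are $w(1),\ldots,w(M+1)\in\Lambda^g_s$ with $x\in K_{w(1)}$, $y\in K_{w(M+1)}$, $K_{w(i)}\cap K_{w(i+1)}\ne\emptyset$. $g$ is exponential if there are $m\ge0$, $c_1\in(0,1)$ with $g(v)\le c_1g(w)$ for $v\in T_w$, $|v|\ge|w|+m$, and $c_2\in(0,1)$ with $g(v)\ge c_2g(w)$ for $v\in S(w)$; uniformly finite if $\sup_{s\in(0,1],w\in\Lambda^g_s}\#\{v\in\Lambda^g_s:K_v\cap K_w\ne\emptyset\}<\infty$; thick if there are $M\ge1,\alpha>0$ such that for all $s\in(0,1]$, $w\in\Lambda^g_s$, $K_w\supseteq U^g_M(x,\alpha s)$ for some $x\in K_w$. $\mathcal D(X,\mathcal O)$: metrics inducing $\mathcal O$ with $\operatorname{diam}(X,d)=1$; $B_d(x,r)$ open balls; $g_d(w)=\operatorname{diam}(K_w,d)$. $d$ is $M$-adapted if there are $\alpha_1,\alpha_2>0$ with $U^{g_d}_M(x,\alpha_1r)\subseteq B_d(x,r)\subseteq U^{g_d}_M(x,\alpha_2r)$ for all $x\in X,r>0$. $\mathcal D_{A,e}(X,\mathcal O)$: those $d\in\mathcal D(X,\mathcal O)$ which are $M$-adapted for some $M\ge0$ with $g_d$ exponential. Basic framework. $K$ is minimal, $\sup_{w}\#(S(w))<\infty$, $d\in\mathcal D(X,\mathcal O)$ is $M_*$-adapted for some fixed $M_*\ge1$, $g_d$ is exponential, thick and uniformly finite, and there are $r\in(0,1)$, $c_1,c_2>0$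 with $c_1r^{|w|}\le g_d(w)\le c_2r^{|w|}$ for all $w\in T$. For $w\in T$ and $M\ge1$, $\Gamma_M(w)$ is the set of $u\in(T)_{|w|}$ for which there are $w(1)=w,\ldots,w(M+1)=u$ in $(T)_{|w|}$ with $K_{w(i)}\cap K_{w(i+1)}\neq\emptyset$; $\Gamma_0(w)=\{w\}$. $L_*=\sup_{w\in T}\#(\Gamma_1(w))$ (finite). $T^{(k)}=\bigcup_{m\ge0}(T)_{mk}$. A horizontal $N$-jpath is a finite sequence $(w(1),\ldots,w(m))$ of elements of $T$ of the same level $|\cdot|$ with $w(i+1)\in\Gamma_N(w(i))$ for all $i$. $\mathcal C_{w,k}(N_1,N_2,N)$ is the set of horizontal $N$-jpaths $(w(1),\ldots,w(m))$ with all $w(j)\in S^k(\Gamma_{N_2}(w))$, $\Gamma_N(w(1))\cap S^k(\Gamma_{N_1}(w))\ne\emptyset$ and $\Gamma_N(w(m))\setminus S^k(\Gamma_{N_2}(w))\neq\emptyset$. $\rho$ is quasisymmetric to $d$ if there is a homeomorphism $h$ of $[0,\infty)$ with $h(0)=0$ such that for any $t>0$, $\rho(x,z)<h(t)\rho(x,y)$ whenever $d(x,z)<t\,d(x,y)$. $\mu$ is $p$-Ahlfors regular with respect to $\rho$ if there are $C_1,C_2>0$ with $C_1r^p\le\mu(B_\rho(x,r))\le C_2r^p$ for all $x\in X$, $r\in[0,\operatorname{diam}(X,\rho)]$. *)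

theory Defs
  imports "HOL-Probability.Probability"
begin

text \<open>The adjacency matrix with values in {0,1} is given as a relation; only its values
  on the vertex set matter.\<close>

record 't rooted_graph =
  verts :: "'t set"
  adj :: "'t \<Rightarrow> 't \<Rightarrow> bool"
  base :: 't

definition simple_path :: "'t rooted_graph \<Rightarrow> 't \<Rightarrow> 't list \<Rightarrow> 't \<Rightarrow> bool" where
  "simple_path G w p v \<longleftrightarrow> p \<noteq> [] \<and> hd p = w \<and> last p = v \<and> set p \<subseteq> verts G
     \<and> successively (adj G) p \<and> distinct p"

locale reference_tree =
  fixes G :: "'t rooted_graph"
  assumes countable_verts: "countable (verts G)"
    and infinite_verts: "infinite (verts G)"
    and base_in_verts: "base G \<in> verts G"
    and adj_sym: "\<And>w v. w \<in> verts G \<Longrightarrow> v \<in> verts G \<Longrightarrow> adj G w v \<Longrightarrow> adj G v w"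
    and adj_irrefl: "\<And>w. w \<in> verts G \<Longrightarrow> \<not> adj G w w"
    and locally_finite: "\<And>w. w \<in> verts G \<Longrightarrow> finite {v \<in> verts G. adj G w v}"
    and tree: "\<And>w v. w \<in> verts G \<Longrightarrow> v \<in> verts G \<Longrightarrow> \<exists>!p. simple_path G w p v"

definition geodesic :: "'t rooted_graph \<Rightarrow> 't \<Rightarrow> 't \<Rightarrow> 't list" where
  "geodesic G w v = (THE p. simple_path G w p v)"

definition level :: "'t rooted_graph \<Rightarrow> 't \<Rightarrow> nat" where
  "level G w = length (geodesic G (base G) w) - 1"

definition level_set :: "'t rooted_graph \<Rightarrow> nat \<Rightarrow> 't set" where
  "level_set G m = {w \<in> verts G. level G w = m}"

definition parent :: "'t rooted_graph \<Rightarrow> 't \<Rightarrow> 't" where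
  "parent G w = (if w = base G then base G else geodesic G (base G) w ! (level G w - 1))"

definition children :: "'t rooted_graph \<Rightarrow> 't \<Rightarrow> 't set" where
  "children G w = {v \<in> verts G. adj G w v \<and> v \<noteq> parent G w}"

definition subtree :: "'t rooted_graph \<Rightarrow> 't \<Rightarrow> 't set" where
  "subtree G w = {v \<in> verts G. w \<in> set (geodesic G (base G) v)}"

definition descendants :: "'t rooted_graph \<Rightarrow> nat \<Rightarrow> 't \<Rightarrow> 't set" where
  "descendants G k w = {v \<in> subtree G w. level G v = level G w + k}"

definition descendants_of_set :: "'t rooted_graph \<Rightarrow> nat \<Rightarrow> 't set \<Rightarrow> 't set" where
  "descendants_of_set G k A = (\<Union>w\<in>A. descendants G k w)"

definition rays :: "'t rooted_graph \<Rightarrow> (nat \<Rightarrow> 't) set" where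
  "rays G = {\<omega>. range \<omega> \<subseteq> verts G \<and> (\<forall>n. geodesic G (base G) (\<omega> n) = map \<omega> [0..<Suc n])}"

definition level_multiples :: "'t rooted_graph \<Rightarrow> nat \<Rightarrow> 't set" where
  "level_multiples G k = (\<Union>m. level_set G (m * k))"

definition is_partition :: "'t rooted_graph \<Rightarrow> 'x topology \<Rightarrow> ('t \<Rightarrow> 'x set) \<Rightarrow> bool" where
  "is_partition G X K \<longleftrightarrow>
     (\<forall>w\<in>verts G. K w \<noteq> {} \<and> compactin X (K w))
   \<and> K (base G) = topspace X
   \<and> (\<forall>w\<in>verts G. K w = (\<Union>v\<in>children G w. K v))
   \<and> (\<forall>\<omega>\<in>rays G. \<exists>x. (\<Inter>m. K (\<omega> m)) = {x})"

definition minimal_partition :: "'t rooted_graph \<Rightarrow> ('t \<Rightarrow> 'x set) \<Rightarrow> bool" where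
  "minimal_partition G K \<longleftrightarrow>
     (\<forall>w\<in>verts G. K w - (\<Union>v\<in>level_set G (level G w) - {w}. K v) \<noteq> {})"

definition weight_function :: "'t rooted_graph \<Rightarrow> ('t \<Rightarrow> real) \<Rightarrow> bool" where
  "weight_function G g \<longleftrightarrow>
     (\<forall>w\<in>verts G. 0 < g w \<and> g w \<le> 1)
   \<and> g (base G) = 1
   \<and> (\<forall>w\<in>verts G. g (parent G w) \<ge> g w)
   \<and> (\<lambda>m. SUP w\<in>level_set G m. g w) \<longlonglongrightarrow> 0"

definition scale :: "'t rooted_graph \<Rightarrow> ('t \<Rightarrow> real) \<Rightarrow> real \<Rightarrow> 't set" where
  "scale G g s = (if s \<ge> 1 then {base G} else {w \<in> verts G. g (parent G w) > s \<and> s \<ge> g w})"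

definition nbhd :: "'t rooted_graph \<Rightarrow> ('t \<Rightarrow> 'x set) \<Rightarrow> ('t \<Rightarrow> real) \<Rightarrow> nat \<Rightarrow> 'x \<Rightarrow> real \<Rightarrow> 'x set" where
  "nbhd G K g M x s = {y. \<exists>ws. length ws = M + 1 \<and> set ws \<subseteq> scale G g s
     \<and> x \<in> K (hd ws) \<and> y \<in> K (last ws)
     \<and> (\<forall>i<M. K (ws ! i) \<inter> K (ws ! Suc i) \<noteq> {})}"

definition exponential_weight :: "'t rooted_graph \<Rightarrow> ('t \<Rightarrow> real) \<Rightarrow> bool" where
  "exponential_weight G g \<longleftrightarrow> weight_function G g
   \<and> (\<exists>(m::nat) c\<^sub>1. 0 < c\<^sub>1 \<and> c\<^sub>1 < 1
        \<and> (\<forall>w\<in>verts G. \<forall>v\<in>subtree G w. level G v \<ge> level G w + m \<longrightarrow> g v \<le> c\<^sub>1 * g w))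
   \<and> (\<exists>c\<^sub>2. 0 < c\<^sub>2 \<and> c\<^sub>2 < 1 \<and> (\<forall>w\<in>verts G. \<forall>v\<in>children G w. g v \<ge> c\<^sub>2 * g w))"

definition uniformly_finite_weight :: "'t rooted_graph \<Rightarrow> ('t \<Rightarrow> 'x set) \<Rightarrow> ('t \<Rightarrow> real) \<Rightarrow> bool" where
  "uniformly_finite_weight G K g \<longleftrightarrow> weight_function G g
   \<and> (\<exists>N. \<forall>s. 0 < s \<and> s \<le> 1 \<longrightarrow> (\<forall>w\<in>scale G g s.
        finite {v \<in> scale G g s. K v \<inter> K w \<noteq> {}} \<and> card {v \<in> scale G g s. K v \<inter> K w \<noteq> {}} \<le> N))"

definition thick_weight :: "'t rooted_graph \<Rightarrow> ('t \<Rightarrow> 'x set) \<Rightarrow> ('t \<Rightarrow> real) \<Rightarrow> bool" where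
  "thick_weight G K g \<longleftrightarrow> weight_function G g
   \<and> (\<exists>M\<ge>1. \<exists>\<alpha>>0. \<forall>s. 0 < s \<and> s \<le> 1 \<longrightarrow> (\<forall>w\<in>scale G g s.
        \<exists>x\<in>K w. nbhd G K g M x (\<alpha> * s) \<subseteq> K w))"

text \<open>The library's \<^const>\<open>diameter\<close> is tied to the type class of metric spaces;
  this is the same definition for a metric given as a function.\<close>

definition diam :: "('x \<Rightarrow> 'x \<Rightarrow> real) \<Rightarrow> 'x set \<Rightarrow> real" where
  "diam d A = (if A = {} then 0 else SUP (x, y)\<in>A \<times> A. d x y)"

definition normalized_metric :: "'x topology \<Rightarrow> ('x \<Rightarrow> 'x \<Rightarrow> real) \<Rightarrow> bool" where
  "normalized_metric X d \<longleftrightarrow> Metric_space (topspace X) d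
     \<and> Metric_space.mtopology (topspace X) d = X \<and> diam d (topspace X) = 1"

definition metric_weight :: "('t \<Rightarrow> 'x set) \<Rightarrow> ('x \<Rightarrow> 'x \<Rightarrow> real) \<Rightarrow> 't \<Rightarrow> real" where
  "metric_weight K d w = diam d (K w)"

definition adapted_metric ::
    "'t rooted_graph \<Rightarrow> 'x topology \<Rightarrow> ('t \<Rightarrow> 'x set) \<Rightarrow> nat \<Rightarrow> ('x \<Rightarrow> 'x \<Rightarrow> real) \<Rightarrow> bool" where
  "adapted_metric G X K M d \<longleftrightarrow> (\<exists>\<alpha>\<^sub>1>0. \<exists>\<alpha>\<^sub>2>0. \<forall>x\<in>topspace X. \<forall>r>0.
      nbhd G K (metric_weight K d) M x (\<alpha>\<^sub>1 * r) \<subseteq> Metric_space.mball (topspace X) d x r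
    \<and> Metric_space.mball (topspace X) d x r \<subseteq> nbhd G K (metric_weight K d) M x (\<alpha>\<^sub>2 * r))"

definition adapted_exponential_metrics ::
    "'t rooted_graph \<Rightarrow> 'x topology \<Rightarrow> ('t \<Rightarrow> 'x set) \<Rightarrow> ('x \<Rightarrow> 'x \<Rightarrow> real) set" where
  "adapted_exponential_metrics G X K = {d. normalized_metric X d
     \<and> (\<exists>M. adapted_metric G X K M d) \<and> exponential_weight G (metric_weight K d)}"

definition quasisymmetric_to ::
    "'x topology \<Rightarrow> ('x \<Rightarrow> 'x \<Rightarrow> real) \<Rightarrow> ('x \<Rightarrow> 'x \<Rightarrow> real) \<Rightarrow> bool" where
  "quasisymmetric_to X \<rho> d \<longleftrightarrow>
     (\<exists>h h'. homeomorphism {0::real..} {0::real..} h h' \<and> h 0 = 0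
       \<and> (\<forall>t>0. \<forall>x\<in>topspace X. \<forall>y\<in>topspace X. \<forall>z\<in>topspace X.
            d x z < t * d x y \<longrightarrow> \<rho> x z < h t * \<rho> x y))"

text \<open>Borel regular in the usual sense of geometric measure theory: Borel sets are measurable, and
  every measurable set has a Borel hull of the same measure.\<close>

definition borel_regular :: "'x topology \<Rightarrow> 'x measure \<Rightarrow> bool" where
  "borel_regular X \<mu> \<longleftrightarrow> space \<mu> = topspace X
     \<and> sigma_sets (topspace X) {U. openin X U} \<subseteq> sets \<mu>
     \<and> (\<forall>A\<in>sets \<mu>. \<exists>B\<in>sigma_sets (topspace X) {U. openin X U}.
          A \<subseteq> B \<and> emeasure \<mu> A = emeasure \<mu> B)"

definition ahlfors_regular ::
    "'x topology \<Rightarrow> real \<Rightarrow> ('x \<Rightarrow> 'x \<Rightarrow> real) \<Rightarrow> 'x measure \<Rightarrow> bool" where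
  "ahlfors_regular X p \<rho> \<mu> \<longleftrightarrow> (\<exists>C\<^sub>1>0. \<exists>C\<^sub>2>0. \<forall>x\<in>topspace X. \<forall>r\<in>{0..diam \<rho> (topspace X)}.
      C\<^sub>1 * r powr p \<le> measure \<mu> (Metric_space.mball (topspace X) \<rho> x r)
    \<and> measure \<mu> (Metric_space.mball (topspace X) \<rho> x r) \<le> C\<^sub>2 * r powr p)"

locale basic_framework = reference_tree G
  for G :: "'t rooted_graph" +
  fixes X :: "'x topology"
    and K :: "'t \<Rightarrow> 'x set"
    and d :: "'x \<Rightarrow> 'x \<Rightarrow> real"
    and Mstar :: nat
  assumes compact_space: "compact_space X"
    and metrizable_space: "metrizable_space X"
    and no_isolated_point: "\<And>x. x \<in> topspace X \<Longrightarrow> \<not> openin X {x}"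
    and partition: "is_partition G X K"
    and minimal: "minimal_partition G K"
    and bounded_children: "\<exists>N. \<forall>w\<in>verts G. card (children G w) \<le> N"
    and normalized_metric: "normalized_metric X d"
    and Mstar_ge_1: "Mstar \<ge> 1"
    and adapted: "adapted_metric G X K Mstar d"
    and exponential: "exponential_weight G (metric_weight K d)"
    and thick: "thick_weight G K (metric_weight K d)"
    and uniformly_finite: "uniformly_finite_weight G K (metric_weight K d)"
    and geometric_diameters: "\<exists>r c\<^sub>1 c\<^sub>2. 0 < r \<and> r < 1 \<and> 0 < c\<^sub>1 \<and> 0 < c\<^sub>2
      \<and> (\<forall>w\<in>verts G. c\<^sub>1 * r ^ level G w \<le> metric_weight K d w
                   \<and> metric_weight K d w \<le> c\<^sub>2 * r ^ level G w)"

definition horizontal_nbhd :: "'t rooted_graph \<Rightarrow> ('t \<Rightarrow> 'x set) \<Rightarrow> nat \<Rightarrow> 't \<Rightarrow> 't set" where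
  "horizontal_nbhd G K M w = {u. \<exists>ws. length ws = M + 1 \<and> set ws \<subseteq> level_set G (level G w)
     \<and> hd ws = w \<and> last ws = u \<and> (\<forall>i<M. K (ws ! i) \<inter> K (ws ! Suc i) \<noteq> {})}"

text \<open>In the basic framework the cardinalities below are bounded, so that the supremum of
  natural numbers is a maximum.\<close>

definition Lstar :: "'t rooted_graph \<Rightarrow> ('t \<Rightarrow> 'x set) \<Rightarrow> nat" where
  "Lstar G K = (SUP w\<in>verts G. card (horizontal_nbhd G K 1 w))"

definition horizontal_jpath :: "'t rooted_graph \<Rightarrow> ('t \<Rightarrow> 'x set) \<Rightarrow> nat \<Rightarrow> 't list \<Rightarrow> bool" where
  "horizontal_jpath G K N ws \<longleftrightarrow> ws \<noteq> [] \<and> (\<exists>m. set ws \<subseteq> level_set G m)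
     \<and> (\<forall>i. Suc i < length ws \<longrightarrow> ws ! Suc i \<in> horizontal_nbhd G K N (ws ! i))"

definition crossing_jpaths ::
    "'t rooted_graph \<Rightarrow> ('t \<Rightarrow> 'x set) \<Rightarrow> 't \<Rightarrow> nat \<Rightarrow> nat \<Rightarrow> nat \<Rightarrow> nat \<Rightarrow> 't list set" where
  "crossing_jpaths G K w k N\<^sub>1 N\<^sub>2 N = {ws. horizontal_jpath G K N ws
     \<and> set ws \<subseteq> descendants_of_set G k (horizontal_nbhd G K N\<^sub>2 w)
     \<and> horizontal_nbhd G K N (hd ws) \<inter> descendants_of_set G k (horizontal_nbhd G K N\<^sub>1 w) \<noteq> {}
     \<and> horizontal_nbhd G K N (last ws) - descendants_of_set G k (horizontal_nbhd G K N\<^sub>2 w) \<noteq> {}}"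

end

(*
  The function phi is turned into a weight g on T^(k) with g(root) = 1 whose p-th powers are
  additive: the sum of g(v)^p over the k-th generation descendants v of w is g(w)^p. Moreover
  neighbouring vertices have comparable weights, and the minimum of g over horizontal
  neighbourhoods of size M_1 + M_* still satisfies the crossing inequality: the sum along a
  crossing path of w is at least the value at w. The metric rho is the infimum of the sums of
  g over chains of cells of arbitrary levels. To bound a chain from below, its finest level is
  repeatedly replaced by the next coarser one by means of the crossing inequality. Hence
  rho(x, y) is comparable to g(w) for w containing x with diam(K_w, d) of order d(x, y), which
  yields quasisymmetry, exponentiality and adaptedness. The measure is the law of the limit point
  of a random branch passing through w with probability g(w)^p.
*)

theory Submission
  imports Defs
begin

section \<open>Rooted trees and partitions\<close>

text \<open>The hypothesis controls \<phi> only along paths that start next to the children of one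
  vertex and leave the children of its M_1-neighbourhood, with jumps of size M_1. These jumps are
  what allows iteration: cutting a path where its parents leave the M_1-neighbourhood of the current
  coarse vertex yields a coarse path whose steps are again M_1-jumps. The price is that the last
  coarse vertices of a cut path have no crossing to pay for them. This loss recurs on every level,
  and it is summable only because the weight decays geometrically along branches.

  The exponent 2e in the bound for the sum of \<phi>^p, with e = M_1 + 2M_*, has two sources:
  maximizing \<phi> over \<Gamma>_e counts each vertex up to L_*^e times, and the vertices so
  reached lie below up to L_*^e parents. The factor 1/2 reserves mass for a lower bound \<epsilon>
  on the ratio of child to parent, without which neither the comparison of neighbours nor the decay
  would be available.\<close>

context reference_tree
begin

section \<open>Geodesics, levels and parents\<close>

lemma simple_path_verts:
  assumes "simple_path G w p v"
  shows "w \<in> verts G" "v \<in> verts G"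
  using assms unfolding simple_path_def by (metis hd_in_set subsetD, metis last_in_set subsetD)

lemma simple_path_geodesic:
  "w \<in> verts G \<Longrightarrow> v \<in> verts G \<Longrightarrow> simple_path G w (geodesic G w v) v"
  unfolding geodesic_def by (rule theI'[OF tree])

lemma geodesic_eqI: "simple_path G w p v \<Longrightarrow> geodesic G w v = p"
  using tree[of w v] simple_path_geodesic[of w v] simple_path_verts[of w p v] by blast

lemma geodesic_base: "geodesic G (base G) (base G) = [base G]"
  by (rule geodesic_eqI) (auto simp: simple_path_def base_in_verts)

lemma level_base: "level G (base G) = 0"
  by (simp add: level_def geodesic_base)

lemma parent_base: "parent G (base G) = base G"
  by (simp add: parent_def)

text \<open>A prefix of a simple path is simple, so uniqueness identifies it with the geodesic to
  the parent. From here on ancestry can be followed through \<open>parent\<close> instead of through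
  lists.\<close>

lemma geodesic_snoc:
  assumes v: "v \<in> verts G" "v \<noteq> base G"
  shows "parent G v \<in> verts G" "adj G (parent G v) v"
    "geodesic G (base G) v = geodesic G (base G) (parent G v) @ [v]"
proof -
  let ?p = "geodesic G (base G) v"
  define q where "q = butlast ?p"
  have sp: "simple_path G (base G) ?p v"
    by (rule simple_path_geodesic[OF base_in_verts v(1)])
  then have p: "?p = q @ [v]"
    unfolding q_def simple_path_def by (metis append_butlast_last_id)
  have q: "q \<noteq> []"
    using sp v(2) p unfolding simple_path_def by auto
  have sq: "simple_path G (base G) q (last q)"
    using sp q unfolding p simple_path_def by (auto simp: successively_append_iff)
  have "parent G v = last q"
    using v(2) q by (simp add: parent_def level_def p nth_append last_conv_nth)
  then show "parent G v \<in> verts G" "adj G (parent G v) v"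
    "?p = geodesic G (base G) (parent G v) @ [v]"
    using simple_path_verts(2)[OF sq] geodesic_eqI[OF sq] sp p q
    by (auto simp: simple_path_def successively_append_iff)
qed

lemma geodesic_nonempty: "v \<in> verts G \<Longrightarrow> geodesic G (base G) v \<noteq> []"
  using simple_path_geodesic[OF base_in_verts] by (simp add: simple_path_def)

lemma parent_in_verts: "v \<in> verts G \<Longrightarrow> parent G v \<in> verts G"
  by (cases "v = base G") (auto simp: geodesic_snoc parent_base)

lemma level_parent:
  assumes "v \<in> verts G" "v \<noteq> base G"
  shows "level G v = Suc (level G (parent G v))"
  using geodesic_snoc[OF assms] geodesic_nonempty[of "parent G v"]
  by (cases "geodesic G (base G) (parent G v)") (auto simp: level_def)

lemma level_eq_0_iff: "v \<in> verts G \<Longrightarrow> level G v = 0 \<longleftrightarrow> v = base G"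
  using level_parent level_base by fastforce

text \<open>If \<open>v\<close> is off the geodesic to \<open>w\<close>, appending it gives the
  geodesic to \<open>v\<close>. If it is on that geodesic, the tail from \<open>v\<close> to
  \<open>w\<close> and the single edge are simple paths with the same ends, hence equal.\<close>

lemma adj_cases:
  assumes w: "w \<in> verts G" and v: "v \<in> verts G" and "adj G w v"
  shows "v \<noteq> base G \<and> parent G v = w \<or> w \<noteq> base G \<and> parent G w = v"
proof -
  let ?p = "geodesic G (base G) w"
  have sp: "simple_path G (base G) ?p w"
    by (rule simple_path_geodesic[OF base_in_verts w])
  have ne: "w \<noteq> v" using adj_irrefl assms by blast
  show ?thesis
  proof (cases "v \<in> set ?p")
    case False
    then have "simple_path G (base G) (?p @ [v]) v"
      using sp assms by (auto simp: simple_path_def successively_append_iff)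
    then have *: "geodesic G (base G) v = ?p @ [v]" by (rule geodesic_eqI)
    have "v \<noteq> base G" using False sp unfolding simple_path_def by (metis hd_in_set)
    then have "?p = geodesic G (base G) (parent G v)"
      using geodesic_snoc(3)[OF v] * by simp
    then have "parent G v = w"
      using sp simple_path_geodesic[OF base_in_verts parent_in_verts[OF v]]
      unfolding simple_path_def by metis
    then show ?thesis using \<open>v \<noteq> base G\<close> by simp
  next
    case True
    then obtain xs ys where p: "?p = xs @ v # ys" by (metis split_list)
    have "simple_path G v (v # ys) w"
      using sp unfolding simple_path_def p by (auto simp: successively_append_iff split: if_splits)
    moreover have "simple_path G v [v, w] w"
      using assms adj_sym ne by (auto simp: simple_path_def)
    ultimately have ys: "ys = [w]" using geodesic_eqI by (metis list.inject)
    have "w \<noteq> base G"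
    proof
      assume "w = base G"
      then show False using p ys by (simp add: geodesic_base)
    qed
    moreover have "geodesic G (base G) (parent G w) = xs @ [v]"
      using geodesic_snoc(3)[OF w \<open>w \<noteq> base G\<close>] p ys by simp
    then have "parent G w = v"
      using simple_path_geodesic[OF base_in_verts parent_in_verts[OF w]]
      by (simp add: simple_path_def)
    ultimately show ?thesis by simp
  qed
qed

section \<open>Children and descendants through iterated parents\<close>

lemma children_eq:
  assumes "w \<in> verts G"
  shows "children G w = {v \<in> verts G. v \<noteq> base G \<and> parent G v = w}"
proof -
  have "v \<noteq> parent G w" if "v \<in> verts G" "v \<noteq> base G" "parent G v = w" for v
    using level_parent[OF that(1,2)] level_parent[OF assms] that parent_base by fastforce
  moreover have "v \<noteq> base G \<and> parent G v = w" if "v \<in> verts G" "adj G w v" "v \<noteq> parent G w" for v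
    using adj_cases[OF assms that(1,2)] that(3) by metis
  moreover have "adj G w v" if "v \<in> verts G" "v \<noteq> base G" "parent G v = w" for v
    using geodesic_snoc(2)[OF that(1,2)] that(3) by simp
  ultimately show ?thesis unfolding children_def by blast
qed

lemma finite_children: "w \<in> verts G \<Longrightarrow> finite (children G w)"
  unfolding children_def by (rule finite_subset[OF _ locally_finite[of w]]) auto

lemma ancestor_in_verts: "v \<in> verts G \<Longrightarrow> (parent G ^^ j) v \<in> verts G"
  by (induction j) (auto simp: parent_in_verts)

lemma level_ancestor: "v \<in> verts G \<Longrightarrow> level G ((parent G ^^ j) v) = level G v - j"
proof (induction j)
  case (Suc j)
  then show ?case
    using level_parent[OF ancestor_in_verts[OF Suc.prems, of j]]
    by (cases "(parent G ^^ j) v = base G") (auto simp: parent_base level_base)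
qed simp

lemma ancestor_eq_base:
  assumes "v \<in> verts G" "level G v \<le> j"
  shows "(parent G ^^ j) v = base G"
  using level_ancestor[OF assms(1), of j] level_eq_0_iff[OF ancestor_in_verts[OF assms(1), of j]] assms(2)
  by simp

text \<open>The level equation pins \<open>j\<close> down: as \<open>parent\<close> fixes the base,
  \<open>(parent G ^^ j) v = base G\<close> alone holds for all large \<open>j\<close>.\<close>

lemma subtree_eq:
  assumes "w \<in> verts G"
  shows "subtree G w = {v \<in> verts G. \<exists>j. level G v = level G w + j \<and> (parent G ^^ j) v = w}"
proof -
  have "w \<in> set (geodesic G (base G) v) \<longleftrightarrow> (\<exists>j. level G v = level G w + j \<and> (parent G ^^ j) v = w)"
    if "v \<in> verts G" for v
    using that
  proof (induction "level G v" arbitrary: v)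
    case 0
    then have "v = base G" using level_eq_0_iff by simp
    then show ?case using level_base level_eq_0_iff[OF assms] by (auto simp: geodesic_base)
  next
    case (Suc n)
    then have v: "v \<noteq> base G" using level_base by auto
    note lp = level_parent[OF Suc.prems v]
    have "w \<in> set (geodesic G (base G) v) \<longleftrightarrow> w = v \<or> w \<in> set (geodesic G (base G) (parent G v))"
      using geodesic_snoc(3)[OF Suc.prems v] by auto
    also have "\<dots> \<longleftrightarrow> w = v \<or> (\<exists>j. level G (parent G v) = level G w + j \<and> (parent G ^^ j) (parent G v) = w)"
      using Suc lp parent_in_verts by auto
    also have "\<dots> \<longleftrightarrow> (\<exists>j. level G v = level G w + j \<and> (parent G ^^ j) v = w)" (is "?l \<longleftrightarrow> ?r")
    proof
      assume ?l
      then show ?r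
      proof
        assume "w = v" then show ?r by (intro exI[of _ 0]) simp
      next
        assume "\<exists>j. level G (parent G v) = level G w + j \<and> (parent G ^^ j) (parent G v) = w"
        then obtain j where "level G (parent G v) = level G w + j \<and> (parent G ^^ j) (parent G v) = w" ..
        then show ?r using lp by (intro exI[of _ "Suc j"]) (simp add: funpow_swap1)
      qed
    next
      assume ?r
      then obtain j where j: "level G v = level G w + j" "(parent G ^^ j) v = w" by blast
      show ?l
      proof (cases j)
        case 0 then show ?l using j by simp
      next
        case (Suc i)
        then show ?l using j lp by (intro disjI2 exI[of _ i]) (simp add: funpow_swap1)
      qed
    qed
    finally show ?case .
  qed
  then show ?thesis unfolding subtree_def by blast
qed

lemma descendants_eq:
  assumes "w \<in> verts G"
  shows "descendants G k w = {v \<in> verts G. level G v = level G w + k \<and> (parent G ^^ k) v = w}"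
  unfolding descendants_def subtree_eq[OF assms] by auto

lemma descendants_Suc:
  assumes w: "w \<in> verts G"
  shows "descendants G (Suc j) w = (\<Union>v\<in>descendants G j w. children G v)"
proof (intro equalityI subsetI)
  fix v assume "v \<in> descendants G (Suc j) w"
  then have v: "v \<in> verts G" "level G v = Suc (level G w + j)" "(parent G ^^ Suc j) v = w"
    by (auto simp: descendants_eq[OF w])
  then have "v \<noteq> base G" using level_base by auto
  then have "parent G v \<in> descendants G j w" "v \<in> children G (parent G v)"
    using v level_parent[of v] parent_in_verts[of v]
    by (auto simp: descendants_eq[OF w] children_eq funpow_swap1)
  then show "v \<in> (\<Union>v\<in>descendants G j w. children G v)" by blast
next
  fix v assume "v \<in> (\<Union>v\<in>descendants G j w. children G v)"
  then obtain u where "u \<in> descendants G j w" "v \<in> children G u" by blast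
  then have u: "u \<in> verts G" "level G u = level G w + j" "(parent G ^^ j) u = w"
    and v: "v \<in> verts G" "v \<noteq> base G" "parent G v = u"
    by (auto simp: descendants_eq[OF w] children_eq)
  have "(parent G ^^ Suc j) v = w" using u(3) v(3) by (simp only: funpow_Suc_right o_apply)
  moreover have "level G v = level G w + Suc j" using level_parent[OF v(1,2)] u(2) v(3) by simp
  ultimately show "v \<in> descendants G (Suc j) w"
    unfolding descendants_eq[OF w] using v(1) by blast
qed

lemma descendants_0: "w \<in> verts G \<Longrightarrow> descendants G 0 w = {w}"
  by (auto simp: descendants_eq)

lemma descendants_subset_verts: "descendants G j w \<subseteq> verts G"
  by (auto simp: descendants_def subtree_def)

lemma finite_descendants:
  assumes "w \<in> verts G"
  shows "finite (descendants G j w)"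
proof (induction j)
  case 0 then show ?case by (simp add: descendants_0 assms)
next
  case (Suc j)
  have "finite (children G v)" if "v \<in> descendants G j w" for v
    using finite_children descendants_subset_verts[of j w] that by blast
  then show ?case unfolding descendants_Suc[OF assms] using Suc by blast
qed

lemma card_descendants_le:
  assumes "\<And>w. w \<in> verts G \<Longrightarrow> card (children G w) \<le> N" and w: "w \<in> verts G"
  shows "card (descendants G j w) \<le> N ^ j"
proof (induction j)
  case 0 then show ?case by (simp add: descendants_0 w)
next
  case (Suc j)
  have "card (descendants G (Suc j) w) \<le> (\<Sum>v\<in>descendants G j w. card (children G v))"
    unfolding descendants_Suc[OF w] by (rule card_UN_le[OF finite_descendants[OF w]])
  also have "\<dots> \<le> (\<Sum>v\<in>descendants G j w. N)"
    by (rule sum_mono) (use descendants_subset_verts assms(1) in blast)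
  also have "\<dots> \<le> N ^ j * N" using Suc by simp
  finally show ?case by (simp add: mult.commute)
qed

end

section \<open>Cells of a partition along the tree\<close>

locale partitioned_tree = reference_tree G for G :: "'t rooted_graph" +
  fixes X :: "'x topology" and K :: "'t \<Rightarrow> 'x set"
  assumes is_partition: "is_partition G X K"
begin

lemma K_nonempty: "w \<in> verts G \<Longrightarrow> K w \<noteq> {}"
  and compactin_K: "w \<in> verts G \<Longrightarrow> compactin X (K w)"
  and K_base: "K (base G) = topspace X"
  and K_children: "w \<in> verts G \<Longrightarrow> K w = (\<Union>v\<in>children G w. K v)"
  using is_partition unfolding is_partition_def by blast+

lemma K_descendants: "w \<in> verts G \<Longrightarrow> K w = (\<Union>v\<in>descendants G j w. K v)"
proof (induction j)
  case 0 then show ?case by (simp add: descendants_0)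
next
  case (Suc j)
  have "(\<Union>v\<in>descendants G (Suc j) w. K v) = (\<Union>u\<in>descendants G j w. \<Union>v\<in>children G u. K v)"
    using descendants_Suc[OF Suc.prems] by auto
  also have "\<dots> = (\<Union>u\<in>descendants G j w. K u)"
    by (rule SUP_cong) (use K_children descendants_subset_verts[of j w] in auto)
  finally show ?case using Suc by simp
qed

lemma K_subset_topspace: "w \<in> verts G \<Longrightarrow> K w \<subseteq> topspace X"
  using compactin_K compactin_subset_topspace by blast

lemma K_subset_parent: "v \<in> verts G \<Longrightarrow> K v \<subseteq> K (parent G v)"
proof (cases "v = base G")
  case False
  assume v: "v \<in> verts G"
  have "v \<in> children G (parent G v)"
    using False v by (simp add: children_eq[OF parent_in_verts])
  then show ?thesis using K_children[OF parent_in_verts[OF v]] by blast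
qed (simp add: parent_base)

lemma K_subset_ancestor:
  assumes "v \<in> verts G"
  shows "K v \<subseteq> K ((parent G ^^ j) v)"
proof (induction j)
  case (Suc j)
  then show ?case using K_subset_parent[OF ancestor_in_verts[OF assms], of j] by simp
qed simp

lemma covering: "x \<in> topspace X \<Longrightarrow> \<exists>w\<in>level_set G n. x \<in> K w"
  using K_descendants[OF base_in_verts, of n] K_base
  by (auto simp: descendants_eq base_in_verts level_base level_set_def)

end

section \<open>Trees of cells with geometric diameters\<close>

text \<open>This locale describes \<open>V = T^(k)\<close> with \<open>lev\<close> counting generations of \<open>T^(k)\<close>, \<open>P = \<pi>^k\<close> and
  \<open>q = r^k\<close>. The set \<open>\<Gamma>\<^sub>i(w)\<close> is the image of \<open>w\<close> under the \<open>i\<close>-th power of the relation \<open>R\<close> below.\<close>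

locale scaled_tree =
  fixes V :: "'t set" and lev :: "'t \<Rightarrow> nat" and P :: "'t \<Rightarrow> 't" and root :: 't
    and K :: "'t \<Rightarrow> 'x set" and X :: "'x set" and d :: "'x \<Rightarrow> 'x \<Rightarrow> real"
    and q a c\<^sub>1 c\<^sub>2 :: real and M N :: nat
  assumes root_in_V: "root \<in> V"
    and lev_root: "lev root = 0"
    and lev_0D: "\<And>v. v \<in> V \<Longrightarrow> lev v = 0 \<Longrightarrow> v = root"
    and P_in_V: "\<And>v n. v \<in> V \<Longrightarrow> lev v = Suc n \<Longrightarrow> P v \<in> V"
    and lev_P: "\<And>v n. v \<in> V \<Longrightarrow> lev v = Suc n \<Longrightarrow> lev (P v) = n"
    and K_root: "K root = X"
    and K_nonempty: "\<And>v. v \<in> V \<Longrightarrow> K v \<noteq> {}"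
    and K_eq_UN: "\<And>w. w \<in> V \<Longrightarrow> K w = (\<Union>v\<in>{v \<in> V. lev v = Suc (lev w) \<and> P v = w}. K v)"
    and finite_ch': "\<And>w. w \<in> V \<Longrightarrow> finite {v \<in> V. lev v = Suc (lev w) \<and> P v = w}"
    and card_ch': "\<And>w. w \<in> V \<Longrightarrow> card {v \<in> V. lev v = Suc (lev w) \<and> P v = w} \<le> N"
    and metric: "Metric_space X d"
    and q: "0 < q" "q < 1" and a_pos: "a > 0" and c\<^sub>1_pos: "c\<^sub>1 > 0"
    and dist_le: "\<And>w x y. w \<in> V \<Longrightarrow> x \<in> K w \<Longrightarrow> y \<in> K w \<Longrightarrow> d x y \<le> c\<^sub>2 * q ^ lev w"
    and dist_ge: "\<And>w. w \<in> V \<Longrightarrow> \<exists>x\<in>K w. \<exists>y\<in>K w. c\<^sub>1 * q ^ lev w \<le> d x y"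
    and M_ge_1: "M \<ge> 1"
begin

definition R :: "('t \<times> 't) set" where
  "R = {(u, v). u \<in> V \<and> v \<in> V \<and> lev u = lev v \<and> K u \<inter> K v \<noteq> {}}"

definition ch :: "'t \<Rightarrow> 't set" where
  "ch w = {v \<in> V. lev v = Suc (lev w) \<and> P v = w}"

lemma finite_ch: "w \<in> V \<Longrightarrow> finite (ch w)" and card_ch: "w \<in> V \<Longrightarrow> card (ch w) \<le> N"
  and K_ch: "w \<in> V \<Longrightarrow> K w = (\<Union>v\<in>ch w. K v)"
  unfolding ch_def by (rule finite_ch' card_ch' K_eq_UN; assumption)+

lemma ch_P: "v \<in> V \<Longrightarrow> lev v = Suc n \<Longrightarrow> v \<in> ch (P v)"
  by (simp add: ch_def lev_P)

lemma K_subset_P: "v \<in> V \<Longrightarrow> lev v = Suc n \<Longrightarrow> K v \<subseteq> K (P v)"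
  using K_ch[OF P_in_V] ch_P by blast

section \<open>Horizontal walks as powers of \<open>R\<close>\<close>

lemma relpow_R_sym: "(u, v) \<in> R ^^ i \<Longrightarrow> (v, u) \<in> R ^^ i"
proof (induction i arbitrary: v)
  case (Suc i)
  then obtain y where "(u, y) \<in> R ^^ i" "(y, v) \<in> R" by auto
  then show ?case using Suc.IH relpow_Suc_I2[of v y R u i] by (auto simp: R_def)
qed auto

lemma R_refl: "v \<in> V \<Longrightarrow> (v, v) \<in> R"
  using K_nonempty by (auto simp: R_def)

lemma relpow_R_invariants:
  "(u, v) \<in> R ^^ i \<Longrightarrow> u \<in> V \<Longrightarrow> v \<in> V \<and> lev v = lev u"
proof (induction i arbitrary: v)
  case (Suc i)
  then obtain y where "(u, y) \<in> R ^^ i" "(y, v) \<in> R" by (elim relpow_Suc_E)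
  then show ?case using Suc.IH[of y] Suc.prems(2) by (simp add: R_def)
qed simp

lemma relpow_R_refl: "v \<in> V \<Longrightarrow> (v, v) \<in> R ^^ i"
proof (induction i)
  case (Suc i)
  show ?case by (rule relpow_Suc_I[OF Suc.IH[OF Suc.prems] R_refl[OF Suc.prems]])
qed simp

text \<open>Cells are nonempty, so \<open>R\<close> is reflexive and a short walk can be padded with
  constant steps.\<close>

lemma relpow_R_mono:
  assumes "(u, v) \<in> R ^^ i" "i \<le> j" "u \<in> V"
  shows "(u, v) \<in> R ^^ j"
proof -
  have "(v, v) \<in> R ^^ (j - i)" using relpow_R_refl relpow_R_invariants assms by blast
  then have "(u, v) \<in> R ^^ (i + (j - i))" using assms(1) unfolding relpow_add by blast
  then show ?thesis using assms(2) by simp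
qed

lemma R_imp_relpow: "(u, v) \<in> R \<Longrightarrow> 1 \<le> j \<Longrightarrow> (u, v) \<in> R ^^ j"
  using relpow_R_mono[of u v 1 j] by (auto simp: R_def)

lemma relpow_R_trans: "(u, v) \<in> R ^^ i \<Longrightarrow> (v, w) \<in> R ^^ j \<Longrightarrow> (u, w) \<in> R ^^ (i + j)"
  unfolding relpow_add by blast

lemma R_P: "(u, v) \<in> R \<Longrightarrow> lev u = Suc n \<Longrightarrow> (P u, P v) \<in> R"
  using K_subset_P[of u n] K_subset_P[of v n] P_in_V[of u n] P_in_V[of v n] lev_P[of u n] lev_P[of v n]
  unfolding R_def by auto

text \<open>Passing to parents enlarges cells, so walks go to walks of the same length. The
  contraction hypotheses \<open>contract_M\<close> and \<open>contract_J\<close> improve on this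
  length.\<close>

lemma relpow_R_P:
  "(u, v) \<in> R ^^ i \<Longrightarrow> u \<in> V \<Longrightarrow> lev u = Suc n \<Longrightarrow> (P u, P v) \<in> R ^^ i"
proof (induction i arbitrary: v)
  case (Suc i)
  then obtain y where y: "(u, y) \<in> R ^^ i" "(y, v) \<in> R" by auto
  then have "lev y = Suc n" using relpow_R_invariants Suc.prems by metis
  then show ?case using relpow_Suc_I[OF Suc.IH[OF y(1)] R_P[OF y(2)]] Suc.prems by simp
qed simp

lemma covering: "x \<in> X \<Longrightarrow> \<exists>w\<in>V. lev w = n \<and> x \<in> K w"
proof (induction n)
  case 0 then show ?case using root_in_V lev_root K_root by auto
next
  case (Suc n)
  then obtain w where w: "w \<in> V" "lev w = n" "x \<in> K w" by blast
  then obtain v where "v \<in> ch w" "x \<in> K v" using K_ch by blast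
  then show ?case using w by (auto simp: ch_def)
qed

lemma descend:
  assumes "w \<in> V" "x \<in> K w"
  shows "\<exists>v\<in>V. lev v = lev w + j \<and> x \<in> K v \<and> (P ^^ j) v = w"
proof (induction j)
  case 0 then show ?case using assms by auto
next
  case (Suc j)
  then obtain v where v: "v \<in> V" "lev v = lev w + j" "x \<in> K v" "(P ^^ j) v = w" by blast
  then obtain u where "u \<in> ch v" "x \<in> K u" using K_ch by blast
  then show ?case using v by (intro bexI[of _ u]) (auto simp: ch_def funpow_swap1[symmetric] funpow_Suc_right simp del: funpow.simps)
qed

lemma ascend:
  assumes "v \<in> V" "lev v = n + j"
  shows "(P ^^ j) v \<in> V" "lev ((P ^^ j) v) = n" "K v \<subseteq> K ((P ^^ j) v)"
proof -
  have "(P ^^ j) v \<in> V \<and> lev ((P ^^ j) v) = n \<and> K v \<subseteq> K ((P ^^ j) v)"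
    using assms
  proof (induction j arbitrary: n)
    case (Suc j)
    then have IH: "(P ^^ j) v \<in> V" "lev ((P ^^ j) v) = Suc n" "K v \<subseteq> K ((P ^^ j) v)"
      using Suc.IH[of "Suc n"] by auto
    then show ?case using P_in_V lev_P K_subset_P by fastforce
  qed auto
  then show "(P ^^ j) v \<in> V" "lev ((P ^^ j) v) = n" "K v \<subseteq> K ((P ^^ j) v)" by auto
qed

lemma K_subset_X:
  assumes "v \<in> V" shows "K v \<subseteq> X"
  using ascend[OF assms, of 0 "lev v"] lev_0D K_root by auto

lemma level_0: "{v \<in> V. lev v = 0} = {root}"
  using root_in_V lev_root lev_0D by blast

lemma level_Suc: "{v \<in> V. lev v = Suc n} = (\<Union>w\<in>{v \<in> V. lev v = n}. ch w)"
proof (intro equalityI subsetI)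
  fix v assume "v \<in> {v \<in> V. lev v = Suc n}"
  then show "v \<in> (\<Union>w\<in>{v \<in> V. lev v = n}. ch w)"
    using P_in_V[of v n] lev_P[of v n] ch_P[of v n] by blast
qed (auto simp: ch_def)

lemma finite_level: "finite {v \<in> V. lev v = n}"
  by (induction n) (auto simp: level_0 level_Suc finite_ch)

lemma finite_nb: "u \<in> V \<Longrightarrow> finite ((R ^^ i) `` {u})"
  by (rule finite_subset[OF _ finite_level[of "lev u"]]) (auto dest: relpow_R_invariants)

sublocale metric_X: Metric_space X d by (rule metric)

lemma c\<^sub>2_pos: "c\<^sub>2 > 0"
proof -
  obtain x y where "x \<in> K root" "y \<in> K root" "c\<^sub>1 * q ^ lev root \<le> d x y"
    using dist_ge root_in_V by blast
  then have "c\<^sub>1 \<le> c\<^sub>2" using dist_le[OF root_in_V, of x y] lev_root by simp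
  then show ?thesis using c\<^sub>1_pos by simp
qed

lemma dist_nb:
  assumes "(u, v) \<in> R ^^ i" "u \<in> V" "x \<in> K u" "y \<in> K v"
  shows "d x y \<le> (real i + 1) * (c\<^sub>2 * q ^ lev u)"
  using assms(1,4)
proof (induction i arbitrary: v y)
  case 0 then show ?case using dist_le assms by auto
next
  case (Suc i)
  then obtain t where t: "(u, t) \<in> R ^^ i" "(t, v) \<in> R" by auto
  then obtain z where z: "z \<in> K t" "z \<in> K v" by (auto simp: R_def)
  have tv: "t \<in> V" "v \<in> V" "lev t = lev u" "lev v = lev u"
    using t relpow_R_invariants[OF t(1) assms(2)] by (auto simp: R_def)
  have "d x y \<le> d x z + d z y"
    using assms z Suc.prems tv K_subset_X by (intro metric_X.triangle) auto
  also have "d x z \<le> (real i + 1) * (c\<^sub>2 * q ^ lev u)" using Suc.IH[OF t(1) z(1)] .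
  also have "d z y \<le> c\<^sub>2 * q ^ lev u" using dist_le[OF tv(2) z(2) Suc.prems(2)] tv by simp
  finally show ?case by (simp add: algebra_simps)
qed

text \<open>If \<open>v\<close> were the only descendant \<open>m\<close> generations below
  \<open>w\<close>, then \<open>K w\<close> would be contained in \<open>K v\<close>, which is too
  small once \<open>c\<^sub>2 * q ^ m < c\<^sub>1\<close>. The second descendant is what forces the
  weight to decay in \<open>g_decay\<close>.\<close>

lemma no_single_descendant:
  "\<exists>m\<ge>1. \<forall>w\<in>V. \<forall>v\<in>V. lev v = lev w + m \<longrightarrow> (P ^^ m) v = w
      \<longrightarrow> (\<exists>v'\<in>V. v' \<noteq> v \<and> lev v' = lev w + m \<and> (P ^^ m) v' = w)"
proof -
  have "(\<lambda>m. c\<^sub>2 * q ^ m) \<longlonglongrightarrow> c\<^sub>2 * 0"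
    using q by (intro tendsto_intros LIMSEQ_realpow_zero) auto
  then have "\<forall>\<^sub>F m in sequentially. c\<^sub>2 * q ^ m < c\<^sub>1"
    using c\<^sub>1_pos order_tendstoD(2) by fastforce
  then have "\<forall>\<^sub>F m in sequentially. c\<^sub>2 * q ^ m < c\<^sub>1 \<and> 1 \<le> m"
    using eventually_ge_at_top[of 1] by eventually_elim simp
  then obtain m where m: "c\<^sub>2 * q ^ m < c\<^sub>1" "m \<ge> 1"
    unfolding eventually_sequentially by blast
  have "\<exists>v'\<in>V. v' \<noteq> v \<and> lev v' = lev w + m \<and> (P ^^ m) v' = w"
    if *: "w \<in> V" "v \<in> V" "lev v = lev w + m" "(P ^^ m) v = w" for v w
  proof (rule ccontr)
    assume neg: "\<not> ?thesis"
    have "K w \<subseteq> K v"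
    proof
      fix x assume "x \<in> K w"
      then show "x \<in> K v" using descend[OF \<open>w \<in> V\<close>, of x m] neg by metis
    qed
    moreover obtain x y where "x \<in> K w" "y \<in> K w" "c\<^sub>1 * q ^ lev w \<le> d x y"
      using dist_ge * by blast
    ultimately have "c\<^sub>1 * q ^ lev w \<le> c\<^sub>2 * q ^ lev v" using dist_le[OF \<open>v \<in> V\<close>, of x y] by force
    also have "\<dots> = (c\<^sub>2 * q ^ m) * q ^ lev w" using * by (simp add: power_add)
    also have "\<dots> < c\<^sub>1 * q ^ lev w" using m q by simp
    finally show False by simp
  qed
  then show ?thesis using m(2) by blast
qed

end

section \<open>A balanced multiplicative weight\<close>

text \<open>\<open>J\<close> stands for M_1, \<open>M\<close> for M_* and \<open>L\<close> for L_*.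
  In \<open>crossing\<close>, \<open>u\<close> and \<open>t\<close> are the witnesses for the two
  end conditions of a crossing path; \<open>near_chain\<close> is the form in which adaptedness of
  \<open>d\<close> enters.\<close>

locale admissible_weight = scaled_tree +
  fixes J L :: nat and \<phi> :: "'a \<Rightarrow> real" and p :: real
  assumes J_ge_1: "J \<ge> 1" and p_pos: "p > 0"
    and contract_M: "\<And>u v n. (u, v) \<in> R ^^ (M + M) \<Longrightarrow> u \<in> V \<Longrightarrow> lev u = Suc n \<Longrightarrow> (P u, P v) \<in> R ^^ M"
    and contract_J: "\<And>u v n. (u, v) \<in> R ^^ (J + M) \<Longrightarrow> u \<in> V \<Longrightarrow> lev u = Suc n \<Longrightarrow> (P u, P v) \<in> R ^^ M"
    and card_R: "\<And>u. u \<in> V \<Longrightarrow> card (R `` {u}) \<le> L"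
    and inner_child: "\<And>w. w \<in> V \<Longrightarrow> \<exists>v\<in>ch w. R `` {v} \<subseteq> ch w"
    and \<phi>_pos: "\<And>v. v \<in> V \<Longrightarrow> 0 < \<phi> v"
    and \<phi>_le_1: "\<And>v. v \<in> V \<Longrightarrow> \<phi> v \<le> 1"
    and crossing: "\<And>w vs u t. w \<in> V \<Longrightarrow> vs \<noteq> [] \<Longrightarrow>
        (\<And>v. v \<in> set vs \<Longrightarrow> v \<in> V \<and> lev v = Suc (lev w) \<and> (w, P v) \<in> R ^^ J) \<Longrightarrow>
        successively (\<lambda>u v. (u, v) \<in> R ^^ J) vs \<Longrightarrow>
        u \<in> ch w \<Longrightarrow> (u, hd vs) \<in> R ^^ J \<Longrightarrow>
        (last vs, t) \<in> R ^^ J \<Longrightarrow> (w, P t) \<notin> R ^^ J \<Longrightarrow>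
        1 \<le> sum_list (map \<phi> vs)"
    and sum_\<phi>: "\<And>w. w \<in> V \<Longrightarrow> (\<Sum>v\<in>ch w. \<phi> v powr p) \<le> 1 / 2 / real L ^ (2 * (J + 2 * M))"
    and near_chain: "\<And>x y n. x \<in> X \<Longrightarrow> y \<in> X \<Longrightarrow> d x y < a * q ^ n \<Longrightarrow>
        \<exists>u v. (u, v) \<in> R ^^ M \<and> u \<in> V \<and> lev u = n \<and> x \<in> K u \<and> y \<in> K v"
    and branch_nonempty: "\<And>\<omega>. \<omega> 0 = root \<Longrightarrow> (\<And>n. \<omega> (Suc n) \<in> ch (\<omega> n)) \<Longrightarrow> (\<Inter>n. K (\<omega> n)) \<noteq> {}"
    and K_closed: "\<And>w. w \<in> V \<Longrightarrow> closedin (Metric_space.mtopology X d) (K w)"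
begin

section \<open>Level-by-level construction of the weight\<close>

lemma L_pos: "L > 0"
proof -
  have "finite (R `` {root})" using finite_nb[OF root_in_V, of 1] by simp
  moreover have "root \<in> R `` {root}" using R_refl root_in_V by blast
  ultimately have "card (R `` {root}) > 0" by (auto simp: card_gt_0_iff)
  then show ?thesis using card_R[OF root_in_V] by simp
qed

lemma card_nb:
  assumes "u \<in> V"
  shows "card ((R ^^ i) `` {u}) \<le> L ^ i"
proof (induction i)
  case (Suc i)
  have "(R ^^ Suc i) `` {u} = (\<Union>t\<in>(R ^^ i) `` {u}. R `` {t})" by auto
  then have "card ((R ^^ Suc i) `` {u}) \<le> (\<Sum>t\<in>(R ^^ i) `` {u}. card (R `` {t}))"
    using card_UN_le[OF finite_nb[OF assms, of i], of "\<lambda>t. R `` {t}"] by simp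
  also have "\<dots> \<le> (\<Sum>t\<in>(R ^^ i) `` {u}. L)"
    by (rule sum_mono) (use relpow_R_invariants assms card_R in blast)
  also have "\<dots> \<le> L ^ i * L" using Suc by simp
  finally show ?case by (simp add: mult.commute)
qed simp

text \<open>Double counting with e = \<open>J + 2 * M\<close>: each \<open>u\<close> is reached from
  at most \<open>L ^ e\<close> children of \<open>w\<close>, and all these \<open>u\<close> are
  children of at most \<open>L ^ e\<close> vertices, each contributing at most
  \<open>1 / 2 / L ^ (2 * e)\<close>.\<close>

lemma sum_smoothed:
  assumes w: "w \<in> V"
  shows "(\<Sum>v\<in>ch w. \<Sum>u\<in>(R ^^ (J + 2 * M)) `` {v}. \<phi> u powr p) \<le> 1 / 2"
proof -
  define e where "e = J + 2 * M"
  define U where "U = (\<Union>w'\<in>(R ^^ e) `` {w}. ch w')"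
  have nbw: "w' \<in> V" "lev w' = lev w" if "w' \<in> (R ^^ e) `` {w}" for w'
    using relpow_R_invariants[of w w' e] that w by auto
  have fU: "finite U"
    unfolding U_def using finite_nb[OF w, of e] finite_ch nbw by blast
  have sub: "(R ^^ e) `` {v} = {u \<in> U. (v, u) \<in> R ^^ e}" if v: "v \<in> ch w" for v
  proof -
    have v': "v \<in> V" "lev v = Suc (lev w)" "P v = w" using v by (auto simp: ch_def)
    have "u \<in> U" if "(v, u) \<in> R ^^ e" for u
    proof -
      have "(w, P u) \<in> R ^^ e" using relpow_R_P[OF that v'(1,2)] v' by simp
      moreover have "u \<in> ch (P u)"
        using relpow_R_invariants[OF that v'(1)] v' ch_P by simp
      ultimately show ?thesis unfolding U_def by blast
    qed
    then show ?thesis by blast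
  qed
  have "(\<Sum>v\<in>ch w. \<Sum>u\<in>(R ^^ e) `` {v}. \<phi> u powr p)
      = (\<Sum>v\<in>ch w. \<Sum>u | u \<in> U \<and> (v, u) \<in> R ^^ e. \<phi> u powr p)"
    by (rule sum.cong) (use sub in auto)
  also have "\<dots> = (\<Sum>u\<in>U. \<Sum>v | v \<in> ch w \<and> (v, u) \<in> R ^^ e. \<phi> u powr p)"
    by (rule sum.swap_restrict[OF finite_ch[OF w] fU])
  also have "\<dots> \<le> (\<Sum>u\<in>U. real L ^ e * \<phi> u powr p)"
  proof (rule sum_mono)
    fix u assume "u \<in> U"
    then have u: "u \<in> V" unfolding U_def ch_def by blast
    have "card {v. v \<in> ch w \<and> (v, u) \<in> R ^^ e} \<le> card ((R ^^ e) `` {u})"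
      by (rule card_mono[OF finite_nb[OF u]]) (use relpow_R_sym in blast)
    also have "\<dots> \<le> L ^ e" by (rule card_nb[OF u])
    finally have "real (card {v. v \<in> ch w \<and> (v, u) \<in> R ^^ e}) \<le> real L ^ e"
      using of_nat_mono by fastforce
    then show "(\<Sum>v | v \<in> ch w \<and> (v, u) \<in> R ^^ e. \<phi> u powr p) \<le> real L ^ e * \<phi> u powr p"
      by (simp add: mult_right_mono)
  qed
  also have "\<dots> = real L ^ e * (\<Sum>u\<in>U. \<phi> u powr p)" by (simp add: sum_distrib_left)
  finally have 1: "(\<Sum>v\<in>ch w. \<Sum>u\<in>(R ^^ e) `` {v}. \<phi> u powr p)
    \<le> real L ^ e * (\<Sum>u\<in>U. \<phi> u powr p)" .
  have "(\<Sum>u\<in>U. \<phi> u powr p) = (\<Sum>w'\<in>(R ^^ e) `` {w}. \<Sum>u\<in>ch w'. \<phi> u powr p)"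
    unfolding U_def
  proof (rule sum.UNION_disjoint)
    show "\<forall>w'\<in>(R ^^ e) `` {w}. finite (ch w')" using finite_ch nbw(1) by blast
  qed (use finite_nb[OF w] in \<open>auto simp: ch_def\<close>)
  also have "\<dots> \<le> (\<Sum>w'\<in>(R ^^ e) `` {w}. 1 / 2 / real L ^ (2 * e))"
    by (rule sum_mono) (use sum_\<phi> nbw(1) in \<open>simp add: e_def\<close>)
  also have "\<dots> = real (card ((R ^^ e) `` {w})) * (1 / 2 / real L ^ (2 * e))" by simp
  also have "\<dots> \<le> real (L ^ e) * (1 / 2 / real L ^ (2 * e))"
    by (intro mult_right_mono of_nat_mono card_nb[OF w]) simp
  finally have "real L ^ e * (\<Sum>u\<in>U. \<phi> u powr p) \<le> real L ^ e * (real (L ^ e) * (1 / 2 / real L ^ (2 * e)))"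
    by (rule mult_left_mono) simp
  also have "\<dots> = 1 / 2"
  proof -
    have "x * (x * (1 / 2 / (x * x))) = 1 / 2" if "x > 0" for x :: real
      using that by (simp add: field_simps)
    moreover have "real L ^ (2 * e) = real L ^ e * real L ^ e" "real (L ^ e) = real L ^ e"
      by (simp_all only: mult_2 power_add of_nat_power)
    ultimately show ?thesis using L_pos by (simp only:) simp
  qed
  finally have "(\<Sum>v\<in>ch w. \<Sum>u\<in>(R ^^ e) `` {v}. \<phi> u powr p) \<le> 1 / 2"
    using 1 by (rule order_trans[rotated])
  then show ?thesis unfolding e_def .
qed

text \<open>One generation of the weight. The function \<open>h\<close> multiplies \<open>f\<close> by a maximum of \<open>\<phi>\<close> over
  \<open>\<Gamma>\<^bsub>J+M\<^esub>\<close>, and \<open>h'\<close> is its smallest majorant that decays by at most a factor \<open>B\<close> per step within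
  distance \<open>M\<close>. Truncating the maximum at distance \<open>M\<close> does not destroy the balance since
  \<open>P\<close> maps \<open>\<Gamma>\<^bsub>2M\<^esub>\<close> into \<open>\<Gamma>\<^bsub>M\<^esub>\<close>. In total \<open>\<phi>\<close> is maximized over \<open>\<Gamma>\<^bsub>J+2M\<^esub>\<close>, which accounts for
  the constant in the hypothesis on \<open>\<phi>\<close>. The mass missing from \<open>f(w)^p\<close> is put on a child
  whose neighbours are all children of \<open>w\<close>.\<close>

lemma weight_step:
  fixes \<epsilon> B :: real and f :: "'a \<Rightarrow> real"
  assumes \<epsilon>: "0 < \<epsilon>" "\<epsilon> \<le> 1" "real N * \<epsilon> powr p \<le> 1 / 2" and B: "1 \<le> \<epsilon> * B"
    and f_pos: "\<And>v. v \<in> V \<Longrightarrow> lev v = n \<Longrightarrow> 0 < f v"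
    and f_bal: "\<And>u v. (u, v) \<in> R \<Longrightarrow> lev u = n \<Longrightarrow> f u \<le> B * f v"
  shows "\<exists>f'. (\<forall>v\<in>V. lev v = Suc n \<longrightarrow> \<epsilon> * f (P v) \<le> f' v)
    \<and> (\<forall>u v. (u, v) \<in> R \<longrightarrow> lev u = Suc n \<longrightarrow> f' u \<le> B * f' v)
    \<and> (\<forall>w\<in>V. lev w = n \<longrightarrow> (\<Sum>v\<in>ch w. f' v powr p) = f w powr p)
    \<and> (\<forall>u v. u \<in> V \<longrightarrow> lev u = Suc n \<longrightarrow> (u, v) \<in> R ^^ (J + M) \<longrightarrow> \<phi> u * f (P v) \<le> f' v)"
proof -
  have B1: "B \<ge> 1" using B \<epsilon> mult_left_le_one_le[of B \<epsilon>]
    by (smt (verit) mult_less_0_iff mult_left_le)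
  have f_bal_i: "f u \<le> B ^ i * f v" if "(u, v) \<in> R ^^ i" "u \<in> V" "lev u = n" for u v i
    using that(1)
  proof (induction i arbitrary: v)
    case (Suc i)
    then obtain y where y: "(u, y) \<in> R ^^ i" "(y, v) \<in> R" by (elim relpow_Suc_E)
    have "f u \<le> B ^ i * f y" by (rule Suc.IH[OF y(1)])
    also have "\<dots> \<le> B ^ i * (B * f v)"
      using f_bal[OF y(2)] relpow_R_invariants[OF y(1) that(2)] that(3) B1
      by (intro mult_left_mono) auto
    finally show ?case by (simp add: mult_ac)
  qed simp
  \<comment> \<open>The floor \<epsilon> keeps every child above \<epsilon> times its parent; it
    uses at most \<open>real N * \<epsilon> powr p\<close>, hence at most half of the mass.\<close>
  define s where "s = (\<lambda>v. Max (insert \<epsilon> (\<phi> ` ((R ^^ (J + M)) `` {v}))))"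
  define h where "h = (\<lambda>v. s v * f (P v))"
  define S where "S = (\<lambda>v. (\<lambda>(j, u). h u / B ^ j) ` (SIGMA j:{..M}. (R ^^ j) `` {v}))"
  define h' where "h' = (\<lambda>v. Max (S v))"
  have s_fin: "finite (insert \<epsilon> (\<phi> ` ((R ^^ (J + M)) `` {v})))" if "v \<in> V" for v
    using finite_nb[OF that] by simp
  have s_ge: "\<epsilon> \<le> s v" if "v \<in> V" for v
    unfolding s_def using s_fin[OF that] by (intro Max_ge) auto
  have s_ge_\<phi>: "\<phi> u \<le> s v" if "v \<in> V" "(v, u) \<in> R ^^ (J + M)" for u v
    unfolding s_def using s_fin[OF that(1)] that(2) by (intro Max_ge) auto
  have s_cases: "s v = \<epsilon> \<or> (\<exists>u. (v, u) \<in> R ^^ (J + M) \<and> s v = \<phi> u)" if "v \<in> V" for v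
    using Max_in[OF s_fin[OF that]] unfolding s_def by blast
  have s_le: "s v \<le> 1" if "v \<in> V" for v
    using s_cases[OF that] \<epsilon> \<phi>_le_1 relpow_R_invariants that by metis
  have S_fin: "finite (S v)" if "v \<in> V" for v
    unfolding S_def using finite_nb[OF that] by auto
  have S_I: "h u / B ^ j \<in> S v" if "j \<le> M" "(v, u) \<in> R ^^ j" for u v j
    unfolding S_def using that by force
  have S_ne: "S v \<noteq> {}" if "v \<in> V" for v using S_I[of 0 v v] by auto
  have h'_ge: "h u / B ^ j \<le> h' v" if "j \<le> M" "(v, u) \<in> R ^^ j" "v \<in> V" for u v j
    unfolding h'_def using S_fin S_I that by (intro Max_ge) auto
  have h'_eq: "\<exists>j u. j \<le> M \<and> (v, u) \<in> R ^^ j \<and> h' v = h u / B ^ j" if "v \<in> V" for v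
    using Max_in[OF S_fin[OF that] S_ne[OF that]] unfolding h'_def S_def by auto
  have fP_pos: "0 < f (P v)" if "v \<in> V" "lev v = Suc n" for v
    using f_pos[OF P_in_V[OF that] lev_P[OF that]] .
  have h_le_h': "h v \<le> h' v" if "v \<in> V" for v using h'_ge[of 0 v v] that by simp
  have h_ge: "\<epsilon> * f (P v) \<le> h v" if "v \<in> V" "lev v = Suc n" for v
    unfolding h_def using s_ge[OF that(1)] fP_pos[OF that] by (intro mult_right_mono) auto
  have h_le: "h v \<le> f (P v)" if "v \<in> V" "lev v = Suc n" for v
    unfolding h_def using s_le fP_pos[OF that] that mult_right_mono[of "s v" 1 "f (P v)"] by auto
  have h'_lower: "\<epsilon> * f (P v) \<le> h' v" if "v \<in> V" "lev v = Suc n" for v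
    using h_ge h_le_h' that by fastforce
  have h'_pos: "0 < h' v" if "v \<in> V" "lev v = Suc n" for v
    using h'_lower[OF that] mult_pos_pos[OF \<epsilon>(1) fP_pos[OF that]] by linarith
  have h'_bal: "h' u \<le> B * h' v" if uv: "(u, v) \<in> R" "lev u = Suc n" for u v
  proof -
    have V: "u \<in> V" "v \<in> V" "lev v = Suc n" using uv by (auto simp: R_def)
    obtain j t where t: "j \<le> M" "(u, t) \<in> R ^^ j" "h' u = h t / B ^ j" using h'_eq[OF V(1)] by blast
    have "(v, u) \<in> R" using relpow_R_sym[of u v 1] uv by simp
    then have vt: "(v, t) \<in> R ^^ Suc j" using t(2) relpow_Suc_I2 by metis
    show ?thesis
    proof (cases "j < M")
      case True
      then have "h t / B ^ Suc j \<le> h' v" using h'_ge[OF _ vt V(2)] by simp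
      then have "B * (h t / B ^ Suc j) \<le> B * h' v" using B1 by (intro mult_left_mono) auto
      then show ?thesis using t(3) B1 by simp
    next
      case False
      then have j: "j = M" using t by simp
      \<comment> \<open>The witness is now too far from \<open>v\<close> to be used for it.
        Contraction still puts its parent within \<open>M\<close> of \<open>P v\<close>, so dividing
        by \<open>B ^ M\<close> brings \<open>h' u\<close> below \<open>f (P v)\<close>, and the
        floor \<epsilon> takes over.\<close>
      have "(v, t) \<in> R ^^ (M + M)"
        using relpow_R_mono[OF vt, of "M + M"] V M_ge_1 j by simp
      then have "(P v, P t) \<in> R ^^ M" using contract_M V by blast
      then have "(P t, P v) \<in> R ^^ M" by (rule relpow_R_sym)
      moreover have tV: "t \<in> V" "lev t = Suc n" using relpow_R_invariants[OF t(2) V(1)] uv by auto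
      ultimately have "f (P t) \<le> B ^ M * f (P v)"
        using f_bal_i P_in_V lev_P by blast
      then have "h t \<le> B ^ M * f (P v)" using h_le[OF tV] by linarith
      then have "h' u \<le> f (P v)" using t(3) j B1 by (simp add: divide_le_eq mult.commute)
      also have "\<dots> \<le> (\<epsilon> * B) * f (P v)" using B fP_pos[OF V(2,3)] by simp
      also have "\<dots> = B * (\<epsilon> * f (P v))" by simp
      also have "\<dots> \<le> B * h' v" using h'_lower[OF V(2,3)] B1 by (intro mult_left_mono) auto
      finally show ?thesis .
    qed
  qed
  have h'_upper: "h' v powr p \<le> (\<epsilon> powr p + (\<Sum>u\<in>(R ^^ (J + 2 * M)) `` {v}. \<phi> u powr p)) * f (P v) powr p"
    if v: "v \<in> V" "lev v = Suc n" for v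
  proof -
    obtain j t where t: "j \<le> M" "(v, t) \<in> R ^^ j" "h' v = h t / B ^ j" using h'_eq[OF v(1)] by blast
    have tV: "t \<in> V" "lev t = Suc n" using relpow_R_invariants[OF t(2) v(1)] v by auto
    \<comment> \<open>The division by \<open>B ^ j\<close> absorbs the drift of \<open>f\<close>
      between the two parents; only the maximum \<open>s t\<close> remains, and a maximum is at most
      the sum.\<close>
    have "(P t, P v) \<in> R ^^ j" using relpow_R_sym[OF relpow_R_P[OF t(2) v]] .
    then have "f (P t) \<le> B ^ j * f (P v)" using f_bal_i P_in_V lev_P tV by blast
    then have "f (P t) / B ^ j \<le> f (P v)" using B1 by (simp add: field_simps)
    then have "h' v \<le> s t * f (P v)"
      unfolding t(3) h_def using mult_left_mono[of "f (P t) / B ^ j" "f (P v)" "s t"] s_ge[OF tV(1)] \<epsilon>(1) by simp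
    then have "h' v powr p \<le> (s t * f (P v)) powr p"
      using h'_pos[OF v] p_pos by (intro powr_mono2) auto
    also have "\<dots> = s t powr p * f (P v) powr p"
      using s_ge[OF tV(1)] \<epsilon>(1) fP_pos[OF v] by (simp add: powr_mult)
    also have "s t powr p \<le> \<epsilon> powr p + (\<Sum>u\<in>(R ^^ (J + 2 * M)) `` {v}. \<phi> u powr p)"
      using s_cases[OF tV(1)]
    proof
      assume "s t = \<epsilon>" then show ?thesis by (simp add: sum_nonneg)
    next
      assume "\<exists>u. (t, u) \<in> R ^^ (J + M) \<and> s t = \<phi> u"
      then obtain u where u: "(t, u) \<in> R ^^ (J + M)" "s t = \<phi> u" by blast
      have "(v, u) \<in> R ^^ (J + 2 * M)"
        using relpow_R_mono[OF relpow_R_trans[OF t(2) u(1)], of "J + 2 * M"] t(1) v by simp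
      then have "\<phi> u powr p \<le> (\<Sum>u\<in>(R ^^ (J + 2 * M)) `` {v}. \<phi> u powr p)"
        using finite_nb[OF v(1)] by (intro member_le_sum) auto
      then show ?thesis using u(2) by (simp add: add_increasing)
    qed
    finally show ?thesis by (simp add: mult_right_mono)
  qed
  have h'_sum: "(\<Sum>v\<in>ch w. h' v powr p) \<le> f w powr p" if w: "w \<in> V" "lev w = n" for w
  proof -
    have "(\<Sum>v\<in>ch w. h' v powr p)
      \<le> (\<Sum>v\<in>ch w. (\<epsilon> powr p + (\<Sum>u\<in>(R ^^ (J + 2 * M)) `` {v}. \<phi> u powr p)) * f w powr p)"
      by (rule sum_mono) (use h'_upper w in \<open>auto simp: ch_def\<close>)
    also have "\<dots> = (real (card (ch w)) * \<epsilon> powr p + (\<Sum>v\<in>ch w. \<Sum>u\<in>(R ^^ (J + 2 * M)) `` {v}. \<phi> u powr p)) * f w powr p"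
      by (simp add: sum.distrib sum_distrib_right[symmetric])
    also have "\<dots> \<le> (1 / 2 + 1 / 2) * f w powr p"
    proof (intro mult_right_mono add_mono sum_smoothed[OF w(1)])
      have "real (card (ch w)) * \<epsilon> powr p \<le> real N * \<epsilon> powr p"
        using card_ch[OF w(1)] by (intro mult_right_mono) auto
      then show "real (card (ch w)) * \<epsilon> powr p \<le> 1 / 2" using \<epsilon>(3) by (rule order_trans)
    qed simp
    finally show ?thesis by simp
  qed
  obtain c where c: "\<And>w. w \<in> V \<Longrightarrow> c w \<in> ch w" "\<And>w. w \<in> V \<Longrightarrow> R `` {c w} \<subseteq> ch w"
    using inner_child by metis
  define rest where "rest = (\<lambda>w. f w powr p - (\<Sum>u\<in>ch w - {c w}. h' u powr p))"
  define f' where "f' = (\<lambda>v. if v = c (P v) then rest (P v) powr (1 / p) else h' v)"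
  have f'_c: "f' (c w) powr p = rest w" "h' (c w) \<le> f' (c w)" "f' (c w) \<le> f w"
    if w: "w \<in> V" "lev w = n" for w
  proof -
    have cw: "c w \<in> V" "lev (c w) = Suc n" "P (c w) = w" using c(1)[OF w(1)] w by (auto simp: ch_def)
    have "(\<Sum>v\<in>ch w. h' v powr p) = h' (c w) powr p + (\<Sum>u\<in>ch w - {c w}. h' u powr p)"
      using finite_ch c w by (intro sum.remove) auto
    then have le: "h' (c w) powr p \<le> rest w" using h'_sum[OF w] unfolding rest_def by simp
    have le2: "rest w \<le> f w powr p" unfolding rest_def by (simp add: sum_nonneg)
    have f'_eq: "f' (c w) = rest w powr (1 / p)" unfolding f'_def using cw by simp
    have rest_nn: "0 \<le> rest w" using le by (smt (verit) powr_ge_zero)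
    then show "f' (c w) powr p = rest w" using f'_eq p_pos by (simp add: powr_powr)
    have "h' (c w) = (h' (c w) powr p) powr (1 / p)"
      using h'_pos[OF cw(1,2)] p_pos by (simp add: powr_powr)
    also have "\<dots> \<le> f' (c w)" unfolding f'_eq using le p_pos by (intro powr_mono2) auto
    finally show "h' (c w) \<le> f' (c w)" .
    have "f' (c w) \<le> (f w powr p) powr (1 / p)"
      unfolding f'_eq using le2 rest_nn p_pos by (intro powr_mono2) auto
    then show "f' (c w) \<le> f w" using f_pos[OF w] p_pos by (simp add: powr_powr)
  qed
  have f'_other: "f' v = h' v" if "v \<noteq> c (P v)" for v
    unfolding f'_def using that by simp
  have h'_le_f': "h' v \<le> f' v" if "v \<in> V" "lev v = Suc n" for v
    using f'_c(2)[OF P_in_V[OF that] lev_P[OF that]] f'_other[of v] by (cases "v = c (P v)") auto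
  \<comment> \<open>Raising the value at \<open>c w\<close> is harmless because its neighbours are
    siblings: the raised value is at most \<open>f w\<close>, every sibling has at least \<epsilon>
    times that, and \<open>B\<close> is at least 1 / \<epsilon>.\<close>
  have bal_c: "f' u \<le> B * f' v \<and> f' v \<le> B * f' u"
    if uv: "(u, v) \<in> R" "lev u = Suc n" "u = c (P u)" "u \<noteq> v" for u v
  proof -
    have V: "u \<in> V" "v \<in> V" "lev v = Suc n" using uv by (auto simp: R_def)
    have Pu: "P u \<in> V" "lev (P u) = n" using P_in_V lev_P V uv by auto
    have "v \<in> ch (P u)" using c(2)[OF Pu(1)] uv(1,3) by auto
    then have Pv: "P v = P u" by (simp add: ch_def)
    then have fv: "f' v = h' v" using f'_other[of v] uv by auto
    have "f' u \<le> f (P u)" using f'_c(3)[OF Pu] uv(3) by simp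
    also have "\<dots> \<le> (\<epsilon> * B) * f (P v)" using B fP_pos[OF V(2,3)] Pv by simp
    also have "\<dots> = B * (\<epsilon> * f (P v))" by simp
    also have "\<dots> \<le> B * h' v" using h'_lower[OF V(2,3)] B1 by (intro mult_left_mono) auto
    finally have 1: "f' u \<le> B * f' v" using fv by simp
    have "(v, u) \<in> R" using relpow_R_sym[of u v 1] uv by simp
    then have "f' v \<le> B * h' u" using h'_bal[of v u] fv V by simp
    also have "\<dots> \<le> B * f' u" using h'_le_f'[OF V(1) uv(2)] B1 by (intro mult_left_mono) auto
    finally show ?thesis using 1 by simp
  qed
  show ?thesis
  proof (intro exI[of _ f'] conjI ballI allI impI)
    fix v assume "v \<in> V" "lev v = Suc n"
    then show "\<epsilon> * f (P v) \<le> f' v" using h'_lower h'_le_f' by fastforce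
  next
    fix u v assume uv: "(u, v) \<in> R" "lev u = Suc n"
    have V: "u \<in> V" "v \<in> V" "lev v = Suc n" using uv by (auto simp: R_def)
    have vu: "(v, u) \<in> R" using relpow_R_sym[of u v 1] uv by simp
    show "f' u \<le> B * f' v"
    proof (cases "u = v")
      case True
      have "0 < f' u" using h'_pos[OF V(1) uv(2)] h'_le_f'[OF V(1) uv(2)] by linarith
      then show ?thesis using True B1 by simp
    next
      case False
      consider "u = c (P u)" | "v = c (P v)" | "u \<noteq> c (P u)" "v \<noteq> c (P v)" by blast
      then show ?thesis
      proof cases
        case 1 then show ?thesis using bal_c[OF uv] False by simp
      next
        case 2 then show ?thesis using bal_c[OF vu V(3)] False by simp
      next
        case 3 then show ?thesis using f'_other h'_bal[OF uv] by simp
      qed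
    qed
  next
    fix w assume w: "w \<in> V" "lev w = n"
    have "(\<Sum>v\<in>ch w. f' v powr p) = f' (c w) powr p + (\<Sum>u\<in>ch w - {c w}. f' u powr p)"
      using finite_ch c w by (intro sum.remove) auto
    also have "(\<Sum>u\<in>ch w - {c w}. f' u powr p) = (\<Sum>u\<in>ch w - {c w}. h' u powr p)"
      by (rule sum.cong) (use f'_other in \<open>auto simp: ch_def\<close>)
    finally show "(\<Sum>v\<in>ch w. f' v powr p) = f w powr p" using f'_c(1)[OF w] by (simp add: rest_def)
  next
    fix u v assume uv: "u \<in> V" "lev u = Suc n" "(u, v) \<in> R ^^ (J + M)"
    have V: "v \<in> V" "lev v = Suc n" using relpow_R_invariants[OF uv(3,1)] uv by auto
    have "\<phi> u * f (P v) \<le> h v"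
      unfolding h_def using s_ge_\<phi>[OF V(1) relpow_R_sym[OF uv(3)]] fP_pos[OF V] by (intro mult_right_mono) auto
    then show "\<phi> u * f (P v) \<le> f' v" using h_le_h'[OF V(1)] h'_le_f'[OF V] by linarith
  qed
qed

lemma weight_exists:
  "\<exists>g \<epsilon> B. 0 < \<epsilon> \<and> \<epsilon> \<le> 1 \<and> 1 \<le> B \<and> g root = 1 \<and> (\<forall>v\<in>V. 0 < g v)
    \<and> (\<forall>v n. v \<in> V \<longrightarrow> lev v = Suc n \<longrightarrow> \<epsilon> * g (P v) \<le> g v)
    \<and> (\<forall>u v. (u, v) \<in> R \<longrightarrow> g u \<le> B * g v)
    \<and> (\<forall>w\<in>V. (\<Sum>v\<in>ch w. g v powr p) = g w powr p)
    \<and> (\<forall>u v n. u \<in> V \<longrightarrow> lev u = Suc n \<longrightarrow> (u, v) \<in> R ^^ (J + M) \<longrightarrow> \<phi> u * g (P v) \<le> g v)"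
proof -
  \<comment> \<open>With this value \<open>N\<close> children of relative weight \<epsilon> use at
    most half of the mass; \<open>B\<close> is then the least constant that
    \<open>weight_step\<close> allows.\<close>
  define \<epsilon> where "\<epsilon> = (1 / (2 * (real N + 1))) powr (1 / p)"
  define B where "B = 1 / \<epsilon>"
  have \<epsilon>0: "0 < \<epsilon>" unfolding \<epsilon>_def by simp
  have \<epsilon>1: "\<epsilon> \<le> 1" unfolding \<epsilon>_def using p_pos by (intro powr_le1) auto
  have "\<epsilon> powr p = 1 / (2 * (real N + 1))" unfolding \<epsilon>_def using p_pos by (simp add: powr_powr)
  then have \<epsilon>N: "real N * \<epsilon> powr p \<le> 1 / 2" by (simp only:) (simp add: field_simps)
  have B: "1 \<le> \<epsilon> * B" "1 \<le> B" unfolding B_def using \<epsilon>0 \<epsilon>1 by auto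
  define good where "good = (\<lambda>n f. (\<forall>v\<in>V. lev v = n \<longrightarrow> 0 < f v)
     \<and> (\<forall>u v. (u, v) \<in> R \<longrightarrow> lev u = n \<longrightarrow> f u \<le> B * f v) \<and> (n = 0 \<longrightarrow> f root = (1::real)))"
  define nxt where "nxt = (\<lambda>n f f'. (\<forall>v\<in>V. lev v = Suc n \<longrightarrow> \<epsilon> * f (P v) \<le> f' v)
    \<and> (\<forall>w\<in>V. lev w = n \<longrightarrow> (\<Sum>v\<in>ch w. f' v powr p) = (f w powr p :: real))
    \<and> (\<forall>u v. u \<in> V \<longrightarrow> lev u = Suc n \<longrightarrow> (u, v) \<in> R ^^ (J + M) \<longrightarrow> \<phi> u * f (P v) \<le> f' v))"
  have "\<exists>F. \<forall>n. good n (F n) \<and> nxt n (F n) (F (Suc n))"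
  proof (rule dependent_nat_choice)
    show "\<exists>f. good 0 f"
      using B by (intro exI[of _ "\<lambda>_. 1"]) (simp add: good_def)
  next
    fix f n assume g: "good n f"
    have pos: "0 < f v" if "v \<in> V" "lev v = n" for v using g that unfolding good_def by blast
    have bal: "f u \<le> B * f v" if "(u, v) \<in> R" "lev u = n" for u v using g that unfolding good_def by blast
    obtain f' where f': "(\<forall>v\<in>V. lev v = Suc n \<longrightarrow> \<epsilon> * f (P v) \<le> f' v)
      \<and> (\<forall>u v. (u, v) \<in> R \<longrightarrow> lev u = Suc n \<longrightarrow> f' u \<le> B * f' v)
      \<and> (\<forall>w\<in>V. lev w = n \<longrightarrow> (\<Sum>v\<in>ch w. f' v powr p) = f w powr p)
      \<and> (\<forall>u v. u \<in> V \<longrightarrow> lev u = Suc n \<longrightarrow> (u, v) \<in> R ^^ (J + M) \<longrightarrow> \<phi> u * f (P v) \<le> f' v)"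
      by (rule exE[OF weight_step[OF \<epsilon>0 \<epsilon>1 \<epsilon>N B(1) pos bal]])
    have "0 < f' v" if v: "v \<in> V" "lev v = Suc n" for v
    proof -
      have "0 < f (P v)" using g P_in_V[OF v] lev_P[OF v] unfolding good_def by blast
      then have "0 < \<epsilon> * f (P v)" using \<epsilon>0 by simp
      also have "\<dots> \<le> f' v" using conjunct1[OF f'] v by blast
      finally show ?thesis .
    qed
    then show "\<exists>f'. good (Suc n) f' \<and> nxt n f f'"
      using f' unfolding good_def nxt_def by (intro exI[of _ f']) simp
  qed
  then obtain F where F: "\<And>n. good n (F n)" "\<And>n. nxt n (F n) (F (Suc n))" by blast
  \<comment> \<open>\<open>F n\<close> is meaningful on level \<open>n\<close> only, so each vertex
    is read off at its own level.\<close>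
  define g where "g = (\<lambda>v. F (lev v) v)"
  have 1: "\<forall>v\<in>V. 0 < g v" "g root = 1" using F(1) lev_root unfolding g_def good_def by auto
  have 2: "g u \<le> B * g v" if "(u, v) \<in> R" for u v
  proof -
    have "lev v = lev u" using that by (auto simp: R_def)
    then show ?thesis using F(1)[of "lev u"] that unfolding good_def g_def by simp
  qed
  have 3: "\<epsilon> * g (P v) \<le> g v" if v: "v \<in> V" "lev v = Suc n" for v n
    using F(2)[of n] lev_P[OF v] v unfolding nxt_def g_def by simp
  have 4: "(\<Sum>v\<in>ch w. g v powr p) = g w powr p" if "w \<in> V" for w
  proof -
    have "(\<Sum>v\<in>ch w. g v powr p) = (\<Sum>v\<in>ch w. F (Suc (lev w)) v powr p)"
      by (rule sum.cong) (auto simp: g_def ch_def)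
    then show ?thesis using F(2)[of "lev w"] that unfolding nxt_def g_def by simp
  qed
  have 5: "\<phi> u * g (P v) \<le> g v" if uv: "u \<in> V" "lev u = Suc n" "(u, v) \<in> R ^^ (J + M)" for u v n
  proof -
    have v: "v \<in> V" "lev v = Suc n" using relpow_R_invariants[OF uv(3,1)] uv by auto
    then show ?thesis using F(2)[of n] lev_P[OF v] uv unfolding nxt_def g_def by simp
  qed
  show ?thesis
  proof (rule exI[of _ g], rule exI[of _ \<epsilon>], rule exI[of _ B], intro conjI)
    show "\<forall>v n. v \<in> V \<longrightarrow> lev v = Suc n \<longrightarrow> \<epsilon> * g (P v) \<le> g v" by (intro allI impI) (rule 3)
    show "\<forall>u v. (u, v) \<in> R \<longrightarrow> g u \<le> B * g v" by (intro allI impI) (rule 2)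
    show "\<forall>w\<in>V. (\<Sum>v\<in>ch w. g v powr p) = g w powr p" by (intro ballI 4)
    show "\<forall>u v n. u \<in> V \<longrightarrow> lev u = Suc n \<longrightarrow> (u, v) \<in> R ^^ (J + M) \<longrightarrow> \<phi> u * g (P v) \<le> g v"
      by (intro allI impI) (rule 5)
  qed (fact \<epsilon>0 \<epsilon>1 B(2) 1)+
qed

end

locale balanced_weight = admissible_weight +
  fixes g :: "'a \<Rightarrow> real" and \<epsilon> B :: real
  assumes \<epsilon>_pos: "0 < \<epsilon>" and \<epsilon>_le_1: "\<epsilon> \<le> 1" and B_ge_1: "1 \<le> B"
    and g_root: "g root = 1"
    and g_pos: "\<And>v. v \<in> V \<Longrightarrow> 0 < g v"
    and g_ge: "\<And>v n. v \<in> V \<Longrightarrow> lev v = Suc n \<Longrightarrow> \<epsilon> * g (P v) \<le> g v"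
    and g_bal: "\<And>u v. (u, v) \<in> R \<Longrightarrow> g u \<le> B * g v"
    and g_mass: "\<And>w. w \<in> V \<Longrightarrow> (\<Sum>v\<in>ch w. g v powr p) = g w powr p"
    and g_\<phi>: "\<And>u v n. u \<in> V \<Longrightarrow> lev u = Suc n \<Longrightarrow> (u, v) \<in> R ^^ (J + M) \<Longrightarrow> \<phi> u * g (P v) \<le> g v"
begin

section \<open>Comparison, conservation and decay of the weight\<close>

lemma g_bal_relpow: "(u, v) \<in> R ^^ i \<Longrightarrow> g u \<le> B ^ i * g v"
proof (induction i arbitrary: v)
  case (Suc i)
  then obtain y where y: "(u, y) \<in> R ^^ i" "(y, v) \<in> R" by (elim relpow_Suc_E)
  have "g u \<le> B ^ i * g y" by (rule Suc.IH[OF y(1)])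
  also have "\<dots> \<le> B ^ i * (B * g v)"
    using g_bal[OF y(2)] B_ge_1 by (intro mult_left_mono) auto
  finally show ?case by (simp add: mult_ac)
qed simp

lemma g_le_P:
  assumes v: "v \<in> V" "lev v = Suc n"
  shows "g v \<le> g (P v)"
proof -
  have Pv: "P v \<in> V" using P_in_V[OF v] .
  have "g v powr p \<le> (\<Sum>v\<in>ch (P v). g v powr p)"
    using ch_P[OF v] finite_ch[OF Pv] by (intro member_le_sum) auto
  then have "g v powr p \<le> g (P v) powr p" using g_mass[OF Pv] by simp
  then show ?thesis
    using powr_less_mono2[of p "g (P v)" "g v"] p_pos g_pos[OF Pv] by force
qed

lemma g_le_ancestor:
  assumes "v \<in> V" "lev v = n + j"
  shows "g v \<le> g ((P ^^ j) v)"
  using assms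
proof (induction j arbitrary: n)
  case (Suc j)
  have "g v \<le> g ((P ^^ j) v)" using Suc.IH[of "Suc n"] Suc.prems by simp
  also have "\<dots> \<le> g (P ((P ^^ j) v))"
    using g_le_P ascend[of v "Suc n" j] Suc.prems by simp
  finally show ?case by simp
qed simp

lemma g_ge_ancestor:
  assumes "v \<in> V" "lev v = n + j"
  shows "\<epsilon> ^ j * g ((P ^^ j) v) \<le> g v"
  using assms
proof (induction j arbitrary: n)
  case (Suc j)
  have "\<epsilon> ^ j * (\<epsilon> * g (P ((P ^^ j) v))) \<le> \<epsilon> ^ j * g ((P ^^ j) v)"
    using g_ge ascend[of v "Suc n" j] Suc.prems \<epsilon>_pos by (intro mult_left_mono) auto
  also have "\<dots> \<le> g v" using Suc.IH[of "Suc n"] Suc.prems by simp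
  finally show ?case by (simp add: mult_ac)
qed simp

lemma g_mass_descendants:
  assumes w: "w \<in> V"
  defines "De \<equiv> \<lambda>j. {v \<in> V. lev v = lev w + j \<and> (P ^^ j) v = w}"
  shows "finite (De j)" "(\<Sum>v\<in>De j. g v powr p) = g w powr p"
proof -
  have fin: "finite (De j)" for j
    by (rule finite_subset[OF _ finite_level[of "lev w + j"]]) (auto simp: De_def)
  then show "finite (De j)" .
  show "(\<Sum>v\<in>De j. g v powr p) = g w powr p"
  proof (induction j)
    case 0
    have "De 0 = {w}" using w by (auto simp: De_def)
    then show ?case by simp
  next
    case (Suc j)
    have De: "De (Suc j) = (\<Union>u\<in>De j. ch u)"
    proof (intro equalityI subsetI)
      fix v assume "v \<in> De (Suc j)"
      then have v: "v \<in> V" "lev v = Suc (lev w + j)" "(P ^^ j) (P v) = w"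
        by (auto simp: De_def funpow_swap1)
      then have "P v \<in> De j" using P_in_V lev_P by (simp add: De_def)
      then show "v \<in> (\<Union>u\<in>De j. ch u)" using ch_P[OF v(1,2)] by blast
    next
      fix v assume "v \<in> (\<Union>u\<in>De j. ch u)"
      then show "v \<in> De (Suc j)" by (auto simp: De_def ch_def funpow_swap1)
    qed
    have "(\<Sum>v\<in>De (Suc j). g v powr p) = (\<Sum>u\<in>De j. \<Sum>v\<in>ch u. g v powr p)"
      unfolding De
    proof (rule sum.UNION_disjoint[OF fin])
      show "\<forall>i\<in>De j. finite (ch i)" using finite_ch by (auto simp: De_def)
    qed (auto simp: ch_def)
    also have "\<dots> = (\<Sum>u\<in>De j. g u powr p)"
      by (rule sum.cong) (use g_mass in \<open>auto simp: De_def\<close>)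
    finally show ?case using Suc by simp
  qed
qed

text \<open>Over \<open>m\<close> generations a second descendant of \<open>w\<close> keeps at least
  the fraction \<open>(\<epsilon> ^ m) powr p\<close> of the mass of \<open>w\<close>, so by
  conservation \<open>v\<close> must lose a fixed fraction.\<close>

lemma g_decay:
  "\<exists>D \<theta>. 0 < D \<and> 0 < \<theta> \<and> \<theta> < 1 \<and>
    (\<forall>v n j. v \<in> V \<longrightarrow> lev v = n + j \<longrightarrow> g v \<le> D * \<theta> ^ j * g ((P ^^ j) v))"
proof -
  obtain m where m: "m \<ge> 1" and two: "\<And>w v. w \<in> V \<Longrightarrow> v \<in> V \<Longrightarrow> lev v = lev w + m \<Longrightarrow> (P ^^ m) v = w
      \<Longrightarrow> (\<exists>v'\<in>V. v' \<noteq> v \<and> lev v' = lev w + m \<and> (P ^^ m) v' = w)"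
    using no_single_descendant by blast
  \<comment> \<open>The maximum with 1 / 2 keeps \<eta> positive even when \<epsilon> = 1.\<close>
  define \<eta> where "\<eta> = max (1 / 2) ((1 - (\<epsilon> ^ m) powr p) powr (1 / p))"
  have \<epsilon>m: "0 < (\<epsilon> ^ m) powr p" "(\<epsilon> ^ m) powr p \<le> 1"
    using \<epsilon>_pos \<epsilon>_le_1 p_pos by (auto intro!: powr_le1 power_le_one)
  have "(1 - (\<epsilon> ^ m) powr p) powr (1 / p) < 1 powr (1 / p)"
    using \<epsilon>m p_pos by (intro powr_less_mono2) auto
  then have \<eta>: "0 < \<eta>" "\<eta> < 1" unfolding \<eta>_def by auto
  have step: "g v \<le> \<eta> * g ((P ^^ m) v)" if v: "v \<in> V" "lev v = n + m" for v n
  proof -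
    define w where "w = (P ^^ m) v"
    have w: "w \<in> V" "lev w = n" using ascend[OF v] by (auto simp: w_def)
    obtain v' where v': "v' \<in> V" "v' \<noteq> v" "lev v' = lev w + m" "(P ^^ m) v' = w"
      using two[OF w(1) v(1) _ w_def[symmetric]] v(2) w(2) by metis
    let ?De = "{v \<in> V. lev v = lev w + m \<and> (P ^^ m) v = w}"
    have "g v powr p + g v' powr p = (\<Sum>u\<in>{v, v'}. g u powr p)" using v'(2) by simp
    also have "\<dots> \<le> (\<Sum>u\<in>?De. g u powr p)"
      using v v' w g_mass_descendants(1)[OF w(1), of m] by (intro sum_mono2) (auto simp: w_def)
    also have "\<dots> = g w powr p" by (rule g_mass_descendants(2)[OF w(1)])
    finally have 1: "g v powr p + g v' powr p \<le> g w powr p" .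
    have "(\<epsilon> ^ m * g w) powr p \<le> g v' powr p"
      using g_ge_ancestor[OF v'(1,3)] v'(4) \<epsilon>_pos g_pos[OF w(1)] p_pos by (intro powr_mono2) auto
    then have "(\<epsilon> ^ m) powr p * g w powr p \<le> g v' powr p"
      using \<epsilon>_pos g_pos[OF w(1)] by (simp add: powr_mult)
    with 1 have "g v powr p \<le> (1 - (\<epsilon> ^ m) powr p) * g w powr p" by (simp add: algebra_simps)
    then have "(g v powr p) powr (1 / p) \<le> ((1 - (\<epsilon> ^ m) powr p) * g w powr p) powr (1 / p)"
      using p_pos by (intro powr_mono2) auto
    then have "g v \<le> (1 - (\<epsilon> ^ m) powr p) powr (1 / p) * g w"
      using g_pos[OF v(1)] g_pos[OF w(1)] p_pos \<epsilon>m by (simp add: powr_mult powr_powr)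
    also have "\<dots> \<le> \<eta> * g w" using g_pos[OF w(1)] by (intro mult_right_mono) (auto simp: \<eta>_def)
    finally show ?thesis by (simp add: w_def)
  qed
  \<comment> \<open>The \<open>m\<close>-th root spreads the loss \<eta> over \<open>m\<close>
    generations; the prefactor 1 / \<eta> below covers an incomplete block of fewer than
    \<open>m\<close> generations.\<close>
  define \<theta> where "\<theta> = \<eta> powr (1 / real m)"
  have \<theta>: "0 < \<theta>" using \<eta> by (simp add: \<theta>_def)
  have \<theta>m: "\<theta> ^ m = \<eta>"
    using \<eta> m powr_realpow[OF \<theta>, of m] by (simp add: \<theta>_def powr_powr)
  have "\<theta> < 1"
    using powr_less_mono2[of "1 / real m" \<eta> 1] \<eta> m by (simp add: \<theta>_def)
  with \<theta> have \<theta>: "0 < \<theta>" "\<theta> < 1" by simp_all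
  have main: "g v \<le> 1 / \<eta> * \<theta> ^ j * g ((P ^^ j) v)" if "v \<in> V" "lev v = n + j" for v n j
    using that
  proof (induction j arbitrary: v rule: less_induct)
    case (less j)
    show ?case
    proof (cases "j < m")
      case True
      have "\<eta> \<le> \<theta> ^ j" using True \<theta> power_decreasing[of j m \<theta>] \<theta>m by simp
      then have "1 \<le> 1 / \<eta> * \<theta> ^ j" using \<eta> by (simp add: field_simps)
      moreover have "0 < g ((P ^^ j) v)" using ascend(1)[OF less.prems] g_pos by blast
      ultimately have "g ((P ^^ j) v) \<le> 1 / \<eta> * \<theta> ^ j * g ((P ^^ j) v)"
        using mult_right_mono[of 1 "1 / \<eta> * \<theta> ^ j" "g ((P ^^ j) v)"] by simp
      then show ?thesis using g_le_ancestor[OF less.prems] by linarith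
    next
      case False
      then obtain i where i: "j = i + m" by (metis le_add_diff_inverse2 not_less)
      let ?u = "(P ^^ m) v"
      have lv: "lev v = (n + i) + m" using less.prems i by simp
      have u: "?u \<in> V" "lev ?u = n + i" using ascend[OF less.prems(1) lv] by auto
      have "g v \<le> \<eta> * g ?u" by (rule step[OF less.prems(1) lv])
      also have "\<dots> \<le> \<eta> * (1 / \<eta> * \<theta> ^ i * g ((P ^^ i) ?u))"
        using less.IH[OF _ u] i m \<eta> by (intro mult_left_mono) auto
      also have "\<dots> = 1 / \<eta> * \<theta> ^ j * g ((P ^^ j) v)"
        by (simp add: i power_add \<theta>m funpow_add)
      finally show ?thesis .
    qed
  qed
  show ?thesis
    by (rule exI[of _ "1 / \<eta>"], rule exI[of _ \<theta>]) (use \<eta> \<theta> main in auto)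
qed

section \<open>The minimum of the weight over a horizontal neighbourhood\<close>

definition low :: "'a \<Rightarrow> real" where
  "low w = Min (g ` ((R ^^ (J + M)) `` {w}))"

lemma low_le: "w \<in> V \<Longrightarrow> (w, u) \<in> R ^^ (J + M) \<Longrightarrow> low w \<le> g u"
  unfolding low_def using finite_nb by (intro Min_le) auto

lemma low_cases: "w \<in> V \<Longrightarrow> \<exists>u. (w, u) \<in> R ^^ (J + M) \<and> low w = g u"
  unfolding low_def
  using Min_in[of "g ` ((R ^^ (J + M)) `` {w})"] finite_nb[of w "J + M"] relpow_R_refl by blast

lemma low_le_g: "w \<in> V \<Longrightarrow> low w \<le> g w"
  using low_le relpow_R_refl by blast

lemma low_pos: "w \<in> V \<Longrightarrow> 0 < low w"
  using low_cases g_pos relpow_R_invariants by metis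

lemma low_ge: "w \<in> V \<Longrightarrow> g w \<le> B ^ (J + M) * low w"
  using low_cases g_bal_relpow by metis

text \<open>A vertex within distance \<open>J + M\<close> of a vertex of the path has its parent within distance
  \<open>M\<close> of a vertex at distance \<open>J\<close> from \<open>w\<close>, so the minimum defining \<open>low w\<close> runs over it.\<close>

lemma low_crossing:
  assumes w: "w \<in> V" and vs: "vs \<noteq> []"
    "\<And>v. v \<in> set vs \<Longrightarrow> v \<in> V \<and> lev v = Suc (lev w) \<and> (w, P v) \<in> R ^^ J"
    "successively (\<lambda>u v. (u, v) \<in> R ^^ J) vs"
    and ends: "u \<in> ch w" "(u, hd vs) \<in> R ^^ J" "(last vs, t) \<in> R ^^ J" "(w, P t) \<notin> R ^^ J"
  shows "low w \<le> sum_list (map low vs)"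
proof -
  have "\<phi> v * low w \<le> low v" if v: "v \<in> set vs" for v
  proof -
    have v': "v \<in> V" "lev v = Suc (lev w)" "(w, P v) \<in> R ^^ J" using vs(2)[OF v] by auto
    obtain y where y: "(v, y) \<in> R ^^ (J + M)" "low v = g y" using low_cases[OF v'(1)] by blast
    have "(w, P y) \<in> R ^^ (J + M)"
      using relpow_R_trans[OF v'(3) contract_J[OF y(1) v'(1,2)]] .
    then have "\<phi> v * low w \<le> \<phi> v * g (P y)"
      using low_le[OF w] \<phi>_pos[OF v'(1)] by (intro mult_left_mono) auto
    also have "\<dots> \<le> g y" by (rule g_\<phi>[OF v'(1,2) y(1)])
    finally show ?thesis using y by simp
  qed
  then have "sum_list (map (\<lambda>v. \<phi> v * low w) vs) \<le> sum_list (map low vs)"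
    by (intro sum_list_mono) auto
  then have "sum_list (map \<phi> vs) * low w \<le> sum_list (map low vs)"
    by (simp add: sum_list_mult_const)
  moreover have "1 * low w \<le> sum_list (map \<phi> vs) * low w"
    using crossing[OF w vs ends] low_pos[OF w] by (intro mult_right_mono) auto
  ultimately show ?thesis by simp
qed

end

section \<open>Coarsening of chains\<close>

locale decaying_weight = balanced_weight +
  fixes D \<theta> :: real
  assumes D_pos: "0 < D" and \<theta>: "0 < \<theta>" "\<theta> < 1"
    and g_le_decay: "\<And>v n j. v \<in> V \<Longrightarrow> lev v = n + j \<Longrightarrow> g v \<le> D * \<theta> ^ j * g ((P ^^ j) v)"
begin

text \<open>Jumps of size \<open>J\<close> are permitted within a level because coarsening a run
  produces them; at a change of level the cells must meet, so that a common point is available for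
  comparing weights.\<close>

definition link :: "'a \<Rightarrow> 'a \<Rightarrow> bool" where
  "link u v \<longleftrightarrow> (if lev u = lev v then (u, v) \<in> R ^^ J else K u \<inter> K v \<noteq> {})"

lemma linkI: "u \<in> V \<Longrightarrow> v \<in> V \<Longrightarrow> K u \<inter> K v \<noteq> {} \<Longrightarrow> link u v"
  using R_imp_relpow[OF _ J_ge_1] by (auto simp: link_def R_def)

text \<open>The fixed point of the map s to \<open>s * q + (real J + 1) * c\<^sub>2\<close>, which
  describes how closeness to a point passes from a vertex to a vertex within \<open>J\<close> of its
  parent.\<close>

definition reach :: real where "reach = (real J + 1) * c\<^sub>2 / (1 - q)"

lemma reach_pos: "reach > 0"
  using c\<^sub>2_pos q by (simp add: reach_def)

lemma reach_eq: "reach = reach * q + (real J + 1) * c\<^sub>2"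
  using q by (simp add: reach_def field_simps)

lemma reach_ge: "(real J + 1) * c\<^sub>2 \<le> reach"
  using reach_eq reach_pos q mult_pos_pos[of reach q] by linarith

definition near :: "'b \<Rightarrow> 'a \<Rightarrow> bool" where
  "near y v \<longleftrightarrow> (\<exists>z\<in>K v. d z y \<le> reach * q ^ lev v)"

lemma near_J:
  assumes "(w, v) \<in> R ^^ J" "w \<in> V" "y \<in> K v"
  shows "near y w"
proof -
  obtain z where z: "z \<in> K w" using K_nonempty assms by blast
  have "d z y \<le> (real J + 1) * (c\<^sub>2 * q ^ lev w)" by (rule dist_nb[OF assms(1,2) z assms(3)])
  also have "\<dots> = ((real J + 1) * c\<^sub>2) * q ^ lev w" by simp
  also have "\<dots> \<le> reach * q ^ lev w" using q by (intro mult_right_mono reach_ge) auto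
  finally show ?thesis using z by (auto simp: near_def)
qed

text \<open>The bound at the child shrinks by \<open>q\<close> relative to the parent level and the
  walk of \<open>J\<close> steps adds \<open>(real J + 1) * c\<^sub>2\<close>; \<open>reach\<close>
  solves exactly this equation. Used contrapositively: a crossing path of a vertex not near
  \<open>y\<close> has no vertex near \<open>y\<close>.\<close>

lemma near_parent:
  assumes v: "v \<in> V" "lev v = Suc n" and w: "w \<in> V" "(w, P v) \<in> R ^^ J" and y: "y \<in> X" "near y v"
  shows "near y w"
proof -
  obtain z where z: "z \<in> K v" "d z y \<le> reach * q ^ Suc n" using y v by (auto simp: near_def)
  obtain x where x: "x \<in> K w" using K_nonempty w by blast
  have Pv: "P v \<in> V" "lev (P v) = n" using P_in_V lev_P v by auto
  have lw: "lev w = n" using relpow_R_invariants[OF w(2,1)] Pv by simp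
  have zP: "z \<in> K (P v)" using z K_subset_P v by blast
  have "d x y \<le> d x z + d z y"
    using x z y K_subset_X[OF w(1)] K_subset_X[OF v(1)] by (intro metric_X.triangle) auto
  also have "d x z \<le> (real J + 1) * (c\<^sub>2 * q ^ n)" using dist_nb[OF w(2,1) x zP] lw by simp
  also have "(real J + 1) * (c\<^sub>2 * q ^ n) + d z y \<le> (real J + 1) * (c\<^sub>2 * q ^ n) + reach * q ^ Suc n"
    using z by simp
  also have "\<dots> = (reach * q + (real J + 1) * c\<^sub>2) * q ^ n" by (simp add: algebra_simps)
  also have "\<dots> = reach * q ^ lev w" using reach_eq lw by simp
  finally show ?thesis using x by (auto simp: near_def)
qed

text \<open>Neglecting the vertices close to the endpoint \<open>y\<close> keeps the crossing inequality and makes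
  the unpaid last vertices of a coarsened path free of charge.\<close>

definition cost :: "'b \<Rightarrow> 'a \<Rightarrow> real" where
  "cost y v = (if near y v then 0 else low v)"

lemma cost_nonneg: "v \<in> V \<Longrightarrow> 0 \<le> cost y v"
  using low_pos[of v] by (simp add: cost_def)

lemma cost_le_g: "v \<in> V \<Longrightarrow> cost y v \<le> g v"
  using low_le_g[of v] g_pos[of v] by (simp add: cost_def)

lemma cost_crossing:
  assumes y: "y \<in> X" and w: "w \<in> V" and vs: "vs \<noteq> []"
    "\<And>v. v \<in> set vs \<Longrightarrow> v \<in> V \<and> lev v = Suc (lev w) \<and> (w, P v) \<in> R ^^ J"
    "successively (\<lambda>u v. (u, v) \<in> R ^^ J) vs"
    and ends: "u \<in> ch w" "(u, hd vs) \<in> R ^^ J" "(last vs, t) \<in> R ^^ J" "(w, P t) \<notin> R ^^ J"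
  shows "cost y w \<le> sum_list (map (cost y) vs)"
proof (cases "near y w")
  case True
  have "0 \<le> sum_list (map (cost y) vs)"
    by (rule sum_list_nonneg) (use vs(2) cost_nonneg in auto)
  then show ?thesis using True by (simp add: cost_def)
next
  case False
  have low_eq: "map (cost y) vs = map low vs"
    using near_parent[OF _ _ w _ y] vs(2) False by (auto simp: cost_def)
  show ?thesis
    unfolding low_eq using low_crossing[OF w vs ends] False by (simp add: cost_def)
qed

text \<open>Greedy cutting: follow the run while the parents stay within \<open>J\<close> of
  \<open>u\<close>. When they leave, the part already passed is a crossing path of \<open>u\<close>
  and pays for it, and the procedure restarts at the parent of its last vertex. Only the final
  coarse vertex is unpaid, whence \<open>butlast\<close>.\<close>

lemma coarsen_run:
  assumes y: "y \<in> X" and "vs \<noteq> []" "\<And>v. v \<in> set vs \<Longrightarrow> v \<in> V \<and> lev v = Suc n"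
    "successively (\<lambda>u v. (u, v) \<in> R ^^ J) vs"
    "u \<in> V" "lev u = n" "t \<in> ch u" "(t, hd vs) \<in> R ^^ J"
  shows "\<exists>us. us \<noteq> [] \<and> hd us = u \<and> set us \<subseteq> {v \<in> V. lev v = n}
    \<and> successively (\<lambda>u v. (u, v) \<in> R ^^ J) us \<and> (last us, P (last vs)) \<in> R ^^ J
    \<and> sum_list (map (cost y) (butlast us)) \<le> sum_list (map (cost y) vs)"
  using assms(2-)
proof (induction "length vs" arbitrary: vs u t rule: less_induct)
  case less
  have nonneg: "0 \<le> sum_list (map (cost y) vs)"
    by (rule sum_list_nonneg) (use less.prems(2) cost_nonneg in auto)
  show ?case
  proof (cases "\<forall>v\<in>set vs. (u, P v) \<in> R ^^ J")
    case True
    \<comment> \<open>No exit occurs, so \<open>u\<close> is the final coarse vertex and is not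
      charged.\<close>
    then show ?thesis using less.prems nonneg by (intro exI[of _ "[u]"]) auto
  next
    case False
    define xs where "xs = takeWhile (\<lambda>v. (u, P v) \<in> R ^^ J) vs"
    define ys where "ys = dropWhile (\<lambda>v. (u, P v) \<in> R ^^ J) vs"
    have vs: "vs = xs @ ys" by (simp add: xs_def ys_def)
    have ys: "ys \<noteq> []" using False by (auto simp: ys_def)
    have hd_ys: "(u, P (hd ys)) \<notin> R ^^ J" unfolding ys_def
      using hd_dropWhile ys ys_def by blast
    have t: "t \<in> V" "lev t = Suc n" "P t = u" using less.prems by (auto simp: ch_def)
    \<comment> \<open>Parents of the walk from \<open>t\<close> to \<open>hd vs\<close> form a walk
      from \<open>u\<close>, so at least one vertex is consumed and the recursion
      terminates.\<close>
    have "(u, P (hd vs)) \<in> R ^^ J" using relpow_R_P[OF less.prems(7) t(1,2)] t by simp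
    then have xs: "xs \<noteq> []" using less.prems(1) by (cases vs) (auto simp: xs_def)
    have in_xs: "(u, P v) \<in> R ^^ J" if "v \<in> set xs" for v
      using that set_takeWhileD unfolding xs_def by metis
    have suc: "successively (\<lambda>u v. (u, v) \<in> R ^^ J) xs" "successively (\<lambda>u v. (u, v) \<in> R ^^ J) ys"
      "(last xs, hd ys) \<in> R ^^ J"
      using less.prems(3) xs ys unfolding vs by (auto simp: successively_append_iff)
    have pay: "cost y u \<le> sum_list (map (cost y) xs)"
    proof (rule cost_crossing[OF y less.prems(4) xs _ suc(1) less.prems(6) _ suc(3) hd_ys])
      show "v \<in> V \<and> lev v = Suc (lev u) \<and> (u, P v) \<in> R ^^ J" if "v \<in> set xs" for v
        using less.prems(2,5) in_xs[OF that] that by (simp add: vs)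
      show "(t, hd xs) \<in> R ^^ J" using less.prems(7) xs by (simp add: vs)
    qed
    \<comment> \<open>This parent is within \<open>J\<close> of \<open>u\<close>, which makes the
      coarse step admissible, and \<open>last xs\<close> takes over the role of \<open>t\<close> for
      the remaining run.\<close>
    define u' where "u' = P (last xs)"
    have lx: "last xs \<in> V" "lev (last xs) = Suc n" using less.prems(2) xs by (auto simp: vs)
    have u': "u' \<in> V" "lev u' = n" "(u, u') \<in> R ^^ J" "last xs \<in> ch u'"
      using P_in_V[OF lx] lev_P[OF lx] in_xs xs ch_P[OF lx] by (auto simp: u'_def)
    have "length ys < length vs" using xs by (simp add: vs)
    from less.hyps[OF this ys _ suc(2) u'(1,2,4) suc(3)] less.prems(2)
    obtain us where us: "us \<noteq> []" "hd us = u'" "set us \<subseteq> {v \<in> V. lev v = n}"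
      "successively (\<lambda>u v. (u, v) \<in> R ^^ J) us" "(last us, P (last ys)) \<in> R ^^ J"
      "sum_list (map (cost y) (butlast us)) \<le> sum_list (map (cost y) ys)"
      by (auto simp: vs)
    show ?thesis
      using us u' pay ys less.prems by (intro exI[of _ "u # us"]) (auto simp: vs successively_Cons)
  qed
qed

text \<open>Bounds the two unpaid vertices at the end of a run: relative to a suitable descendant of
  the next coarse vertex one costs a factor \<open>B\<close>, the other \<open>B ^ (J + 1)\<close>,
  and \<open>D\<close> comes from the decay.\<close>

definition toll :: real where "toll = (B + B ^ (J + 1)) * D"

lemma toll_pos: "toll > 0"
  using D_pos B_ge_1 by (simp add: toll_def add_pos_pos)

text \<open>A potential: besides its cost a vertex holds a reserve for the charges it may still
  receive while the finest level drops from \<open>n\<close> to its own. Each coarsening step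
  releases the top term of the geometric sum.\<close>

definition total_cost :: "'b \<Rightarrow> nat \<Rightarrow> 'a \<Rightarrow> real" where
  "total_cost y n v = cost y v + toll * (\<Sum>j<n - lev v. \<theta> ^ j) * g v"

lemma total_cost_level: "lev v = n \<Longrightarrow> total_cost y n v = cost y v"
  by (simp add: total_cost_def)

lemma total_cost_Suc:
  "lev v \<le> n \<Longrightarrow> total_cost y (Suc n) v = total_cost y n v + toll * \<theta> ^ (n - lev v) * g v"
  by (simp add: total_cost_def Suc_diff_le algebra_simps)

text \<open>A common point of \<open>K v\<close> and \<open>K b\<close> lies in a descendant
  \<open>b'\<close> of \<open>b\<close> on level \<open>n\<close>. Then \<open>v\<close> neighbours
  \<open>b'\<close>, \<open>u\<close> is within \<open>J + 1\<close> of it, and the weight of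
  \<open>b'\<close> has decayed by \<open>D * \<theta> ^ (n - lev b)\<close>.\<close>

lemma toll_suffices:
  assumes b: "b \<in> V" "lev b \<le> n" and v: "v \<in> V" "lev v = n" "K v \<inter> K b \<noteq> {}"
    and u: "(u, v) \<in> R ^^ J"
  shows "cost y u + cost y v \<le> toll * \<theta> ^ (n - lev b) * g b"
proof -
  obtain x where x: "x \<in> K v" "x \<in> K b" using v by blast
  obtain b' where b': "b' \<in> V" "lev b' = n" "x \<in> K b'" "(P ^^ (n - lev b)) b' = b"
    using descend[OF b(1) x(2), of "n - lev b"] b(2) by auto
  have "(v, b') \<in> R" using v b' x by (auto simp: R_def)
  then have 1: "g v \<le> B * g b'" by (rule g_bal)
  have "(u, b') \<in> R ^^ (J + 1)" using relpow_R_trans[OF u, of b' 1] \<open>(v, b') \<in> R\<close> by simp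
  then have 2: "g u \<le> B ^ (J + 1) * g b'" by (rule g_bal_relpow)
  have uV: "u \<in> V" using relpow_R_invariants[OF relpow_R_sym[OF u] v(1)] by simp
  have "cost y u + cost y v \<le> (B + B ^ (J + 1)) * g b'"
    using 1 2 cost_le_g[OF uV, of y] cost_le_g[OF v(1), of y] by (simp add: algebra_simps)
  also have "g b' \<le> D * \<theta> ^ (n - lev b) * g b"
    using g_le_decay[OF b'(1), of "lev b" "n - lev b"] b' b by simp
  then have "(B + B ^ (J + 1)) * g b' \<le> (B + B ^ (J + 1)) * (D * \<theta> ^ (n - lev b) * g b)"
    using B_ge_1 by (intro mult_left_mono) auto
  finally show ?thesis by (simp add: toll_def mult_ac)
qed

text \<open>Each maximal run of vertices of level \<open>n + 1\<close> is replaced by its coarsening. The last two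
  vertices of the latter are not paid for by the run; their cost is charged to the coarse vertex
  following the run. A vertex of level \<open>l\<close> is charged at most once on each level \<open>n \<ge> l\<close>, by an amount
  of order \<open>\<theta>^(n - l)\<close>, so that the charges add up to a bounded factor.\<close>

lemma coarsen_step:
  assumes y: "y \<in> X" and "ws \<noteq> []" "set ws \<subseteq> V" "\<And>v. v \<in> set ws \<Longrightarrow> lev v \<le> Suc n"
    "successively link ws" "y \<in> K (last ws)"
  shows "\<exists>ws'. ws' \<noteq> [] \<and> set ws' \<subseteq> V \<and> (\<forall>v\<in>set ws'. lev v \<le> n) \<and> successively link ws'
    \<and> y \<in> K (last ws') \<and> hd ws' = (if lev (hd ws) = Suc n then P (hd ws) else hd ws)
    \<and> sum_list (map (total_cost y n) ws')
        + (if lev (hd ws) \<le> n then toll * \<theta> ^ (n - lev (hd ws)) * g (hd ws) else 0)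
      \<le> sum_list (map (total_cost y (Suc n)) ws)"
  using assms(2-)
proof (induction "length ws" arbitrary: ws rule: less_induct)
  case less
  show ?case
  proof (cases "lev (hd ws) = Suc n")
    case False
    obtain b rest where ws: "ws = b # rest" using less.prems(1) by (cases ws) auto
    have b: "b \<in> V" "lev b \<le> n" using less.prems(2,3) False ws by (auto simp: le_Suc_eq)
    show ?thesis
    proof (cases "rest = []")
      case True
      then show ?thesis using less.prems b total_cost_Suc[of b n y] by (intro exI[of _ "[b]"]) (auto simp: ws)
    next
      case rest: False
      have "length rest < length ws" by (simp add: ws)
      moreover have "successively link rest" "link b (hd rest)"
        using less.prems(4) rest by (auto simp: ws successively_Cons)
      ultimately obtain ws' where ws': "ws' \<noteq> []" "set ws' \<subseteq> V" "\<forall>v\<in>set ws'. lev v \<le> n"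
        "successively link ws'" "y \<in> K (last ws')"
        "hd ws' = (if lev (hd rest) = Suc n then P (hd rest) else hd rest)"
        "sum_list (map (total_cost y n) ws')
          + (if lev (hd rest) \<le> n then toll * \<theta> ^ (n - lev (hd rest)) * g (hd rest) else 0)
        \<le> sum_list (map (total_cost y (Suc n)) rest)"
        using less.hyps[of rest] rest less.prems by (auto simp: ws)
      have hr: "hd rest \<in> V" using less.prems(2) rest by (auto simp: ws)
      have "link b (hd ws')"
      proof (cases "lev (hd rest) = Suc n")
        case True
        then have "K b \<inter> K (hd rest) \<noteq> {}" using \<open>link b (hd rest)\<close> b by (auto simp: link_def)
        then show ?thesis
          using linkI[OF b(1) P_in_V[OF hr True]] K_subset_P[OF hr True] ws'(6) True by auto
      qed (use ws'(6) \<open>link b (hd rest)\<close> in auto)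
      moreover have "0 \<le> (if lev (hd rest) \<le> n then toll * \<theta> ^ (n - lev (hd rest)) * g (hd rest) else 0)"
        using toll_pos \<theta> g_pos[OF hr] by simp
      ultimately show ?thesis
        using ws' b total_cost_Suc[of b n y] rest
        by (intro exI[of _ "b # ws'"]) (auto simp: ws successively_Cons)
    qed
  next
    case True
    define run where "run = takeWhile (\<lambda>v. lev v = Suc n) ws"
    define rest where "rest = dropWhile (\<lambda>v. lev v = Suc n) ws"
    have ws: "ws = run @ rest" by (simp add: run_def rest_def)
    have run: "run \<noteq> []" using True less.prems(1) by (cases ws) (auto simp: run_def)
    have lev_run: "lev v = Suc n" if "v \<in> set run" for v
      using that set_takeWhileD unfolding run_def by metis
    have V_run: "v \<in> V" if "v \<in> set run" for v using that less.prems(2) by (auto simp: ws)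
    have hd_run: "hd ws = hd run" using run by (simp add: ws)
    have h: "hd run \<in> V" "lev (hd run) = Suc n" using run V_run lev_run by auto
    have l: "last run \<in> V" "lev (last run) = Suc n" using run V_run lev_run by auto
    have "successively link run" using less.prems(4) by (simp add: ws successively_append_iff)
    then have suc_run: "successively (\<lambda>u v. (u, v) \<in> R ^^ J) run"
      by (rule successively_mono) (use lev_run in \<open>auto simp: link_def\<close>)
    obtain us where us: "us \<noteq> []" "hd us = P (hd run)" "set us \<subseteq> {v \<in> V. lev v = n}"
      "successively (\<lambda>u v. (u, v) \<in> R ^^ J) us" "(last us, P (last run)) \<in> R ^^ J"
      "sum_list (map (cost y) (butlast us)) \<le> sum_list (map (cost y) run)"
      using coarsen_run[OF y run _ suc_run P_in_V[OF h] lev_P[OF h] ch_P[OF h] relpow_R_refl[OF h(1)]]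
        lev_run V_run by blast
    define z where "z = P (last run)"
    have z: "z \<in> V" "lev z = n" "K (last run) \<subseteq> K z"
      using P_in_V[OF l] lev_P[OF l] K_subset_P[OF l] by (auto simp: z_def)
    \<comment> \<open>\<open>us\<close> ends only within \<open>J\<close> of \<open>z\<close>;
      appending \<open>z\<close>, whose cell contains that of the last vertex of the run, restores
      contact with the next coarse cell or with \<open>y\<close>.\<close>
    define zs where "zs = us @ [z]"
    have zs_V: "v \<in> V" "lev v = n" if "v \<in> set zs" for v
      using that us(3) z by (auto simp: zs_def)
    have "successively (\<lambda>u v. (u, v) \<in> R ^^ J) zs"
      using us by (simp add: zs_def z_def successively_append_iff)
    then have suc_zs: "successively link zs"
      by (rule successively_mono) (use zs_V in \<open>auto simp: link_def\<close>)
    have "map (total_cost y n) zs = map (cost y) zs"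
      using zs_V total_cost_level by simp
    moreover have "sum_list (map (cost y) zs) = sum_list (map (cost y) (butlast us)) + (cost y (last us) + cost y z)"
    proof -
      have "zs = (butlast us @ [last us]) @ [z]"
        by (simp only: zs_def append_butlast_last_id[OF us(1)])
      then show ?thesis by simp
    qed
    moreover have run_cost: "map (total_cost y (Suc n)) run = map (cost y) run"
      using lev_run total_cost_level by simp
    ultimately have zs_cost: "sum_list (map (total_cost y n) zs)
        \<le> sum_list (map (total_cost y (Suc n)) run) + (cost y (last us) + cost y z)"
      using us(6) by (simp only: add_le_cancel_right)
    show ?thesis
    proof (cases "rest = []")
      case rest: True
      then have "y \<in> K (last run)" using less.prems(5) by (simp add: ws)
      then have yz: "y \<in> K z" using z by blast
      have "last us \<in> V" using us(1,3) last_in_set by blast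
      then have "near y (last us)" using near_J[OF us(5)] yz by (simp add: z_def)
      moreover have "near y z" using near_J[OF relpow_R_refl[OF z(1)] z(1) yz] .
      ultimately have "cost y (last us) + cost y z = 0" by (simp add: cost_def)
      then show ?thesis
        using zs_cost zs_V suc_zs yz us(1,2) True rest
        by (intro exI[of _ zs]) (auto simp: zs_def ws hd_run)
    next
      case rest: False
      define b where "b = hd rest"
      have "lev b \<noteq> Suc n" unfolding b_def rest_def
        using hd_dropWhile[of "\<lambda>v. lev v = Suc n" ws] rest rest_def by blast
      moreover have "b \<in> set ws" using rest by (simp add: ws b_def)
      ultimately have b: "b \<in> V" "lev b \<le> n"
        using less.prems(2) less.prems(3)[of b] by (auto simp: le_Suc_eq)
      have "link (last run) b" using less.prems(4) run rest by (auto simp: ws successively_append_iff b_def)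
      then have "K (last run) \<inter> K b \<noteq> {}" using l b by (auto simp: link_def)
      then have zb: "K z \<inter> K b \<noteq> {}" using z by blast
      have "length rest < length ws" using run by (simp add: ws)
      moreover have "successively link rest"
        using less.prems(4) by (auto simp: ws successively_append_iff)
      ultimately obtain ws' where ws': "ws' \<noteq> []" "set ws' \<subseteq> V" "\<forall>v\<in>set ws'. lev v \<le> n"
        "successively link ws'" "y \<in> K (last ws')" "hd ws' = b"
        "sum_list (map (total_cost y n) ws') + toll * \<theta> ^ (n - lev b) * g b
        \<le> sum_list (map (total_cost y (Suc n)) rest)"
        using less.hyps[of rest] rest less.prems b by (auto simp: ws b_def)
      \<comment> \<open>The extra summand of the claim, applied to \<open>rest\<close>, is the
        released reserve of its head \<open>b\<close>. It is spent here.\<close>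
      have "cost y (last us) + cost y z \<le> toll * \<theta> ^ (n - lev b) * g b"
        using toll_suffices[OF b z(1,2) zb] us(5) by (simp add: z_def)
      then have "sum_list (map (total_cost y n) (zs @ ws')) \<le> sum_list (map (total_cost y (Suc n)) ws)"
        using zs_cost ws'(7) by (simp add: ws)
      moreover have "successively link (zs @ ws')"
        using suc_zs ws'(1,4,6) linkI[OF z(1) b(1) zb] by (simp add: successively_append_iff successively_Cons zs_def)
      ultimately show ?thesis
        using ws' zs_V us(1,2) True
        by (intro exI[of _ "zs @ ws'"]) (auto simp: zs_def hd_run)
    qed
  qed
qed

lemma coarsen:
  assumes y: "y \<in> X" and "ws \<noteq> []" "set ws \<subseteq> V" "\<And>v. v \<in> set ws \<Longrightarrow> lev v \<le> n + i"
    "successively link ws" "x \<in> K (hd ws)" "y \<in> K (last ws)"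
  shows "\<exists>ws'. ws' \<noteq> [] \<and> set ws' \<subseteq> V \<and> (\<forall>v\<in>set ws'. lev v \<le> n)
    \<and> x \<in> K (hd ws')
    \<and> sum_list (map (total_cost y n) ws') \<le> sum_list (map (total_cost y (n + i)) ws)"
  using assms(2-)
proof (induction i arbitrary: ws)
  case 0
  then show ?case by auto
next
  case (Suc i)
  obtain ws' where ws': "ws' \<noteq> []" "set ws' \<subseteq> V" "\<forall>v\<in>set ws'. lev v \<le> n + i" "successively link ws'"
    "y \<in> K (last ws')" "hd ws' = (if lev (hd ws) = Suc (n + i) then P (hd ws) else hd ws)"
    "sum_list (map (total_cost y (n + i)) ws')
        + (if lev (hd ws) \<le> n + i then toll * \<theta> ^ (n + i - lev (hd ws)) * g (hd ws) else 0)
      \<le> sum_list (map (total_cost y (Suc (n + i))) ws)"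
    using coarsen_step[OF y Suc.prems(1,2) _ Suc.prems(4,6), of "n + i"] Suc.prems(3) by auto
  have hd: "hd ws \<in> V" using Suc.prems by auto
  have "x \<in> K (hd ws')" using ws'(6) Suc.prems(5) K_subset_P[OF hd] by auto
  moreover have "0 \<le> (if lev (hd ws) \<le> n + i then toll * \<theta> ^ (n + i - lev (hd ws)) * g (hd ws) else 0)"
    using toll_pos \<theta> g_pos[OF hd] by simp
  ultimately show ?case using Suc.IH[OF ws'(1,2) _ ws'(4) _ ws'(5)] ws'(3,7) by fastforce
qed

section \<open>Lower bounds for chains\<close>

definition chain :: "'b \<Rightarrow> 'b \<Rightarrow> 'a list \<Rightarrow> bool" where
  "chain x y ws \<longleftrightarrow> ws \<noteq> [] \<and> set ws \<subseteq> V \<and> x \<in> K (hd ws) \<and> y \<in> K (last ws)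
    \<and> successively (\<lambda>u v. K u \<inter> K v \<noteq> {}) ws"

text \<open>After coarsening to levels at most \<open>lev w\<close>, look at the head, whose cell
  contains \<open>x\<close>. On level \<open>lev w\<close> it neighbours \<open>w\<close> and is not
  near \<open>y\<close>, as \<open>x\<close> is too far from \<open>y\<close>, so its minimum is
  paid in full. On a coarser level the first term of its reserve already dominates the weight of
  \<open>w\<close>.\<close>

lemma chain_lower:
  "\<exists>c>0. \<forall>x y w ws. w \<in> V \<longrightarrow> x \<in> K w \<longrightarrow> y \<in> X \<longrightarrow> (c\<^sub>2 + reach) * q ^ lev w < d x y
     \<longrightarrow> chain x y ws \<longrightarrow> c * g w \<le> sum_list (map g ws)"
proof -
  define s where "s = 1 + toll / (1 - \<theta>)"
  have s: "s > 0" using toll_pos \<theta> by (simp add: s_def add_pos_pos)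
  \<comment> \<open>One term for each case at the head: \<open>B\<close> to pass from
    \<open>w\<close> to its neighbour with \<open>B ^ (J + M)\<close> to pass to the minimum, or
    \<open>toll / B\<close> from the reserve. Division by \<open>s\<close> undoes the bound of the
    total cost by \<open>s * g\<close>.\<close>
  define c where "c = min (1 / B ^ (J + M + 1)) (toll / B) / s"
  have c: "c > 0" using s toll_pos B_ge_1 by (simp add: c_def)
  have geo: "(\<Sum>j<m. \<theta> ^ j) \<le> 1 / (1 - \<theta>)" for m
    using \<theta> by (simp add: sum_gp_strict divide_right_mono)
  have "c * g w \<le> sum_list (map g ws)"
    if w: "w \<in> V" "x \<in> K w" and y: "y \<in> X" "(c\<^sub>2 + reach) * q ^ lev w < d x y" and ch: "chain x y ws"
    for x y w ws
  proof -
    define n where "n = lev w"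
    \<comment> \<open>Any bound of the form \<open>n + i\<close> on the levels will do, so a chain
      whose levels all lie below \<open>n\<close> is no special case.\<close>
    define i where "i = Max (lev ` set ws)"
    have ws: "ws \<noteq> []" "set ws \<subseteq> V" "x \<in> K (hd ws)" "y \<in> K (last ws)"
      "successively (\<lambda>u v. K u \<inter> K v \<noteq> {}) ws"
      using ch by (auto simp: chain_def)
    have levs: "lev v \<le> n + i" if "v \<in> set ws" for v
      using that Max_ge[of "lev ` set ws" "lev v"] by (simp add: i_def trans_le_add2)
    have "successively link ws"
      using ws(5) by (rule successively_mono) (use ws(2) linkI in auto)
    from coarsen[OF y(1) ws(1,2) levs this ws(3,4)]
    obtain ws' where ws': "ws' \<noteq> []" "set ws' \<subseteq> V" "\<forall>v\<in>set ws'. lev v \<le> n" "x \<in> K (hd ws')"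
      "sum_list (map (total_cost y n) ws') \<le> sum_list (map (total_cost y (n + i)) ws)" by blast
    have "total_cost y (n + i) v \<le> s * g v" if "v \<in> set ws" for v
    proof -
      have v: "v \<in> V" using that ws by blast
      have "toll * (\<Sum>j<n + i - lev v. \<theta> ^ j) * g v \<le> toll * (1 / (1 - \<theta>)) * g v"
        using geo toll_pos g_pos[OF v] by (intro mult_right_mono mult_left_mono) auto
      then show ?thesis using cost_le_g[OF v, of y] by (simp add: total_cost_def s_def algebra_simps)
    qed
    then have "sum_list (map (total_cost y (n + i)) ws) \<le> sum_list (map (\<lambda>v. s * g v) ws)"
      by (intro sum_list_mono) auto
    then have up: "sum_list (map (total_cost y n) ws') \<le> s * sum_list (map g ws)"
      using ws'(5) by (simp add: sum_list_const_mult)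
    define h where "h = hd ws'"
    have h: "h \<in> V" "lev h \<le> n" "x \<in> K h" "h \<in> set ws'" using ws' by (auto simp: h_def)
    have tc_nonneg: "0 \<le> total_cost y n v" if "v \<in> set ws'" for v
    proof -
      have v: "v \<in> V" using that ws' by blast
      show ?thesis using cost_nonneg[OF v, of y] toll_pos g_pos[OF v] \<theta>
        by (auto simp: total_cost_def intro!: add_nonneg_nonneg mult_nonneg_nonneg sum_nonneg)
    qed
    have "total_cost y n h \<le> sum_list (map (total_cost y n) ws')"
      using tc_nonneg h(4) by (intro member_le_sum_list) auto
    with up have up2: "total_cost y n h \<le> s * sum_list (map g ws)" by simp
    have "s * c * g w \<le> total_cost y n h"
    proof (cases "lev h = n")
      case True
      have hw: "(w, h) \<in> R" using h w True by (auto simp: R_def n_def)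
      have "\<not> near y h"
      proof
        assume "near y h"
        then obtain z where z: "z \<in> K h" "d z y \<le> reach * q ^ n" using True by (auto simp: near_def)
        have "d x y \<le> d x z + d z y"
          using h z y K_subset_X[OF h(1)] by (intro metric_X.triangle) auto
        also have "d x z \<le> c\<^sub>2 * q ^ n" using dist_le[OF h(1,3) z(1)] True by simp
        finally show False using z y(2) by (simp add: n_def algebra_simps)
      qed
      then have "total_cost y n h = low h" using total_cost_level[OF True] by (simp add: cost_def)
      have "g w \<le> B * g h" by (rule g_bal[OF hw])
      also have "\<dots> \<le> B * (B ^ (J + M) * low h)" using low_ge[OF h(1)] B_ge_1 by (intro mult_left_mono) auto
      finally have "1 / B ^ (J + M + 1) * g w \<le> low h" using B_ge_1 by (simp add: field_simps)
      moreover have "s * c * g w \<le> 1 / B ^ (J + M + 1) * g w"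
        using s g_pos[OF w(1)] by (intro mult_right_mono) (auto simp: c_def)
      ultimately show ?thesis using \<open>total_cost y n h = low h\<close> by simp
    next
      case False
      then have ln: "lev h < n" using h by simp
      obtain u where u: "u \<in> V" "lev u = n" "x \<in> K u" "(P ^^ (n - lev h)) u = h"
        using descend[OF h(1,3), of "n - lev h"] ln by auto
      have "(w, u) \<in> R" using u w by (auto simp: R_def n_def)
      then have "g w \<le> B * g u" by (rule g_bal)
      also have "g u \<le> g h" using g_le_ancestor[OF u(1), of "lev h" "n - lev h"] u ln by simp
      then have "B * g u \<le> B * g h" using B_ge_1 by simp
      finally have 1: "g w / B \<le> g h" using B_ge_1 by (simp add: divide_le_eq mult.commute)
      have "s * c * g w \<le> toll / B * g w"
        using s g_pos[OF w(1)] by (intro mult_right_mono) (auto simp: c_def)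
      also have "\<dots> = toll * (g w / B)" by simp
      also have "\<dots> \<le> toll * g h" using 1 toll_pos by (intro mult_left_mono) auto
      also have "\<dots> \<le> toll * (\<Sum>j<n - lev h. \<theta> ^ j) * g h"
      proof -
        have "\<theta> ^ 0 \<le> (\<Sum>j<n - lev h. \<theta> ^ j)" using ln \<theta> by (intro member_le_sum) auto
        then show ?thesis using toll_pos g_pos[OF h(1)]
            mult_left_mono[of 1 "\<Sum>j<n - lev h. \<theta> ^ j" "toll * g h"] by (simp add: mult_ac)
      qed
      also have "\<dots> \<le> total_cost y n h" using cost_nonneg[OF h(1)] by (simp add: total_cost_def)
      finally show ?thesis .
    qed
    with up2 have "s * (c * g w) \<le> s * sum_list (map g ws)" by simp
    then show ?thesis using s by simp
  qed
  then show ?thesis using c by blast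
qed

end

section \<open>The chain metric\<close>

lemma diam_leI:
  assumes "A \<noteq> {}" "\<And>x y. x \<in> A \<Longrightarrow> y \<in> A \<Longrightarrow> d x y \<le> c"
  shows "diam d A \<le> c"
  unfolding diam_def using assms by (auto intro!: cSUP_least)

lemma le_diamI:
  assumes "\<And>x y. x \<in> A \<Longrightarrow> y \<in> A \<Longrightarrow> d x y \<le> c" "x \<in> A" "y \<in> A"
  shows "d x y \<le> diam d A"
proof -
  have "bdd_above ((\<lambda>(x, y). d x y) ` (A \<times> A))"
    using assms(1) by (intro bdd_aboveI[of _ c]) auto
  then have "(case (x, y) of (x, y) \<Rightarrow> d x y) \<le> (SUP (x, y)\<in>A \<times> A. d x y)"
    using assms by (intro cSUP_upper) auto
  then show ?thesis using assms by (auto simp: diam_def)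
qed

context decaying_weight
begin

text \<open>The value 0 outside \<open>X\<close> secures symmetry and nonnegativity there, which
  \<open>Metric_space\<close> demands on the whole type.\<close>

definition chain_dist :: "'b \<Rightarrow> 'b \<Rightarrow> real" where
  "chain_dist x y = (if x \<in> X \<and> y \<in> X then Inf {sum_list (map g ws) |ws. chain x y ws} else 0)"

lemma chain_sum_nonneg: "chain x y ws \<Longrightarrow> 0 \<le> sum_list (map g ws)"
  by (rule sum_list_nonneg) (use g_pos in \<open>fastforce simp: chain_def\<close>)

lemma chain_root: "x \<in> X \<Longrightarrow> y \<in> X \<Longrightarrow> chain x y [root]"
  using root_in_V K_root by (simp add: chain_def)

lemma chain_rev: "chain x y ws \<Longrightarrow> chain y x (rev ws)"
  by (auto simp: chain_def hd_rev last_rev Int_commute)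

lemma chain_append: "chain x y ws \<Longrightarrow> chain y z ws' \<Longrightarrow> chain x z (ws @ ws')"
  by (auto simp: chain_def successively_append_iff)

lemma chain_dist_le:
  assumes "chain x y ws"
  shows "chain_dist x y \<le> sum_list (map g ws)"
proof -
  have "x \<in> X \<and> y \<in> X"
    using assms K_subset_X by (metis chain_def hd_in_set last_in_set subsetD)
  moreover have "bdd_below {sum_list (map g ws) |ws. chain x y ws}"
    using chain_sum_nonneg by (intro bdd_belowI[of _ 0]) auto
  ultimately show ?thesis unfolding chain_dist_def using assms by (auto intro!: cInf_lower)
qed

lemma chain_dist_geI:
  assumes "x \<in> X" "y \<in> X" "\<And>ws. chain x y ws \<Longrightarrow> c \<le> sum_list (map g ws)"
  shows "c \<le> chain_dist x y"
  unfolding chain_dist_def using assms chain_root[OF assms(1,2)]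
  by (auto intro!: cInf_greatest)

lemma chain_dist_nonneg: "0 \<le> chain_dist x y"
  using chain_dist_geI[of x y 0] chain_sum_nonneg by (cases "x \<in> X \<and> y \<in> X") (auto simp: chain_dist_def)

lemma chain_dist_commute: "chain_dist x y = chain_dist y x"
proof -
  have "chain_dist x y \<le> chain_dist y x" if "x \<in> X" "y \<in> X" for x y
  proof (rule chain_dist_geI[OF that(2,1)])
    fix ws assume "chain y x ws"
    then show "chain_dist x y \<le> sum_list (map g ws)"
      using chain_dist_le[OF chain_rev, of y x ws] by (simp add: rev_map[symmetric])
  qed
  moreover have "chain_dist x y = chain_dist y x" if "\<not> (x \<in> X \<and> y \<in> X)"
    using that by (auto simp: chain_dist_def)
  ultimately show ?thesis by (metis antisym)
qed

lemma chain_dist_triangle: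
  assumes "x \<in> X" "y \<in> X" "z \<in> X"
  shows "chain_dist x z \<le> chain_dist x y + chain_dist y z"
proof -
  have "chain_dist x z - chain_dist y z \<le> chain_dist x y"
  proof (rule chain_dist_geI[OF assms(1,2)])
    fix ws assume ws: "chain x y ws"
    have "chain_dist x z - sum_list (map g ws) \<le> chain_dist y z"
    proof (rule chain_dist_geI[OF assms(2,3)])
      fix ws' assume "chain y z ws'"
      then show "chain_dist x z - sum_list (map g ws) \<le> sum_list (map g ws')"
        using chain_dist_le[OF chain_append[OF ws]] by fastforce
    qed
    then show "chain_dist x z - chain_dist y z \<le> sum_list (map g ws)" by simp
  qed
  then show ?thesis by simp
qed

section \<open>Comparison of the chain distance with the weight\<close>

lemma chain_dist_le_g:
  assumes "w \<in> V" "x \<in> K w" "y \<in> K w"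
  shows "chain_dist x y \<le> g w"
  using chain_dist_le[of x y "[w]"] assms by (simp add: chain_def)

lemma chain_dist_le_relpow:
  assumes "(u, v) \<in> R ^^ i" "u \<in> V" "x \<in> K u" "y \<in> K v"
  shows "chain_dist x y \<le> (real i + 1) * B ^ i * g u"
  using assms(1,4)
proof (induction i arbitrary: v y)
  case 0 then show ?case using chain_dist_le_g assms by auto
next
  case (Suc i)
  obtain t where t: "(u, t) \<in> R ^^ i" "(t, v) \<in> R" using Suc.prems(1) by (elim relpow_Suc_E)
  then obtain z where z: "z \<in> K t" "z \<in> K v" by (auto simp: R_def)
  have tv: "t \<in> V" "v \<in> V" using t by (auto simp: R_def)
  have "chain_dist x y \<le> chain_dist x z + chain_dist z y"
    using assms z Suc.prems tv K_subset_X by (intro chain_dist_triangle) auto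
  also have "chain_dist x z \<le> (real i + 1) * B ^ i * g u" by (rule Suc.IH[OF t(1) z(1)])
  also have "\<dots> \<le> (real i + 1) * B ^ Suc i * g u"
    using B_ge_1 g_pos[OF assms(2)] by (intro mult_right_mono mult_left_mono power_increasing) auto
  also have "chain_dist z y \<le> g v" by (rule chain_dist_le_g[OF tv(2) z(2) Suc.prems(2)])
  also have "g v \<le> B ^ Suc i * g u" by (rule g_bal_relpow[OF relpow_R_sym[OF Suc.prems(1)]])
  finally show ?case by (simp add: algebra_simps)
qed

text \<open>Climbing \<open>l\<close> generations with \<open>q ^ l < a\<close> brings both points
  within reach of \<open>near_chain\<close>, at the cost of \<open>1 / \<epsilon> ^ l\<close>; near
  the root the root cell serves. The alternative \<open>lev w = 0\<close> matches the one in
  \<open>scale_index\<close>.\<close>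

lemma chain_dist_upper:
  "\<exists>C\<ge>1. \<forall>x y w. w \<in> V \<longrightarrow> x \<in> K w \<longrightarrow> y \<in> X \<longrightarrow> d x y \<le> q ^ lev w \<or> lev w = 0 \<longrightarrow> chain_dist x y \<le> C * g w"
proof -
  have "(\<lambda>n. q ^ n) \<longlonglongrightarrow> 0" using q by (intro LIMSEQ_realpow_zero) auto
  then have "\<forall>\<^sub>F n in sequentially. q ^ n < a" using a_pos order_tendstoD(2) by fastforce
  then have "\<forall>\<^sub>F n in sequentially. q ^ n < a \<and> 1 \<le> n"
    using eventually_ge_at_top[of 1] by eventually_elim simp
  then obtain l where l: "q ^ l < a" "1 \<le> l" unfolding eventually_sequentially by blast
  define C where "C = (real M + 1) * B ^ (M + 1) / \<epsilon> ^ l"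
  have MB: "1 \<le> (real M + 1) * B ^ (M + 1)"
    using B_ge_1 mult_mono[of 1 "real M + 1" 1 "B ^ (M + 1)"] one_le_power[of B "M + 1"] by simp
  have \<epsilon>l: "0 < \<epsilon> ^ l" "\<epsilon> ^ l \<le> 1" using \<epsilon>_pos \<epsilon>_le_1 by (auto intro: power_le_one)
  have C1: "1 / \<epsilon> ^ l \<le> C" unfolding C_def using MB \<epsilon>l by (intro divide_right_mono) auto
  have C2: "1 \<le> C" using C1 \<epsilon>l by (smt (verit) le_divide_eq_1_pos)
  have "chain_dist x y \<le> C * g w"
    if w: "w \<in> V" "x \<in> K w" and y: "y \<in> X" "d x y \<le> q ^ lev w \<or> lev w = 0" for x y w
  proof (cases "lev w < l")
    case True
    have x: "x \<in> X" using w K_subset_X by blast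
    have 1: "chain_dist x y \<le> 1" using chain_dist_le_g[OF root_in_V, of x y] K_root x y g_root by simp
    have "(P ^^ lev w) w = root" using ascend[OF w(1), of 0 "lev w"] lev_0D by simp
    then have "\<epsilon> ^ lev w \<le> g w" using g_ge_ancestor[OF w(1), of 0 "lev w"] g_root by simp
    moreover have "\<epsilon> ^ l \<le> \<epsilon> ^ lev w" using True \<epsilon>_pos \<epsilon>_le_1 by (intro power_decreasing) auto
    ultimately have "1 \<le> 1 / \<epsilon> ^ l * g w" using \<epsilon>l by (simp add: field_simps)
    also have "\<dots> \<le> C * g w" using C1 g_pos[OF w(1)] by (intro mult_right_mono) auto
    finally show ?thesis using 1 by simp
  next
    case False
      obtain n where n: "lev w = n + l" using False by (metis add.commute le_Suc_ex not_less)
      let ?w = "(P ^^ l) w"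
      have w': "?w \<in> V" "lev ?w = n" "x \<in> K ?w" using ascend[OF w(1) n] w(2) by auto
      have "d x y \<le> q ^ n * q ^ l" using y(2) n l(2) by (simp add: power_add)
      also have "\<dots> < a * q ^ n" using l(1) q by simp
      finally obtain u v where uv: "(u, v) \<in> R ^^ M" "u \<in> V" "lev u = n" "x \<in> K u" "y \<in> K v"
        using near_chain[of x y n] w y K_subset_X by blast
      have "(u, ?w) \<in> R" using uv w' by (auto simp: R_def)
      have "chain_dist x y \<le> (real M + 1) * B ^ M * g u"
        by (rule chain_dist_le_relpow[OF uv(1,2,4,5)])
      also have "\<dots> \<le> (real M + 1) * B ^ M * (B * g ?w)"
        using g_bal[OF \<open>(u, ?w) \<in> R\<close>] B_ge_1 by (intro mult_left_mono) auto
      also have "\<dots> = C * (\<epsilon> ^ l * g ?w)" using \<epsilon>_pos by (simp add: C_def)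
      also have "\<dots> \<le> C * g w" using g_ge_ancestor[OF w(1) n] C2 by (intro mult_left_mono) auto
      finally show ?thesis .
  qed
  then show ?thesis using C2 by blast
qed

text \<open>The threshold in \<open>chain_lower\<close> is fixed. Applying it to a descendant of
  \<open>w\<close> through \<open>x\<close>, \<open>l\<close> generations deeper, admits any
  positive threshold and loses only \<open>\<epsilon> ^ l\<close>.\<close>

lemma chain_dist_lower:
  assumes b: "b > 0"
  shows "\<exists>c>0. \<forall>x y w. w \<in> V \<longrightarrow> x \<in> K w \<longrightarrow> y \<in> X \<longrightarrow> b * q ^ lev w < d x y \<longrightarrow> c * g w \<le> chain_dist x y"
proof -
  obtain c where c: "c > 0" "\<And>x y w ws. w \<in> V \<Longrightarrow> x \<in> K w \<Longrightarrow> y \<in> X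
    \<Longrightarrow> (c\<^sub>2 + reach) * q ^ lev w < d x y \<Longrightarrow> chain x y ws \<Longrightarrow> c * g w \<le> sum_list (map g ws)"
    using chain_lower by blast
  have "(\<lambda>n. (c\<^sub>2 + reach) * q ^ n) \<longlonglongrightarrow> (c\<^sub>2 + reach) * 0"
    using q by (intro tendsto_intros LIMSEQ_realpow_zero) auto
  then have "\<forall>\<^sub>F n in sequentially. (c\<^sub>2 + reach) * q ^ n < b" using b order_tendstoD(2) by fastforce
  then obtain l where l: "(c\<^sub>2 + reach) * q ^ l < b" unfolding eventually_sequentially by blast
  have "c * \<epsilon> ^ l * g w \<le> chain_dist x y"
    if w: "w \<in> V" "x \<in> K w" and y: "y \<in> X" "b * q ^ lev w < d x y" for x y w
  proof -
    obtain u where u: "u \<in> V" "lev u = lev w + l" "x \<in> K u" "(P ^^ l) u = w"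
      using descend[OF w] by blast
    have "(c\<^sub>2 + reach) * q ^ lev u = ((c\<^sub>2 + reach) * q ^ l) * q ^ lev w" using u by (simp add: power_add)
    also have "\<dots> < b * q ^ lev w" using l q by simp
    also have "\<dots> < d x y" by (rule y(2))
    finally have "c * g u \<le> chain_dist x y"
      using c(2)[OF u(1,3) y(1)] w y K_subset_X by (intro chain_dist_geI) auto
    moreover have "c * (\<epsilon> ^ l * g w) \<le> c * g u"
      using g_ge_ancestor[OF u(1,2)] u(4) c(1) by (intro mult_left_mono) auto
    ultimately show ?thesis by simp
  qed
  then show ?thesis using c \<epsilon>_pos by (intro exI[of _ "c * \<epsilon> ^ l"]) auto
qed

lemma small_scale: "0 < s \<Longrightarrow> \<exists>n. q ^ n < s \<and> D * \<theta> ^ n < s"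
proof -
  assume s: "0 < s"
  have "(\<lambda>n. q ^ n) \<longlonglongrightarrow> 0" "(\<lambda>n. D * \<theta> ^ n) \<longlonglongrightarrow> D * 0"
    using q \<theta> by (intro tendsto_intros LIMSEQ_realpow_zero; simp)+
  then have "\<forall>\<^sub>F n in sequentially. q ^ n < s" "\<forall>\<^sub>F n in sequentially. D * \<theta> ^ n < s"
    using s order_tendstoD(2) by fastforce+
  then have "\<forall>\<^sub>F n in sequentially. q ^ n < s \<and> D * \<theta> ^ n < s" by eventually_elim simp
  then show ?thesis unfolding eventually_sequentially by blast
qed

lemma g_le_level: "w \<in> V \<Longrightarrow> g w \<le> D * \<theta> ^ lev w"
  using g_le_decay[of w 0 "lev w"] ascend[of w 0 "lev w"] lev_0D g_root by fastforce

lemma chain_dist_eq_0_iff: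
  assumes "x \<in> X" "y \<in> X"
  shows "chain_dist x y = 0 \<longleftrightarrow> x = y"
proof
  assume 0: "chain_dist x y = 0"
  show "x = y"
  proof (rule ccontr)
    assume "x \<noteq> y"
    then have "d x y > 0" using assms by simp
    then obtain n where n: "q ^ n < d x y" using small_scale by blast
    obtain c where c: "c > 0" "\<And>x y w. w \<in> V \<Longrightarrow> x \<in> K w \<Longrightarrow> y \<in> X
        \<Longrightarrow> 1 * q ^ lev w < d x y \<Longrightarrow> c * g w \<le> chain_dist x y"
      using chain_dist_lower[of 1] by auto
    obtain w where w: "w \<in> V" "lev w = n" "x \<in> K w" using covering assms by blast
    have "c * g w \<le> 0" using c(2)[OF w(1,3) assms(2)] w n 0 by simp
    then show False using c(1) g_pos[OF w(1)] by (simp add: mult_le_0_iff)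
  qed
next
  assume eq: "x = y"
  show "chain_dist x y = 0"
  proof (rule ccontr)
    \<comment> \<open>Chains are nonempty, so even the distance of a point to itself is an infimum
      of positive sums; single cells of high level make it vanish.\<close>
    assume "chain_dist x y \<noteq> 0"
    then have "0 < chain_dist x y" using chain_dist_nonneg[of x y] by simp
    then obtain n where n: "D * \<theta> ^ n < chain_dist x y" using small_scale by blast
    obtain w where w: "w \<in> V" "lev w = n" "x \<in> K w" using covering assms by blast
    then have "chain_dist x y \<le> D * \<theta> ^ n" using chain_dist_le_g[of w x y] eq g_le_level[of w] by simp
    then show False using n by simp
  qed
qed

lemma chain_metric: "Metric_space X chain_dist"
  by unfold_locales
    (use chain_dist_nonneg chain_dist_commute chain_dist_eq_0_iff chain_dist_triangle in blast)+

text \<open>Later arguments see the metric only through these comparisons with \<open>g\<close>, so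
  the chain construction disappears behind the existential.\<close>

lemma normalized_metric_exists:
  "\<exists>\<rho> C. Metric_space X \<rho> \<and> diam \<rho> X = 1 \<and> C \<ge> 1
    \<and> (\<forall>w\<in>V. \<forall>x\<in>K w. \<forall>y\<in>K w. \<rho> x y \<le> C * g w)
    \<and> (\<forall>x y w. w \<in> V \<longrightarrow> x \<in> K w \<longrightarrow> y \<in> X \<longrightarrow> d x y \<le> q ^ lev w \<or> lev w = 0 \<longrightarrow> \<rho> x y \<le> C * g w)
    \<and> (\<forall>b>0. \<exists>c>0. \<forall>x y w. w \<in> V \<longrightarrow> x \<in> K w \<longrightarrow> y \<in> X \<longrightarrow> b * q ^ lev w < d x y \<longrightarrow> c * g w \<le> \<rho> x y)"
proof -
  define \<Delta> where "\<Delta> = diam chain_dist X"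
  have Xne: "X \<noteq> {}" using K_nonempty[OF root_in_V] K_root by simp
  have le1: "chain_dist x y \<le> 1" if "x \<in> X" "y \<in> X" for x y
    using chain_dist_le_g[OF root_in_V, of x y] that K_root g_root by simp
  have le\<Delta>: "chain_dist x y \<le> \<Delta>" if "x \<in> X" "y \<in> X" for x y
    unfolding \<Delta>_def using le1 that by (rule le_diamI)
  obtain x y where "x \<in> X" "y \<in> X" "c\<^sub>1 \<le> d x y"
    using dist_ge[OF root_in_V] K_root lev_root by auto
  then have "x \<noteq> y" using c\<^sub>1_pos metric_X.zero[of x y] by force
  then have "0 < chain_dist x y"
    using chain_dist_eq_0_iff[OF \<open>x \<in> X\<close> \<open>y \<in> X\<close>] chain_dist_nonneg[of x y] by simp
  then have \<Delta>: "0 < \<Delta>" using le\<Delta>[OF \<open>x \<in> X\<close> \<open>y \<in> X\<close>] by simp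
  have \<Delta>1: "\<Delta> \<le> 1" unfolding \<Delta>_def using Xne le1 by (rule diam_leI)
  define \<rho> where "\<rho> = (\<lambda>x y. chain_dist x y / \<Delta>)"
  interpret chain: Metric_space X chain_dist by (rule chain_metric)
  have 1: "Metric_space X \<rho>"
    using \<Delta> chain.nonneg chain.commute chain.zero chain.triangle
    by unfold_locales (auto simp: \<rho>_def add_divide_distrib[symmetric] divide_right_mono)
  have "diam \<rho> X \<le> 1" using Xne le\<Delta> \<Delta> by (intro diam_leI) (auto simp: \<rho>_def)
  moreover have "1 \<le> diam \<rho> X"
  proof -
    have "chain_dist x y \<le> diam \<rho> X * \<Delta>" if "x \<in> X" "y \<in> X" for x y
    proof -
      have "\<rho> x y \<le> diam \<rho> X"
        by (rule le_diamI[of _ _ 1]) (use le\<Delta> \<Delta> that in \<open>auto simp: \<rho>_def\<close>)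
      then show ?thesis using \<Delta> by (simp add: \<rho>_def divide_le_eq)
    qed
    then have "\<Delta> \<le> diam \<rho> X * \<Delta>" unfolding \<Delta>_def using Xne by (intro diam_leI) auto
    then show ?thesis using \<Delta> by simp
  qed
  ultimately have 2: "diam \<rho> X = 1" by simp
  obtain C where C: "C \<ge> 1" "\<And>x y w. w \<in> V \<Longrightarrow> x \<in> K w \<Longrightarrow> y \<in> X
      \<Longrightarrow> d x y \<le> q ^ lev w \<or> lev w = 0 \<Longrightarrow> chain_dist x y \<le> C * g w"
    using chain_dist_upper by blast
  have C\<Delta>: "C / \<Delta> \<ge> 1" using C(1) \<Delta> \<Delta>1 by simp
  have 3: "\<rho> x y \<le> C / \<Delta> * g w" if "w \<in> V" "x \<in> K w" "y \<in> K w" for x y w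
  proof -
    have "1 * g w \<le> C * g w" using C(1) g_pos[OF that(1)] by (intro mult_right_mono) auto
    then have "chain_dist x y \<le> C * g w" using chain_dist_le_g[OF that] by linarith
    then show ?thesis using \<Delta> by (simp add: \<rho>_def divide_right_mono)
  qed
  have 4: "\<rho> x y \<le> C / \<Delta> * g w"
    if "w \<in> V" "x \<in> K w" "y \<in> X" "d x y \<le> q ^ lev w \<or> lev w = 0" for x y w
    using C(2)[OF that] \<Delta> by (simp add: \<rho>_def divide_right_mono)
  have 5: "\<exists>c>0. \<forall>x y w. w \<in> V \<longrightarrow> x \<in> K w \<longrightarrow> y \<in> X \<longrightarrow> b * q ^ lev w < d x y \<longrightarrow> c * g w \<le> \<rho> x y"
    if "b > 0" for b
  proof -
    obtain c where c: "c > 0" "\<And>x y w. w \<in> V \<Longrightarrow> x \<in> K w \<Longrightarrow> y \<in> X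
        \<Longrightarrow> b * q ^ lev w < d x y \<Longrightarrow> c * g w \<le> chain_dist x y"
      using chain_dist_lower[OF \<open>b > 0\<close>] by blast
    then show ?thesis
      using \<Delta> by (intro exI[of _ "c / \<Delta>"]) (auto simp: \<rho>_def divide_right_mono)
  qed
  show ?thesis
    by (rule exI[of _ \<rho>], rule exI[of _ "C / \<Delta>"])
      (intro conjI ballI allI impI 1 2 C\<Delta> 3 4 5; assumption)
qed

end

section \<open>The random branch and its distribution\<close>

context decaying_weight
begin

text \<open>\<open>g_mass\<close> makes the ratios sum to 1. The point mass off \<open>V\<close> is
  a default, so that every factor of the product below is a probability space.\<close>

definition child_pmf :: "'a \<Rightarrow> 'a pmf" where
  "child_pmf w = (if w \<in> V
     then embed_pmf (\<lambda>v. if v \<in> ch w then g v powr p / g w powr p else 0) else return_pmf w)"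

lemma pmf_child:
  assumes "w \<in> V" "v \<in> ch w"
  shows "pmf (child_pmf w) v = g v powr p / g w powr p"
proof -
  let ?f = "\<lambda>v. if v \<in> ch w then g v powr p / g w powr p else 0"
  have "(\<integral>\<^sup>+ v. ennreal (?f v) \<partial>count_space UNIV) = (\<Sum>v\<in>ch w. ennreal (?f v))"
    using finite_ch[OF assms(1)] by (intro nn_integral_count_space') auto
  also have "\<dots> = ennreal (\<Sum>v\<in>ch w. g v powr p / g w powr p)"
    by (subst sum_ennreal[symmetric]) (auto intro!: sum.cong)
  also have "(\<Sum>v\<in>ch w. g v powr p / g w powr p) = 1"
    using g_mass[OF assms(1)] g_pos[OF assms(1)] by (simp add: sum_divide_distrib[symmetric])
  finally have "pmf (embed_pmf ?f) v = ?f v"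
    by (intro pmf_embed_pmf) auto
  then show ?thesis using assms by (simp add: child_pmf_def)
qed

text \<open>Every vertex draws its child in advance and independently. Passing through
  \<open>w\<close> is then a cylinder event over the ancestors of \<open>w\<close>.\<close>

definition choices :: "('a \<Rightarrow> 'a) measure" where
  "choices = PiM UNIV (\<lambda>w. measure_pmf (child_pmf w))"

sublocale choices: product_prob_space "\<lambda>w. measure_pmf (child_pmf w)" UNIV
  rewrites "PiM UNIV (\<lambda>w. measure_pmf (child_pmf w)) = choices"
  by unfold_locales (simp add: choices_def)

lemma space_choices: "space choices = UNIV"
  by (simp add: choices_def space_PiM PiE_UNIV_domain)

lemma component_measurable: "{\<omega>. \<omega> w \<in> S} \<in> sets choices"
proof -
  have "(\<lambda>\<omega>. \<omega> w) \<in> choices \<rightarrow>\<^sub>M measure_pmf (child_pmf w)"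
    unfolding choices_def by (rule measurable_component_singleton) simp
  from measurable_sets[OF this, of S] show ?thesis
    by (simp add: space_choices vimage_def)
qed

definition branch :: "'a \<Rightarrow> ('a \<Rightarrow> 'a) set" where
  "branch w = {\<omega>. \<forall>j<lev w. \<omega> ((P ^^ Suc j) w) = (P ^^ j) w}"

lemma branch_measurable: "branch w \<in> sets choices"
proof -
  have "branch w = (\<Inter>j\<in>{..<lev w}. {\<omega>. \<omega> ((P ^^ Suc j) w) \<in> {(P ^^ j) w}})"
    by (auto simp: branch_def)
  moreover have "\<dots> \<in> sets choices"
  proof (cases "{..<lev w} = {}")
    case True then show ?thesis using sets.top[of choices] by (simp add: space_choices)
  qed (intro sets.finite_INT component_measurable; simp)
  ultimately show ?thesis by (simp only:)
qed

text \<open>Draws at distinct ancestors are independent, and the product of the ratios telescopes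
  down to the root, where \<open>g\<close> is 1.\<close>

lemma measure_branch:
  assumes w: "w \<in> V"
  shows "measure choices (branch w) = g w powr p"
proof -
  define n where "n = lev w"
  define A where "A = (\<lambda>j. (P ^^ j) w)"
  have A: "A j \<in> V" "lev (A j) = n - j" if "j \<le> n" for j
    using ascend[OF w, of "n - j" j] that by (auto simp: A_def n_def)
  have inj: "inj_on (\<lambda>j. A (Suc j)) {..<n}"
  proof (rule inj_onI)
    fix i j assume "i \<in> {..<n}" "j \<in> {..<n}" "A (Suc i) = A (Suc j)"
    then show "i = j" using A(2)[of "Suc i"] A(2)[of "Suc j"] by simp
  qed
  have ch: "A j \<in> ch (A (Suc j))" if "j < n" for j
    using ch_P[of "A j" "n - Suc j"] A[of j] that by (simp add: A_def)
  \<comment> \<open>Here \<open>J\<close> is the set of proper ancestors of \<open>w\<close>. Their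
    levels are distinct, so the set \<open>S u\<close> of prescribed draws is a singleton for each
    of them.\<close>
  define J where "J = (\<lambda>j. A (Suc j)) ` {..<n}"
  define S where "S = (\<lambda>u. {A j |j. j < n \<and> A (Suc j) = u})"
  have S: "S (A (Suc j)) = {A j}" if "j < n" for j
    using inj_onD[OF inj] that by (fastforce simp: S_def)
  have "branch w = {\<omega> \<in> space choices. \<forall>u\<in>J. \<omega> u \<in> S u}"
    using S by (auto simp: branch_def J_def A_def n_def space_choices)
  then have "emeasure choices (branch w) = (\<Prod>u\<in>J. emeasure (measure_pmf (child_pmf u)) (S u))"
    using choices.emeasure_PiM_Collect[of J S] by (simp add: J_def)
  also have "\<dots> = ennreal (\<Prod>u\<in>J. measure (measure_pmf (child_pmf u)) (S u))"
    by (simp add: measure_pmf.emeasure_eq_measure prod_ennreal)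
  finally have "measure choices (branch w) = (\<Prod>u\<in>J. measure (measure_pmf (child_pmf u)) (S u))"
    by (simp add: measure_def prod_nonneg)
  also have "\<dots> = (\<Prod>j<n. measure (measure_pmf (child_pmf (A (Suc j)))) (S (A (Suc j))))"
    unfolding J_def using inj by (simp add: prod.reindex)
  also have "\<dots> = (\<Prod>j<n. g (A j) powr p / g (A (Suc j)) powr p)"
  proof (rule prod.cong)
    fix j assume "j \<in> {..<n}"
    then show "measure (measure_pmf (child_pmf (A (Suc j)))) (S (A (Suc j))) = g (A j) powr p / g (A (Suc j)) powr p"
      using S[of j] pmf_child[OF _ ch[of j]] A(1)[of "Suc j"] by (simp add: measure_pmf_single)
  qed simp
  also have "\<dots> = g (A 0) powr p / g (A n) powr p"
  proof -
    have "g (A i) powr p \<noteq> 0" if "i \<le> n" for i using g_pos[OF A(1)[OF that]] by simp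
    then show ?thesis by (rule prod_lessThan_telescope')
  qed
  also have "A n = root" using A[of n] lev_0D by simp
  finally show ?thesis using g_root by (simp add: A_def)
qed

text \<open>Draws outside \<open>ch w\<close> have probability zero, but overriding them makes every
  walk a true branch, so that its limit exists surely and not just almost surely.\<close>

definition next_vertex :: "('a \<Rightarrow> 'a) \<Rightarrow> 'a \<Rightarrow> 'a" where
  "next_vertex \<omega> w = (if \<omega> w \<in> ch w then \<omega> w else (SOME v. v \<in> ch w))"

primrec walk :: "('a \<Rightarrow> 'a) \<Rightarrow> nat \<Rightarrow> 'a" where
  "walk \<omega> 0 = root"
| "walk \<omega> (Suc n) = next_vertex \<omega> (walk \<omega> n)"

lemma ch_nonempty: "w \<in> V \<Longrightarrow> ch w \<noteq> {}"
  using inner_child by blast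

lemma next_vertex_in_ch: "w \<in> V \<Longrightarrow> next_vertex \<omega> w \<in> ch w"
  using ch_nonempty some_in_eq[of "ch w"] by (auto simp: next_vertex_def)

lemma walk_in_V: "walk \<omega> n \<in> V" and lev_walk: "lev (walk \<omega> n) = n"
proof -
  have "walk \<omega> n \<in> V \<and> lev (walk \<omega> n) = n"
  proof (induction n)
    case (Suc n)
    then show ?case using next_vertex_in_ch[of "walk \<omega> n" \<omega>] by (simp add: ch_def)
  qed (simp add: root_in_V lev_root)
  then show "walk \<omega> n \<in> V" "lev (walk \<omega> n) = n" by auto
qed

lemma walk_Suc_in_ch: "walk \<omega> (Suc n) \<in> ch (walk \<omega> n)"
  using next_vertex_in_ch walk_in_V by simp

lemma walk_branch:
  assumes "w \<in> V" "\<omega> \<in> branch w" "lev w = n"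
  shows "walk \<omega> n = w"
  using assms
proof (induction n arbitrary: w)
  case 0 show ?case using lev_0D[OF 0(1,3)] walk.simps(1)[of \<omega>] by (simp only:)
next
  case (Suc n)
  have Pw: "P w \<in> V" "lev (P w) = n" using P_in_V lev_P Suc.prems by auto
  have "\<omega> \<in> branch (P w)"
    unfolding branch_def
  proof (intro CollectI allI impI)
    fix j assume "j < lev (P w)"
    then have "\<omega> ((P ^^ Suc (Suc j)) w) = (P ^^ Suc j) w"
      using Suc.prems Pw unfolding branch_def by (auto simp del: funpow.simps)
    then show "\<omega> ((P ^^ Suc j) (P w)) = (P ^^ j) (P w)" by (simp add: funpow_swap1)
  qed
  then have "walk \<omega> n = P w" using Suc.IH Pw by blast
  moreover have "\<omega> (P w) = w" using Suc.prems by (force simp: branch_def)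
  ultimately show ?case using ch_P[OF Suc.prems(1,3)] by (simp add: next_vertex_def)
qed

lemma walk_measurable: "{\<omega>. walk \<omega> n = v} \<in> sets choices"
proof (induction n arbitrary: v)
  case 0
  then show ?case using sets.top[of choices] by (cases "v = root") (auto simp: space_choices)
next
  case (Suc n)
  have 1: "{\<omega>. next_vertex \<omega> w = v} \<in> sets choices" for w
  proof -
    have "{\<omega>. next_vertex \<omega> w = v}
      = {\<omega>. \<omega> w \<in> {u. (if u \<in> ch w then u else (SOME v. v \<in> ch w)) = v}}"
      by (auto simp: next_vertex_def)
    then show ?thesis using component_measurable by (simp only:)
  qed
  have "{\<omega>. walk \<omega> (Suc n) = v}
      = (\<Union>w\<in>{v \<in> V. lev v = n}. {\<omega>. walk \<omega> n = w} \<inter> {\<omega>. next_vertex \<omega> w = v})"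
    using walk_in_V lev_walk by auto
  moreover have "\<dots> \<in> sets choices"
    using Suc 1 by (intro sets.finite_UN[OF finite_level] sets.Int) auto
  ultimately show ?case by simp
qed

section \<open>The limit point of a branch\<close>

definition limit :: "('a \<Rightarrow> 'a) \<Rightarrow> 'b" where
  "limit \<omega> = (SOME x. \<forall>n. x \<in> K (walk \<omega> n))"

lemma limit_in_K: "limit \<omega> \<in> K (walk \<omega> n)"
proof -
  have "(\<Inter>n. K (walk \<omega> n)) \<noteq> {}"
    using branch_nonempty[of "walk \<omega>"] walk_Suc_in_ch by simp
  then have "\<exists>x. \<forall>n. x \<in> K (walk \<omega> n)" by blast
  then show ?thesis unfolding limit_def by (rule someI2_ex) blast
qed

lemma limit_in_X: "limit \<omega> \<in> X"
  using limit_in_K[of \<omega> 0] K_root by simp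

text \<open>Cells shrink to the limit point, so a closed set meeting all of them contains it. This
  reduces measurability of the limit to the finitely many values of the walk on each level.\<close>

lemma limit_in_closed_iff:
  assumes F: "closedin metric_X.mtopology F"
  shows "limit \<omega> \<in> F \<longleftrightarrow> (\<forall>n. K (walk \<omega> n) \<inter> F \<noteq> {})"
proof
  assume "limit \<omega> \<in> F" then show "\<forall>n. K (walk \<omega> n) \<inter> F \<noteq> {}" using limit_in_K by blast
next
  assume meets: "\<forall>n. K (walk \<omega> n) \<inter> F \<noteq> {}"
  show "limit \<omega> \<in> F"
  proof (rule ccontr)
    assume "limit \<omega> \<notin> F"
    then obtain r where r: "r > 0" "disjnt F (metric_X.mball (limit \<omega>) r)"
      using F limit_in_X[of \<omega>] unfolding metric_X.closedin_metric by blast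
    obtain n where "q ^ n < r / c\<^sub>2" using small_scale[of "r / c\<^sub>2"] r c\<^sub>2_pos by auto
    then have n: "c\<^sub>2 * q ^ n < r" using c\<^sub>2_pos by (simp add: field_simps)
    obtain z where z: "z \<in> K (walk \<omega> n)" "z \<in> F" using meets by blast
    have "d (limit \<omega>) z < r"
      using dist_le[OF walk_in_V limit_in_K z(1)] lev_walk n by (metis order_le_less_trans)
    then have "z \<in> metric_X.mball (limit \<omega>) r"
      using z K_subset_X[OF walk_in_V] limit_in_X by auto
    then show False using r z by (auto simp: disjnt_def)
  qed
qed

lemma limit_closed_measurable:
  assumes F: "closedin metric_X.mtopology F"
  shows "{\<omega>. limit \<omega> \<in> F} \<in> sets choices"
proof -
  have "{\<omega>. limit \<omega> \<in> F} = (\<Inter>n. \<Union>w\<in>{v \<in> {v \<in> V. lev v = n}. K v \<inter> F \<noteq> {}}. {\<omega>. walk \<omega> n = w})"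
    using limit_in_closed_iff[OF F] walk_in_V lev_walk by auto
  moreover have "\<dots> \<in> sets choices"
  proof (rule sets.countable_INT'')
    fix n
    show "(\<Union>w\<in>{v \<in> {v \<in> V. lev v = n}. K v \<inter> F \<noteq> {}}. {\<omega>. walk \<omega> n = w}) \<in> sets choices"
      by (intro sets.finite_UN walk_measurable finite_Collect_conjI disjI1) (simp add: finite_level)
  qed (use sets.top[of choices] in \<open>simp_all add: space_choices\<close>)
  ultimately show ?thesis by (simp only:)
qed

section \<open>The law of the limit point\<close>

definition borel_X :: "'b measure" where
  "borel_X = sigma X {U. openin metric_X.mtopology U}"

lemma opens_subset: "{U. openin metric_X.mtopology U} \<subseteq> Pow X"
  using openin_subset by fastforce

lemma space_borel_X: "space borel_X = X"
  and sets_borel_X: "sets borel_X = sigma_sets X {U. openin metric_X.mtopology U}"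
  unfolding borel_X_def using opens_subset by (simp_all add: space_measure_of_conv sets_measure_of)

lemma closed_in_borel_X: "closedin metric_X.mtopology F \<Longrightarrow> F \<in> sets borel_X"
proof -
  assume F: "closedin metric_X.mtopology F"
  then have "X - F \<in> sets borel_X" unfolding sets_borel_X by (auto simp: closedin_def)
  then have "space borel_X - (X - F) \<in> sets borel_X" by (rule sets.compl_sets)
  moreover have "X - (X - F) = F" using closedin_subset[OF F] by auto
  ultimately show ?thesis by (simp add: space_borel_X)
qed

lemma limit_measurable: "limit \<in> choices \<rightarrow>\<^sub>M borel_X"
  unfolding borel_X_def
proof (rule measurable_measure_of[OF opens_subset])
  show "limit \<in> space choices \<rightarrow> X" using limit_in_X by simp
  fix U assume "U \<in> {U. openin metric_X.mtopology U}"
  then have "closedin metric_X.mtopology (X - U)" by (auto simp: closedin_def Diff_Diff_Int inf_absorb2 dest: openin_subset)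
  then have "space choices - {\<omega>. limit \<omega> \<in> X - U} \<in> sets choices"
    using limit_closed_measurable by blast
  moreover have "limit -` U \<inter> space choices = space choices - {\<omega>. limit \<omega> \<in> X - U}"
    using limit_in_X by auto
  ultimately show "limit -` U \<inter> space choices \<in> sets choices" by simp
qed

definition mu :: "'b measure" where "mu = distr choices borel_X limit"

lemma sets_mu: "sets mu = sigma_sets X {U. openin metric_X.mtopology U}"
  and space_mu: "space mu = X"
  by (simp_all add: mu_def sets_borel_X space_borel_X)

sublocale mu: prob_space mu
  unfolding mu_def by (rule choices.prob_space_distr[OF limit_measurable])

lemma K_in_sets: "w \<in> V \<Longrightarrow> K w \<in> sets mu"
  using closed_in_borel_X[OF K_closed] by (simp add: mu_def)

lemma measure_K: "w \<in> V \<Longrightarrow> measure mu (K w) = measure choices {\<omega>. limit \<omega> \<in> K w}"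
  unfolding mu_def using closed_in_borel_X[OF K_closed]
  by (simp add: measure_distr[OF limit_measurable] vimage_def space_choices)

text \<open>Only one inclusion of events holds: since cells overlap, the limit can lie in
  \<open>K w\<close> although the walk avoids \<open>w\<close>. The upper bound therefore has to
  count all neighbours of \<open>w\<close>.\<close>

lemma measure_K_ge:
  assumes "w \<in> V"
  shows "g w powr p \<le> measure mu (K w)"
proof -
  have "branch w \<subseteq> {\<omega>. limit \<omega> \<in> K w}"
    using walk_branch[OF assms _ refl] limit_in_K by (metis CollectI subsetI)
  then have "measure choices (branch w) \<le> measure choices {\<omega>. limit \<omega> \<in> K w}"
    by (rule choices.finite_measure_mono) (rule limit_closed_measurable[OF K_closed[OF assms]])
  then show ?thesis using measure_branch measure_K assms by simp
qed

text \<open>The masses \<open>g(u)^p\<close> of a level add up to 1, so it suffices to discard the branches that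
  end away from \<open>w\<close>.\<close>

lemma measure_K_le:
  assumes w: "w \<in> V"
  shows "measure mu (K w) \<le> real L * B powr p * g w powr p"
proof -
  define lv where "lv = {v \<in> V. lev v = lev w}"
  define far where "far = lv - R `` {w}"
  have near_lv: "R `` {w} \<subseteq> lv" by (auto simp: lv_def R_def)
  have fin: "finite lv" unfolding lv_def by (rule finite_level)
  have disj: "disjoint_family_on branch far"
    using walk_branch unfolding disjoint_family_on_def far_def lv_def by blast
  have "measure choices (\<Union>u\<in>far. branch u) = (\<Sum>u\<in>far. measure choices (branch u))"
    using fin branch_measurable disj by (intro choices.finite_measure_finite_Union) (auto simp: far_def)
  also have "\<dots> = (\<Sum>u\<in>far. g u powr p)"
    by (rule sum.cong) (auto simp: measure_branch far_def lv_def)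
  finally have far: "measure choices (\<Union>u\<in>far. branch u) = (\<Sum>u\<in>far. g u powr p)" .
  have "(\<Sum>u\<in>lv. g u powr p) = 1"
  proof -
    have "lv = {v \<in> V. lev v = lev root + lev w \<and> (P ^^ lev w) v = root}"
      using ascend[of _ 0 "lev w"] lev_0D lev_root by (auto simp: lv_def)
    then show ?thesis using g_mass_descendants(2)[OF root_in_V, of "lev w"] g_root by simp
  qed
  moreover have "(\<Sum>u\<in>lv. g u powr p) = (\<Sum>u\<in>far. g u powr p) + (\<Sum>u\<in>R `` {w}. g u powr p)"
    unfolding far_def by (rule sum.subset_diff[OF near_lv fin])
  ultimately have sum1: "(\<Sum>u\<in>far. g u powr p) = 1 - (\<Sum>u\<in>R `` {w}. g u powr p)" by simp
  have m: "(\<Union>u\<in>far. branch u) \<in> sets choices"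
    using fin branch_measurable by (intro sets.finite_UN) (auto simp: far_def)
  have "{\<omega>. limit \<omega> \<in> K w} \<subseteq> space choices - (\<Union>u\<in>far. branch u)"
  proof
    fix \<omega> assume lim: "\<omega> \<in> {\<omega>. limit \<omega> \<in> K w}"
    have "\<omega> \<notin> branch u" if "u \<in> far" for u
    proof
      assume "\<omega> \<in> branch u"
      then have "walk \<omega> (lev w) = u" using walk_branch that by (auto simp: far_def lv_def)
      then have "limit \<omega> \<in> K u" using limit_in_K by metis
      then have "(w, u) \<in> R" using w lim that by (auto simp: R_def far_def lv_def)
      then show False using that by (simp add: far_def)
    qed
    then show "\<omega> \<in> space choices - (\<Union>u\<in>far. branch u)" by (simp add: space_choices)
  qed
  then have "measure choices {\<omega>. limit \<omega> \<in> K w} \<le> measure choices (space choices - (\<Union>u\<in>far. branch u))"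
    using m by (intro choices.finite_measure_mono) auto
  also have "\<dots> = (\<Sum>u\<in>R `` {w}. g u powr p)"
    using choices.prob_compl[OF m] far sum1 by simp
  also have "\<dots> \<le> (\<Sum>u\<in>R `` {w}. (B * g w) powr p)"
  proof (rule sum_mono)
    fix u assume "u \<in> R `` {w}"
    then have "(u, w) \<in> R" "u \<in> V" using relpow_R_sym[of w u 1] by (auto simp: R_def)
    then show "g u powr p \<le> (B * g w) powr p"
      using g_bal g_pos p_pos by (intro powr_mono2) (auto simp: less_imp_le)
  qed
  also have "\<dots> = real (card (R `` {w})) * (B powr p * g w powr p)"
    using B_ge_1 g_pos[OF w] by (simp add: powr_mult)
  also have "\<dots> \<le> real L * (B powr p * g w powr p)"
    using card_R[OF w] by (intro mult_right_mono) auto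
  finally show ?thesis using measure_K[OF w] by (simp add: mult.assoc)
qed

end

section \<open>Quasisymmetry and Ahlfors regularity\<close>

locale comparable_metric = decaying_weight +
  fixes \<rho> :: "'b \<Rightarrow> 'b \<Rightarrow> real" and C :: real
  assumes \<rho>_metric: "Metric_space X \<rho>" and diam_\<rho>: "diam \<rho> X = 1" and C_ge_1: "C \<ge> 1"
    and \<rho>_le_K: "\<And>w x y. w \<in> V \<Longrightarrow> x \<in> K w \<Longrightarrow> y \<in> K w \<Longrightarrow> \<rho> x y \<le> C * g w"
    and \<rho>_le: "\<And>x y w. w \<in> V \<Longrightarrow> x \<in> K w \<Longrightarrow> y \<in> X \<Longrightarrow> d x y \<le> q ^ lev w \<or> lev w = 0 \<Longrightarrow> \<rho> x y \<le> C * g w"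
    and \<rho>_ge: "\<And>b. b > 0 \<Longrightarrow> \<exists>c>0. \<forall>x y w. w \<in> V \<longrightarrow> x \<in> K w \<longrightarrow> y \<in> X \<longrightarrow> b * q ^ lev w < d x y \<longrightarrow> c * g w \<le> \<rho> x y"
begin

sublocale metric_\<rho>: Metric_space X \<rho> by (rule \<rho>_metric)

text \<open>Each metric has small balls inside the balls of the other: \<open>\<rho>_le\<close> with
  the decay of \<open>g\<close> gives one direction, \<open>\<rho>_ge\<close> the other.\<close>

lemma mtopology_eq: "metric_\<rho>.mtopology = metric_X.mtopology"
proof -
  have 1: "\<exists>s>0. metric_X.mball x s \<subseteq> metric_\<rho>.mball x r" if x: "x \<in> X" and r: "r > 0" for x r
  proof -
    obtain n where n: "D * \<theta> ^ n < r / C" using small_scale[of "r / C"] r C_ge_1 by auto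
    obtain w where w: "w \<in> V" "lev w = n" "x \<in> K w" using covering x by blast
    have "metric_X.mball x (q ^ n) \<subseteq> metric_\<rho>.mball x r"
    proof
      fix y assume y: "y \<in> metric_X.mball x (q ^ n)"
      then have "\<rho> x y \<le> C * g w" using \<rho>_le[OF w(1,3), of y] w(2) by auto
      also have "\<dots> \<le> C * (D * \<theta> ^ n)" using g_le_level[OF w(1)] w(2) C_ge_1 by (intro mult_left_mono) auto
      also have "\<dots> < r" using n C_ge_1 by (simp add: field_simps)
      finally show "y \<in> metric_\<rho>.mball x r" using y x by auto
    qed
    then show ?thesis using q by (intro exI[of _ "q ^ n"]) auto
  qed
  have 2: "\<exists>s>0. metric_\<rho>.mball x s \<subseteq> metric_X.mball x r" if x: "x \<in> X" and r: "r > 0" for x r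
  proof -
    obtain c where c: "c > 0" "\<And>x y w. w \<in> V \<Longrightarrow> x \<in> K w \<Longrightarrow> y \<in> X \<Longrightarrow> 1 * q ^ lev w < d x y \<Longrightarrow> c * g w \<le> \<rho> x y"
      using \<rho>_ge[OF zero_less_one] by blast
    obtain n where n: "q ^ n < r" using small_scale r by blast
    obtain w where w: "w \<in> V" "lev w = n" "x \<in> K w" using covering x by blast
    have "metric_\<rho>.mball x (c * g w) \<subseteq> metric_X.mball x r"
    proof
      fix y assume y: "y \<in> metric_\<rho>.mball x (c * g w)"
      then have "\<not> 1 * q ^ lev w < d x y" using c(2)[OF w(1,3), of y] by auto
      then show "y \<in> metric_X.mball x r" using n w y by auto
    qed
    then show ?thesis using c g_pos[OF w(1)] by (intro exI[of _ "c * g w"]) auto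
  qed
  show ?thesis
    unfolding topology_eq metric_\<rho>.openin_mtopology metric_X.openin_mtopology
    using 1 2 by (meson subset_eq)
qed

text \<open>The least index whose next scale lies below \<open>s\<close>; the alternative
  \<open>n = 0\<close> covers values of \<open>s\<close> above the largest scale.\<close>

lemma scale_index:
  fixes b s :: real
  assumes b: "b > 0" and s: "0 < s"
  shows "\<exists>n. b * q ^ Suc n < s \<and> (s \<le> b * q ^ n \<or> n = 0)"
proof -
  have "0 < s / b" using s b by simp
  then obtain n where "q ^ n < s / b" using small_scale by blast
  then have "b * q ^ n < s" using b by (simp add: field_simps)
  moreover have "b * q ^ Suc n \<le> b * q ^ n" using q b by (intro mult_left_mono power_decreasing) auto
  ultimately have ex: "\<exists>n. b * q ^ Suc n < s" by (intro exI[of _ n]) linarith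
  define n where "n = (LEAST n. b * q ^ Suc n < s)"
  have "b * q ^ Suc n < s" unfolding n_def by (rule LeastI_ex[OF ex])
  moreover have "s \<le> b * q ^ n \<or> n = 0"
  proof (cases n)
    case (Suc m)
    then have "\<not> b * q ^ Suc m < s" using not_less_Least[of m "\<lambda>n. b * q ^ Suc n < s"] by (simp add: n_def)
    then show ?thesis using Suc by simp
  qed simp
  ultimately show ?thesis by blast
qed

text \<open>Both \<rho>-distances are compared with the weight on one branch through
  \<open>x\<close>, at the levels \<open>m\<close> and \<open>n\<close> fitting \<open>d x z\<close>
  and \<open>d x y\<close>. If \<open>m\<close> is deeper, decay bounds the ratio of weights by a
  power \<alpha> of \<open>t\<close>; if \<open>n\<close> is deeper, the lower bound \<epsilon> per
  generation gives a power \<beta>.\<close>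

lemma quasisymmetric:
  "\<exists>h h'. homeomorphism {0::real..} {0..} h h' \<and> h 0 = 0
     \<and> (\<forall>t>0. \<forall>x\<in>X. \<forall>y\<in>X. \<forall>z\<in>X. d x z < t * d x y \<longrightarrow> \<rho> x z < h t * \<rho> x y)"
proof -
  obtain c where c: "c > 0" "\<And>x y w. w \<in> V \<Longrightarrow> x \<in> K w \<Longrightarrow> y \<in> X \<Longrightarrow> q * q ^ lev w < d x y \<Longrightarrow> c * g w \<le> \<rho> x y"
    using \<rho>_ge[OF q(1)] by blast
  \<comment> \<open>\<open>c\<^sub>2\<close> is needed at level 0, where it is the only bound on
    \<open>d x y\<close>; dividing by \<open>q\<close> undoes the index shift in
    \<open>scale_index\<close>.\<close>
  define b where "b = max 1 c\<^sub>2 / q"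
  define \<alpha> where "\<alpha> = ln \<theta> / ln q"
  \<comment> \<open>The maximum with 1 keeps the exponent positive even when \<epsilon> = 1.\<close>
  define \<beta> where "\<beta> = max 1 (ln \<epsilon> / ln q)"
  have lnq: "ln q < 0" using q by simp
  have \<alpha>: "\<alpha> > 0" using \<theta> lnq by (simp add: \<alpha>_def divide_neg_neg)
  have \<beta>: "\<beta> > 0" by (simp add: \<beta>_def)
  have b: "b > 0" using q by (simp add: b_def)
  have \<theta>q: "\<theta> = q powr \<alpha>" using q \<theta> lnq by (simp add: \<alpha>_def powr_def)
  have \<epsilon>q: "q powr \<beta> \<le> \<epsilon>"
  proof -
    have "\<beta> * ln q \<le> ln \<epsilon> / ln q * ln q" using lnq by (intro mult_right_mono_neg) (auto simp: \<beta>_def)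
    then have "exp (\<beta> * ln q) \<le> exp (ln \<epsilon>)" using lnq by simp
    then show ?thesis using q \<epsilon>_pos by (simp add: powr_def)
  qed
  define E where "E = C / c * (D * b powr \<alpha> + b powr \<beta>)"
  have E: "E > 0" using C_ge_1 c(1) D_pos b by (auto simp: E_def intro!: mult_pos_pos add_pos_pos divide_pos_pos)
  \<comment> \<open>The factor 2 turns the estimate with \<open>E\<close> into the strict inequality
    that quasisymmetry asks for.\<close>
  define h where "h = (\<lambda>t. 2 * E * (t powr \<alpha> + t powr \<beta>))"
  have h0: "h 0 = 0" by (simp add: h_def)
  have h_pos: "h t > 0" if "t > 0" for t
    using that E by (auto simp: h_def intro!: mult_pos_pos add_pos_pos)
  have cont: "continuous_on {0..} h"
    unfolding h_def using \<alpha> \<beta> by (intro continuous_intros continuous_on_powr') auto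
  have mono: "h s < h t" if "0 \<le> s" "s < t" for s t
    unfolding h_def using that \<alpha> \<beta> E by (intro mult_strict_left_mono add_strict_mono powr_less_mono2) auto
  have surj: "h ` {0..} = {0..}"
  proof (intro equalityI subsetI)
    fix y assume "y \<in> h ` {0..}"
    then show "y \<in> {0..}" using h0 h_pos by (force simp: less_le)
  next
    fix y :: real assume y: "y \<in> {0..}"
    define T where "T = max 1 (y / (2 * E)) powr (1 / \<alpha>)"
    have T0: "0 \<le> T" by (simp add: T_def)
    have "T powr \<alpha> = max 1 (y / (2 * E))" using \<alpha> by (simp add: T_def powr_powr)
    then have "y / (2 * E) \<le> T powr \<alpha> + T powr \<beta>" by (simp add: add_increasing2)
    then have "y \<le> h T" using E by (simp add: h_def divide_le_eq mult_ac)
    moreover have "h 0 \<le> y" using y h0 by simp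
    moreover have "continuous_on {0..T} h" by (rule continuous_on_subset[OF cont]) auto
    ultimately obtain t where "0 \<le> t" "h t = y" using IVT'[of h 0 y T] T0 by blast
    then show "y \<in> h ` {0..}" by force
  qed
  have "inj_on h {0..}"
    by (rule inj_onI) (metis mono atLeast_iff less_irrefl linorder_neqE_linordered_idom)
  then obtain h' where hom: "homeomorphism {0..} {0..} h h'"
    using homeomorphism_into_1d[of "{0::real..}" h "{0..}"] cont surj
    by (auto simp: convex_imp_path_connected)
  have "\<rho> x z < h t * \<rho> x y"
    if t: "t > 0" and xyz: "x \<in> X" "y \<in> X" "z \<in> X" and dt: "d x z < t * d x y" for t x y z
  proof -
    have dxy: "0 < d x y" using dt t metric_X.nonneg[of x z] by (smt (verit) mult_nonneg_nonpos)
    then have "x \<noteq> y" using xyz by auto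
    then have \<rho>xy: "0 < \<rho> x y" using xyz metric_\<rho>.mdist_pos_less by blast
    show ?thesis
    proof (cases "x = z")
      case True
      then show ?thesis using h_pos[OF t] \<rho>xy xyz by simp
    next
      case False
      then have dxz: "0 < d x z" using xyz metric_X.mdist_pos_less by blast
      obtain n where n: "q * q ^ n < d x y" "d x y \<le> q ^ n \<or> n = 0"
        using scale_index[of 1, OF _ dxy] by auto
      obtain m where m: "q * q ^ m < d x z" "d x z \<le> q ^ m \<or> m = 0"
        using scale_index[of 1, OF _ dxz] by auto
      have "d x y \<le> max 1 c\<^sub>2 * q ^ n"
      proof (cases "n = 0")
        case True
        then show ?thesis using dist_le[OF root_in_V, of x y] K_root xyz lev_root by simp
      next
        case False
        then have "d x y \<le> 1 * q ^ n" using n by simp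
        also have "\<dots> \<le> max 1 c\<^sub>2 * q ^ n" using q by (intro mult_right_mono) auto
        finally show ?thesis .
      qed
      then have "t * d x y \<le> t * (max 1 c\<^sub>2 * q ^ n)" using t by (intro mult_left_mono) auto
      then have "q * q ^ m < t * (max 1 c\<^sub>2 * q ^ n)" using m(1) dt by linarith
      then have comp: "q ^ m < (b * t) * q ^ n" using q by (simp add: b_def field_simps)
      have "\<rho> x z \<le> E * (t powr \<alpha> + t powr \<beta>) * \<rho> x y"
      proof (cases "n \<le> m")
        case True
        then obtain j where j: "m = n + j" by (metis le_add_diff_inverse)
        obtain w where w: "w \<in> V" "lev w = m" "x \<in> K w" using covering xyz(1) by blast
        let ?v = "(P ^^ j) w"
        have v: "?v \<in> V" "lev ?v = n" "x \<in> K ?v" using ascend[of w n j] w j by auto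
        have "q ^ j < b * t" using comp q by (simp add: j power_add)
        then have "(q ^ j) powr \<alpha> \<le> (b * t) powr \<alpha>" using q \<alpha> by (intro powr_mono2) auto
        then have "\<theta> ^ j \<le> (b * t) powr \<alpha>"
          using q by (simp add: \<theta>q powr_realpow[symmetric] powr_powr mult.commute)
        then have \<theta>j: "\<theta> ^ j \<le> b powr \<alpha> * t powr \<alpha>" using b t by (simp add: powr_mult)
        have "\<rho> x z \<le> C * g w" using \<rho>_le[OF w(1,3) xyz(3)] m(2) w(2) by simp
        also have "\<dots> \<le> C * (D * \<theta> ^ j * g ?v)"
          using g_le_decay[of w n j] w j C_ge_1 by (intro mult_left_mono) auto
        also have "\<dots> \<le> C * (D * (b powr \<alpha> * t powr \<alpha>) * g ?v)"
          using \<theta>j D_pos C_ge_1 g_pos[OF v(1)] by (intro mult_left_mono mult_right_mono) auto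
        also have "\<dots> = C / c * (D * b powr \<alpha>) * t powr \<alpha> * (c * g ?v)" using c(1) by simp
        also have "\<dots> \<le> C / c * (D * b powr \<alpha>) * t powr \<alpha> * \<rho> x y"
          using c(2)[OF v(1,3) xyz(2)] v n C_ge_1 c(1) D_pos by (intro mult_left_mono) auto
        also have "\<dots> \<le> E * (t powr \<alpha> + t powr \<beta>) * \<rho> x y"
          using \<rho>xy C_ge_1 c(1) D_pos unfolding E_def by (intro mult_right_mono mult_mono mult_left_mono) auto
        finally show ?thesis .
      next
        case False
        then obtain j where j: "n = m + j" by (metis le_add_diff_inverse nat_le_linear)
        obtain w where w: "w \<in> V" "lev w = n" "x \<in> K w" using covering xyz(1) by blast
        let ?v = "(P ^^ j) w"
        have v: "?v \<in> V" "lev ?v = m" "x \<in> K ?v" using ascend[of w m j] w j by auto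
        have "1 < (b * t) * q ^ j" using comp q by (simp add: j power_add)
        then have "1 powr \<beta> \<le> ((b * t) * q ^ j) powr \<beta>" using \<beta> by (intro powr_mono2) auto
        also have "\<dots> = (b powr \<beta> * t powr \<beta>) * (q powr \<beta>) ^ j"
          using b t q by (simp add: powr_mult powr_realpow[symmetric] powr_powr mult.commute)
        also have "\<dots> \<le> (b powr \<beta> * t powr \<beta>) * \<epsilon> ^ j"
          using \<epsilon>q by (intro mult_left_mono power_mono) auto
        finally have \<epsilon>j: "1 \<le> (b powr \<beta> * t powr \<beta>) * \<epsilon> ^ j" by simp
        have "\<rho> x z \<le> C * (1 * g ?v)" using \<rho>_le[OF v(1,3) xyz(3)] m(2) v(2) by simp
        also have "\<dots> \<le> C * (((b powr \<beta> * t powr \<beta>) * \<epsilon> ^ j) * g ?v)"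
          using \<epsilon>j C_ge_1 g_pos[OF v(1)] by (intro mult_left_mono mult_right_mono) auto
        also have "\<dots> = C * (b powr \<beta> * t powr \<beta>) * (\<epsilon> ^ j * g ?v)" by simp
        also have "\<dots> \<le> C * (b powr \<beta> * t powr \<beta>) * g w"
          using g_ge_ancestor[of w m j] w j C_ge_1 by (intro mult_left_mono) auto
        also have "\<dots> = C / c * b powr \<beta> * t powr \<beta> * (c * g w)" using c(1) by simp
        also have "\<dots> \<le> C / c * b powr \<beta> * t powr \<beta> * \<rho> x y"
          using c(2)[OF w(1,3) xyz(2)] w n C_ge_1 c(1) by (intro mult_left_mono) auto
        also have "\<dots> \<le> E * (t powr \<alpha> + t powr \<beta>) * \<rho> x y"
          using \<rho>xy C_ge_1 c(1) D_pos unfolding E_def by (intro mult_right_mono mult_mono mult_left_mono) auto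
        finally show ?thesis .
      qed
      also have "\<dots> < h t * \<rho> x y"
        using \<rho>xy E t by (intro mult_strict_right_mono) (auto simp: h_def intro!: add_pos_pos)
      finally show ?thesis .
    qed
  qed
  then show ?thesis using hom h0 by blast
qed

text \<open>The level is chosen from \<open>d x y\<close>: \<open>near_chain\<close> supplies the
  \<open>M\<close> steps there, and \<open>\<rho>_ge\<close> bounds the weight on that level by the
  \<rho>-distance. This is the geometric content of adaptedness.\<close>

lemma fine_path:
  "\<exists>E>0. \<forall>x\<in>X. \<forall>y\<in>X. \<forall>r. \<rho> x y < r \<longrightarrow>
     (\<exists>u v. u \<in> V \<and> (u, v) \<in> R ^^ M \<and> x \<in> K u \<and> y \<in> K v \<and> g u \<le> E * r)"
proof -
  \<comment> \<open>Half of \<open>a\<close> leaves room for the strict inequality in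
    \<open>near_chain\<close>; the factor \<open>q\<close> is the shift by one level in
    \<open>scale_index\<close>.\<close>
  obtain c where c: "c > 0" "\<And>x y w. w \<in> V \<Longrightarrow> x \<in> K w \<Longrightarrow> y \<in> X
      \<Longrightarrow> (a / 2 * q) * q ^ lev w < d x y \<Longrightarrow> c * g w \<le> \<rho> x y"
    using \<rho>_ge[of "a / 2 * q"] a_pos q by auto
  have "\<exists>u v. u \<in> V \<and> (u, v) \<in> R ^^ M \<and> x \<in> K u \<and> y \<in> K v \<and> g u \<le> (1 / c) * r"
    if xy: "x \<in> X" "y \<in> X" and r: "\<rho> x y < r" for x y r
  proof (cases "x = y")
    case True
    \<comment> \<open>The distance determines no level here, so any sufficiently deep cell is
      taken.\<close>
    have "0 < r" using r metric_\<rho>.nonneg[of x y] by linarith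
    then have "0 < (1 / c) * r" using c(1) by simp
    then obtain n where n: "D * \<theta> ^ n < (1 / c) * r" using small_scale by blast
    obtain w where w: "w \<in> V" "lev w = n" "x \<in> K w" using covering xy by blast
    then show ?thesis
      using g_le_level[OF w(1)] n True relpow_R_refl[OF w(1)] by (intro exI[of _ w]) auto
  next
    case False
    then have "0 < d x y" using xy metric_X.mdist_pos_less by blast
    then obtain n where n: "(a / 2) * q ^ Suc n < d x y" "d x y \<le> (a / 2) * q ^ n \<or> n = 0"
      using scale_index[of "a / 2" "d x y"] a_pos by auto
    have bound: "g u \<le> (1 / c) * r" if u: "u \<in> V" "lev u = n" "x \<in> K u" for u
    proof -
      have "c * g u \<le> \<rho> x y" using c(2)[OF u(1,3) xy(2)] n(1) u(2) by (simp add: mult.assoc)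
      then have "c * g u \<le> r" using r by simp
      then show ?thesis using c(1) by (simp add: field_simps)
    qed
    show ?thesis
    proof (cases "n = 0")
      case True
      then show ?thesis
        using bound[OF root_in_V] relpow_R_refl[OF root_in_V] root_in_V K_root lev_root xy
        by (intro exI[of _ root]) auto
    next
      case False
      then have "d x y \<le> (a / 2) * q ^ n" using n by simp
      also have "\<dots> < a * q ^ n" using a_pos q by simp
      finally obtain u v where "(u, v) \<in> R ^^ M" "u \<in> V" "lev u = n" "x \<in> K u" "y \<in> K v"
        using near_chain xy by blast
      then show ?thesis using bound by blast
    qed
  qed
  then show ?thesis using c(1) by (intro exI[of _ "1 / c"]) auto
qed

section \<open>The measure of balls\<close>

lemma ball_in_sets: "metric_\<rho>.mball x r \<in> sets mu"
  unfolding sets_mu by (rule sigma_sets.Basic) (use metric_\<rho>.openin_mball mtopology_eq in auto)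

text \<open>A stopping argument: the level is minimal, so the parent, whose cell also contains
  \<open>x\<close>, is not yet small. Only the root escapes this, namely when \<open>s\<close>
  exceeds 1.\<close>

lemma first_small_vertex:
  assumes x: "x \<in> X" and s: "0 < s"
  shows "\<exists>w\<in>V. x \<in> K w \<and> g w < s \<and> (w = root \<or> (\<exists>n. lev w = Suc n \<and> s \<le> g (P w)))"
proof -
  define Q where "Q = (\<lambda>n. \<exists>w\<in>V. lev w = n \<and> x \<in> K w \<and> g w < s)"
  have "\<exists>n. Q n"
  proof -
    obtain n where n: "D * \<theta> ^ n < s" using small_scale s by blast
    obtain w where w: "w \<in> V" "lev w = n" "x \<in> K w" using covering x by blast
    then show ?thesis using g_le_level[OF w(1)] n unfolding Q_def by force
  qed
  then have "Q (LEAST n. Q n)" by (rule LeastI_ex)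
  then obtain w where w: "w \<in> V" "lev w = (LEAST n. Q n)" "x \<in> K w" "g w < s" unfolding Q_def by blast
  have "w = root \<or> (\<exists>n. lev w = Suc n \<and> s \<le> g (P w))"
  proof (cases "lev w")
    case 0 then show ?thesis using lev_0D w by blast
  next
    case (Suc n)
    then have "\<not> Q n" using not_less_Least[of n Q] w(2) by simp
    then have "s \<le> g (P w)"
      using P_in_V[OF w(1) Suc] lev_P[OF w(1) Suc] K_subset_P[OF w(1) Suc] w(3) unfolding Q_def by force
    then show ?thesis using Suc by blast
  qed
  then show ?thesis using w by blast
qed

text \<open>Stopping below \<open>s / C\<close> puts the whole cell of \<open>w\<close> into the
  ball, while the parent keeps the weight of \<open>w\<close> comparable to
  \<open>s\<close>.\<close>

lemma ball_lower:
  assumes "x \<in> X" "0 < s" "s \<le> 1"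
  shows "(\<epsilon> / C) powr p * s powr p \<le> measure mu (metric_\<rho>.mball x s)"
proof -
  obtain w where w: "w \<in> V" "x \<in> K w" "g w < s / C" "w = root \<or> (\<exists>n. lev w = Suc n \<and> s / C \<le> g (P w))"
    using first_small_vertex[OF assms(1), of "s / C"] assms C_ge_1 by auto
  have "\<epsilon> / C * s \<le> g w"
    using w(4)
  proof
    assume "w = root"
    moreover have "\<epsilon> / C * s \<le> 1 * 1"
      using assms C_ge_1 \<epsilon>_pos \<epsilon>_le_1 by (intro mult_mono) auto
    ultimately show ?thesis using g_root by simp
  next
    assume "\<exists>n. lev w = Suc n \<and> s / C \<le> g (P w)"
    then obtain n where n: "lev w = Suc n" "s / C \<le> g (P w)" by blast
    have "\<epsilon> * (s / C) \<le> \<epsilon> * g (P w)" using n \<epsilon>_pos by (intro mult_left_mono) auto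
    then show ?thesis using g_ge[OF w(1) n(1)] by simp
  qed
  then have "(\<epsilon> / C * s) powr p \<le> g w powr p"
    using \<epsilon>_pos C_ge_1 assms p_pos by (intro powr_mono2) auto
  moreover have "(\<epsilon> / C * s) powr p = (\<epsilon> / C) powr p * s powr p"
    using \<epsilon>_pos C_ge_1 assms by (subst powr_mult) auto
  ultimately have "(\<epsilon> / C) powr p * s powr p \<le> g w powr p" by (simp only:)
  also have "\<dots> \<le> measure mu (K w)" by (rule measure_K_ge[OF w(1)])
  also have "\<dots> \<le> measure mu (metric_\<rho>.mball x s)"
  proof (rule mu.finite_measure_mono[OF _ ball_in_sets])
    have "C * g w < s" using w(3) C_ge_1 by (simp add: field_simps)
    then show "K w \<subseteq> metric_\<rho>.mball x s"
      using \<rho>_le_K[OF w(1,2)] K_subset_X[OF w(1)] assms(1) by (fastforce intro: order_le_less_trans)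
  qed
  finally show ?thesis .
qed

text \<open>A ball of radius \<open>c * g w\<close> about a point of \<open>K w\<close> is covered
  by the cells within \<open>M + 1\<close> of \<open>w\<close>, boundedly many and of comparable
  mass. It is applied to the parent of the first small vertex, whose ball contains the given
  one.\<close>

lemma ball_upper:
  "\<exists>E>0. \<forall>x\<in>X. \<forall>s>0. measure mu (metric_\<rho>.mball x s) \<le> E * s powr p"
proof -
  obtain c where c: "c > 0" "\<And>x y w. w \<in> V \<Longrightarrow> x \<in> K w \<Longrightarrow> y \<in> X
      \<Longrightarrow> (a / 2) * q ^ lev w < d x y \<Longrightarrow> c * g w \<le> \<rho> x y"
    using \<rho>_ge[of "a / 2"] a_pos by auto
  define F where "F = real L ^ (M + 1) * (real L * B powr p * (B ^ (M + 1)) powr p)"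
  \<comment> \<open>The 1 in the maximum serves the root case, where total mass 1 is the bound;
    dividing by \<open>\<epsilon> powr p\<close> pays for passing to the parent.\<close>
  define E where "E = max 1 (F / \<epsilon> powr p) * (1 / c) powr p"
  have E: "E > 0" using c(1) by (simp add: E_def)
  have Ball_le: "measure mu (metric_\<rho>.mball x (c * g w)) \<le> F * g w powr p"
    if w: "w \<in> V" "x \<in> K w" for x w
  proof -
    let ?N = "(R ^^ (M + 1)) `` {w}"
    have x: "x \<in> X" using w K_subset_X by blast
    have NV: "v \<in> V" if "v \<in> ?N" for v using relpow_R_invariants[of w v "M + 1"] w that by blast
    have "metric_\<rho>.mball x (c * g w) \<subseteq> (\<Union>v\<in>?N. K v)"
    proof
      fix y assume y: "y \<in> metric_\<rho>.mball x (c * g w)"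
      then have "\<not> (a / 2) * q ^ lev w < d x y" using c(2)[OF w] by fastforce
      then have "d x y \<le> (a / 2) * q ^ lev w" by simp
      also have "\<dots> < a * q ^ lev w" using a_pos q by simp
      finally obtain u v where uv: "(u, v) \<in> R ^^ M" "u \<in> V" "lev u = lev w" "x \<in> K u" "y \<in> K v"
        using near_chain[OF x, of y] y metric_\<rho>.in_mball by blast
      have "(w, u) \<in> R" using uv w by (auto simp: R_def)
      then have "(w, v) \<in> R ^^ (M + 1)" using relpow_R_trans[of w u 1, OF _ uv(1)] by (simp add: add.commute)
      then show "y \<in> (\<Union>v\<in>?N. K v)" using uv(5) by blast
    qed
    moreover have fin: "finite ?N" by (rule finite_nb[OF w(1)])
    ultimately have "measure mu (metric_\<rho>.mball x (c * g w)) \<le> measure mu (\<Union>v\<in>?N. K v)"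
      using K_in_sets NV by (intro mu.finite_measure_mono sets.finite_UN) auto
    also have "\<dots> \<le> (\<Sum>v\<in>?N. measure mu (K v))"
      using fin K_in_sets NV by (intro measure_UNION_le) auto
    also have "\<dots> \<le> (\<Sum>v\<in>?N. real L * B powr p * ((B ^ (M + 1)) powr p * g w powr p))"
    proof (rule sum_mono)
      fix v assume v: "v \<in> ?N"
      have "g v \<le> B ^ (M + 1) * g w" using g_bal_relpow[OF relpow_R_sym] v by blast
      then have "g v powr p \<le> (B ^ (M + 1) * g w) powr p"
        using g_pos[OF NV[OF v]] p_pos by (intro powr_mono2) auto
      also have "\<dots> = (B ^ (M + 1)) powr p * g w powr p"
        using B_ge_1 g_pos[OF w(1)] by (simp add: powr_mult)
      finally have "real L * B powr p * g v powr p \<le> real L * B powr p * ((B ^ (M + 1)) powr p * g w powr p)"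
        by (intro mult_left_mono) auto
      then show "measure mu (K v) \<le> real L * B powr p * ((B ^ (M + 1)) powr p * g w powr p)"
        using measure_K_le[OF NV[OF v]] by linarith
    qed
    also have "\<dots> = real (card ?N) * (real L * B powr p * ((B ^ (M + 1)) powr p * g w powr p))" by simp
    also have "\<dots> \<le> real (L ^ (M + 1)) * (real L * B powr p * ((B ^ (M + 1)) powr p * g w powr p))"
      by (intro mult_right_mono of_nat_mono card_nb[OF w(1)]) auto
    finally show ?thesis by (simp add: F_def mult_ac)
  qed
  have "measure mu (metric_\<rho>.mball x s) \<le> E * s powr p" if x: "x \<in> X" and s: "s > 0" for x s
  proof -
    obtain w where w: "w \<in> V" "x \<in> K w" "g w < s / c" "w = root \<or> (\<exists>n. lev w = Suc n \<and> s / c \<le> g (P w))"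
      using first_small_vertex[OF x, of "s / c"] s c(1) by auto
    have E_le: "t * (s / c) powr p \<le> E * s powr p" if "t \<le> max 1 (F / \<epsilon> powr p)" for t
    proof -
      have "(s / c) powr p = (1 / c) powr p * s powr p"
        using powr_mult[of "1 / c" s p] s c(1) by simp
      then show ?thesis using that by (simp add: E_def mult_right_mono mult.assoc[symmetric])
    qed
    from w(4) show ?thesis
    proof
      assume "w = root"
      then have "1 < s / c" using w g_root by simp
      then have "1 \<le> (s / c) powr p" using p_pos by (intro ge_one_powr_ge_zero) auto
      moreover have "(s / c) powr p \<le> E * s powr p" using E_le[of 1] by simp
      ultimately show ?thesis using mu.prob_le_1[of "metric_\<rho>.mball x s"] by linarith
    next
      assume "\<exists>n. lev w = Suc n \<and> s / c \<le> g (P w)"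
      then obtain n where n: "lev w = Suc n" "s / c \<le> g (P w)" by blast
      have Pw: "P w \<in> V" "x \<in> K (P w)" using P_in_V[OF w(1) n(1)] K_subset_P[OF w(1) n(1)] w(2) by auto
      have "s \<le> c * g (P w)" using n(2) c(1) by (simp add: field_simps)
      then have "measure mu (metric_\<rho>.mball x s) \<le> measure mu (metric_\<rho>.mball x (c * g (P w)))"
        by (intro mu.finite_measure_mono ball_in_sets metric_\<rho>.mball_subset_concentric)
      also have "\<dots> \<le> F * g (P w) powr p" by (rule Ball_le[OF Pw])
      also have "g (P w) powr p \<le> (s / c / \<epsilon>) powr p"
      proof -
        have "\<epsilon> * g (P w) \<le> s / c" using g_ge[OF w(1) n(1)] w(3) by linarith
        then have "g (P w) \<le> s / c / \<epsilon>"
          by (subst pos_le_divide_eq[OF \<epsilon>_pos]) (simp only: mult.commute)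
        then show ?thesis using g_pos[OF Pw(1)] p_pos by (intro powr_mono2) auto
      qed
      then have "F * g (P w) powr p \<le> F * (s / c / \<epsilon>) powr p"
        by (intro mult_left_mono) (auto simp: F_def)
      also have "\<dots> = (F / \<epsilon> powr p) * (s / c) powr p"
        using s c(1) \<epsilon>_pos by (subst powr_divide) auto
      also have "\<dots> \<le> E * s powr p" by (rule E_le) simp
      finally show ?thesis .
    qed
  qed
  then show ?thesis using E by blast
qed

lemma ahlfors:
  "\<exists>C\<^sub>1>0. \<exists>C\<^sub>2>0. \<forall>x\<in>X. \<forall>r\<in>{0..diam \<rho> X}.
      C\<^sub>1 * r powr p \<le> measure mu (metric_\<rho>.mball x r) \<and> measure mu (metric_\<rho>.mball x r) \<le> C\<^sub>2 * r powr p"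
proof -
  obtain E where E: "E > 0" "\<And>x s. x \<in> X \<Longrightarrow> s > 0 \<Longrightarrow> measure mu (metric_\<rho>.mball x s) \<le> E * s powr p"
    using ball_upper by blast
  have "(\<epsilon> / C) powr p * r powr p \<le> measure mu (metric_\<rho>.mball x r)
      \<and> measure mu (metric_\<rho>.mball x r) \<le> E * r powr p"
    if "x \<in> X" "r \<in> {0..diam \<rho> X}" for x r
  proof (cases "r = 0")
    case True
    then have "metric_\<rho>.mball x r = {}" using metric_\<rho>.mball_eq_empty by blast
    then show ?thesis using True by simp
  next
    case False
    then show ?thesis using that ball_lower[of x r] E(2)[of x r] diam_\<rho> by auto
  qed
  moreover have "(\<epsilon> / C) powr p > 0" using \<epsilon>_pos C_ge_1 by simp
  ultimately show ?thesis using E(1) by blast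
qed

end

section \<open>Comparable weights on the full tree\<close>

context reference_tree
begin

text \<open>The nearest ancestor in \<open>level_multiples G k\<close>, possibly the vertex
  itself.\<close>

definition truncate :: "nat \<Rightarrow> 't \<Rightarrow> 't" where
  "truncate k w = (parent G ^^ (level G w mod k)) w"

lemma truncate_in_verts: "w \<in> verts G \<Longrightarrow> truncate k w \<in> verts G"
  by (simp add: truncate_def ancestor_in_verts)

lemma level_truncate: "w \<in> verts G \<Longrightarrow> level G (truncate k w) = k * (level G w div k)"
  by (simp add: truncate_def level_ancestor minus_mod_eq_mult_div)

lemma level_multiples_iff: "v \<in> level_multiples G k \<longleftrightarrow> v \<in> verts G \<and> k dvd level G v"
  by (auto simp: level_multiples_def level_set_def dvd_def mult.commute)

lemma truncate_in_level_multiples: "w \<in> verts G \<Longrightarrow> truncate k w \<in> level_multiples G k"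
  by (simp add: level_multiples_iff truncate_in_verts level_truncate)

text \<open>Both vertices are ancestors of \<open>v\<close>, and counting shows that they are the
  same number of steps above it.\<close>

lemma ancestor_truncate:
  assumes k: "k \<ge> 1" and v: "v \<in> verts G" "level G v = level G w + i" "(parent G ^^ i) v = w"
  shows "(parent G ^^ (k * (level G v div k - level G w div k))) (truncate k v) = truncate k w"
proof -
  have "level G w div k \<le> level G v div k" using v(2) by (simp add: div_le_mono)
  then have "k * (level G v div k - level G w div k) + level G v mod k = level G v - k * (level G w div k)"
    by (simp add: diff_mult_distrib2 le_imp_diff_is_add)
  also have "\<dots> = i + level G w mod k"
    using v(2) minus_mult_div_eq_mod[of "level G w" k] by (metis Nat.add_diff_assoc add.commute times_div_less_eq_dividend)
  finally have "k * (level G v div k - level G w div k) + level G v mod k = level G w mod k + i" by simp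
  then have "(parent G ^^ (k * (level G v div k - level G w div k))) ((parent G ^^ (level G v mod k)) v)
    = (parent G ^^ (level G w mod k)) ((parent G ^^ i) v)"
    by (metis funpow_add o_apply)
  then show ?thesis using v(3) by (simp add: truncate_def)
qed

text \<open>The comparison of \<open>gr\<close> with \<open>g\<close> loses the ratio
  \<open>C / A\<close>. Waiting \<open>j\<^sub>0\<close> further generations of the sparse tree
  absorbs this loss together with \<open>D\<close>, which yields a contraction.\<close>

lemma exponential_weight_of_comparable:
  fixes gr g :: "'t \<Rightarrow> real"
  assumes k: "k \<ge> 1"
    and gr_base: "gr (base G) = 1" and gr_mono: "\<And>w. w \<in> verts G \<Longrightarrow> gr w \<le> gr (parent G w)"
    and gr_le_1: "\<And>w. w \<in> verts G \<Longrightarrow> gr w \<le> 1"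
    and level_nonempty: "\<And>m. level_set G m \<noteq> {}"
    and A: "0 < A" "\<And>w. w \<in> verts G \<Longrightarrow> A * g (truncate k w) \<le> gr w"
    and C: "0 < C" "\<And>w. w \<in> verts G \<Longrightarrow> gr w \<le> C * g (truncate k w)"
    and g_pos: "\<And>v. v \<in> level_multiples G k \<Longrightarrow> 0 < g v" and g_base: "g (base G) = 1"
    and D: "0 < D" "0 < \<theta>" "\<theta> < 1"
      "\<And>v n j. v \<in> level_multiples G k \<Longrightarrow> level G v = k * (n + j) \<Longrightarrow> g v \<le> D * \<theta> ^ j * g ((parent G ^^ (k * j)) v)"
    and \<epsilon>: "0 < \<epsilon>" "\<epsilon> \<le> 1"
      "\<And>v n. v \<in> level_multiples G k \<Longrightarrow> level G v = k * Suc n \<Longrightarrow> \<epsilon> * g ((parent G ^^ k) v) \<le> g v"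
  shows "exponential_weight G gr"
proof -
  have gt_pos: "0 < g (truncate k w)" if "w \<in> verts G" for w
    by (rule g_pos[OF truncate_in_level_multiples[OF that]])
  have gr_pos: "0 < gr w" if "w \<in> verts G" for w
    using A(2)[OF that] mult_pos_pos[OF A(1) gt_pos[OF that]] by linarith
  have upper: "gr w \<le> C * (D * \<theta> ^ (m div k))" if w: "w \<in> level_set G m" for w m
  proof -
    have w': "w \<in> verts G" "level G w = m" using w by (auto simp: level_set_def)
    have l: "level G (truncate k w) = k * (0 + m div k)" using level_truncate[OF w'(1)] w' by simp
    have "(parent G ^^ (k * (m div k))) (truncate k w) = base G"
      using ancestor_eq_base[OF truncate_in_verts[OF w'(1)]] l by simp
    then have "g (truncate k w) \<le> D * \<theta> ^ (m div k)"
      using D(4)[OF truncate_in_level_multiples[OF w'(1)] l] g_base by simp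
    then have "C * g (truncate k w) \<le> C * (D * \<theta> ^ (m div k))" using C(1) by (intro mult_left_mono) auto
    then show ?thesis using C(2)[OF w'(1)] by linarith
  qed
  have "(\<lambda>m. SUP w\<in>level_set G m. gr w) \<longlonglongrightarrow> 0"
  proof (rule tendsto_sandwich[OF _ _ tendsto_const])
    have "filterlim (\<lambda>m. m div k) at_top sequentially"
      using k by (intro filterlim_at_top_div_const_nat) auto
    moreover have "(\<lambda>n. C * (D * \<theta> ^ n)) \<longlonglongrightarrow> C * (D * 0)"
      using D by (intro tendsto_intros LIMSEQ_realpow_zero) auto
    ultimately show "(\<lambda>m. C * (D * \<theta> ^ (m div k))) \<longlonglongrightarrow> 0"
      using filterlim_compose by fastforce
    show "\<forall>\<^sub>F m in sequentially. (SUP w\<in>level_set G m. gr w) \<le> C * (D * \<theta> ^ (m div k))"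
      using level_nonempty upper by (intro always_eventually allI cSUP_least) auto
    show "\<forall>\<^sub>F m in sequentially. 0 \<le> (SUP w\<in>level_set G m. gr w)"
    proof (intro always_eventually allI)
      fix m
      obtain w where w: "w \<in> level_set G m" using level_nonempty by blast
      have "0 \<le> gr w" using gr_pos w by (auto simp: level_set_def less_imp_le)
      also have "gr w \<le> (SUP w\<in>level_set G m. gr w)"
        using w gr_le_1 by (intro cSUP_upper bdd_aboveI[of _ 1]) (auto simp: level_set_def)
      finally show "0 \<le> (SUP w\<in>level_set G m. gr w)" .
    qed
  qed
  then have wf: "weight_function G gr"
    using gr_pos gr_le_1 gr_base gr_mono by (simp add: weight_function_def)
  have "(\<lambda>n. C * D / A * \<theta> ^ n) \<longlonglongrightarrow> C * D / A * 0"
    using D by (intro tendsto_intros LIMSEQ_realpow_zero) auto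
  then have "\<forall>\<^sub>F n in sequentially. C * D / A * \<theta> ^ n < 1" by (simp add: order_tendstoD(2))
  then obtain j\<^sub>0 where j\<^sub>0: "C * D / A * \<theta> ^ j\<^sub>0 < 1" unfolding eventually_sequentially by blast
  have decay: "gr v \<le> (C * D / A * \<theta> ^ j\<^sub>0) * gr w"
    if w: "w \<in> verts G" and v: "v \<in> subtree G w" "level G w + (j\<^sub>0 + 1) * k \<le> level G v" for v w
  proof -
    obtain i where i: "v \<in> verts G" "level G v = level G w + i" "(parent G ^^ i) v = w"
      using v(1) unfolding subtree_eq[OF w] by blast
    define j where "j = level G v div k - level G w div k"
    have "level G w div k + (j\<^sub>0 + 1) \<le> level G v div k"
      using div_le_mono[OF v(2), of k] div_mult_self1[of k "level G w" "j\<^sub>0 + 1"] k by simp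
    then have j: "j\<^sub>0 \<le> j" "level G v div k = level G w div k + j" by (auto simp: j_def)
    have "level G (truncate k v) = k * (level G w div k + j)"
      using level_truncate[OF i(1)] j(2) by (simp only:)
    moreover have "(parent G ^^ (k * j)) (truncate k v) = truncate k w"
      using ancestor_truncate[OF k i] by (simp only: j_def)
    ultimately have "g (truncate k v) \<le> D * \<theta> ^ j * g (truncate k w)"
      using D(4)[OF truncate_in_level_multiples[OF i(1)], of "level G w div k" j] by (simp only:)
    also have "\<dots> \<le> D * \<theta> ^ j\<^sub>0 * g (truncate k w)"
      using D j gt_pos[OF w] by (intro mult_right_mono mult_left_mono power_decreasing) auto
    finally have "C * g (truncate k v) \<le> C * (D * \<theta> ^ j\<^sub>0 * g (truncate k w))"
      using C(1) by (intro mult_left_mono) auto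
    also have "\<dots> = (C * D / A * \<theta> ^ j\<^sub>0) * (A * g (truncate k w))" using A(1) by simp
    also have "\<dots> \<le> (C * D / A * \<theta> ^ j\<^sub>0) * gr w"
      using A C(1) D w by (intro mult_left_mono) auto
    finally show ?thesis using C(2)[OF i(1)] by linarith
  qed
  have c\<^sub>2: "min (1 / 2) (A * \<epsilon> / C) * gr w \<le> gr v" if w: "w \<in> verts G" and v: "v \<in> children G w" for v w
  proof -
    have v': "v \<in> verts G" "v \<noteq> base G" "parent G v = w" using v children_eq[OF w] by auto
    have lv: "level G v = level G w + 1" using level_parent[OF v'(1,2)] v'(3) by simp
    have anc: "(parent G ^^ (k * (level G v div k - level G w div k))) (truncate k v) = truncate k w"
      using ancestor_truncate[OF k v'(1) lv] v'(3) by simp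
    \<comment> \<open>A child either stays in the same block of \<open>k\<close> levels, and the
      truncation is unchanged, or opens the next block, one generation further in the sparse
      tree.\<close>
    have "\<epsilon> * g (truncate k w) \<le> g (truncate k v)"
    proof (cases "level G v div k = level G w div k")
      case True
      then have "truncate k v = truncate k w" using anc by simp
      then show ?thesis using \<epsilon> gt_pos[OF w] mult_right_mono[of \<epsilon> 1 "g (truncate k w)"] by simp
    next
      case False
      then have *: "level G v div k = Suc (level G w div k)"
        using k lv by (simp add: div_Suc split: if_splits)
      then have "level G (truncate k v) = k * Suc (level G w div k)"
        using level_truncate[OF v'(1), of k] by simp
      from \<epsilon>(3)[OF truncate_in_level_multiples[OF v'(1)] this] show ?thesis
        using anc * by simp
    qed
    then have "A * (\<epsilon> * g (truncate k w)) \<le> A * g (truncate k v)" using A(1) by (intro mult_left_mono) auto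
    then have "A * \<epsilon> / C * (C * g (truncate k w)) \<le> gr v" using A(2)[OF v'(1)] C(1) by (simp add: mult.assoc)
    moreover have "A * \<epsilon> / C * gr w \<le> A * \<epsilon> / C * (C * g (truncate k w))"
      using A(1) \<epsilon>(1) C w by (intro mult_left_mono) auto
    moreover have "min (1 / 2) (A * \<epsilon> / C) * gr w \<le> A * \<epsilon> / C * gr w"
      using gr_pos[OF w] by (intro mult_right_mono) auto
    ultimately show ?thesis by linarith
  qed
  have "0 < C * D / A * \<theta> ^ j\<^sub>0" "0 < min (1 / 2) (A * \<epsilon> / C)" "min (1 / 2) (A * \<epsilon> / C) < 1"
    using A(1) C(1) D \<epsilon>(1) by auto
  then show ?thesis
    unfolding exponential_weight_def using wf j\<^sub>0 decay c\<^sub>2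
    by (intro conjI exI[of _ "(j\<^sub>0 + 1) * k"] exI[of _ "C * D / A * \<theta> ^ j\<^sub>0"] exI[of _ "min (1 / 2) (A * \<epsilon> / C)"] ballI impI) auto
qed

text \<open>Climb until the value at the parent exceeds \<open>s\<close>; this happens before the
  root is passed, since its value is 1.\<close>

lemma ancestor_in_scale:
  assumes "w \<in> verts G" "gr w \<le> s" "s < 1" "gr (base G) = 1"
  shows "\<exists>j. (parent G ^^ j) w \<in> scale G gr s"
  using assms(1,2)
proof (induction "level G w" arbitrary: w)
  case 0
  then show ?case using level_eq_0_iff assms(3,4) by simp
next
  case (Suc n)
  show ?case
  proof (cases "s < gr (parent G w)")
    case True
    then show ?thesis using Suc.prems assms(3) by (intro exI[of _ 0]) (simp add: scale_def)
  next
    case False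
    have "w \<noteq> base G" using Suc.hyps(2) level_base by auto
    then have "level G (parent G w) = n" using level_parent[OF Suc.prems(1)] Suc.hyps(2) by simp
    then obtain j where "(parent G ^^ j) (parent G w) \<in> scale G gr s"
      using Suc.hyps(1)[of "parent G w"] False parent_in_verts[OF Suc.prems(1)] by auto
    then show ?thesis by (intro exI[of _ "Suc j"]) (simp add: funpow_swap1)
  qed
qed

end

context partitioned_tree
begin

section \<open>Horizontal neighbourhoods and chains of cells\<close>

lemma horizontal_nbhd_iff:
  assumes "w \<in> verts G"
  shows "u \<in> horizontal_nbhd G K i w \<longleftrightarrow>
    (w, u) \<in> {(u, v). u \<in> level_set G (level G w) \<and> v \<in> level_set G (level G w) \<and> K u \<inter> K v \<noteq> {}} ^^ i"
    (is "_ \<longleftrightarrow> _ \<in> ?R ^^ i")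
proof
  assume "u \<in> horizontal_nbhd G K i w"
  then obtain ws where ws: "length ws = i + 1" "set ws \<subseteq> level_set G (level G w)" "hd ws = w" "last ws = u"
    "\<forall>j<i. K (ws ! j) \<inter> K (ws ! Suc j) \<noteq> {}"
    unfolding horizontal_nbhd_def by blast
  have ne: "ws \<noteq> []" using ws by auto
  have mem: "ws ! j \<in> level_set G (level G w)" if "j \<le> i" for j
    using ws(1,2) nth_mem[of j ws] that by auto
  show "(w, u) \<in> ?R ^^ i"
    unfolding relpow_fun_conv
  proof (intro exI[of _ "(!) ws"] conjI allI impI)
    show "ws ! 0 = w" using ws(3) ne by (simp add: hd_conv_nth)
    show "ws ! i = u" using ws(1,4) ne by (simp add: last_conv_nth)
    show "(ws ! j, ws ! Suc j) \<in> ?R" if "j < i" for j using mem[of j] mem[of "Suc j"] ws(5) that by simp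
  qed
next
  assume "(w, u) \<in> ?R ^^ i"
  then obtain f where f: "f 0 = w" "f i = u" "\<And>j. j < i \<Longrightarrow> (f j, f (Suc j)) \<in> ?R"
    unfolding relpow_fun_conv by blast
  have mem: "f j \<in> level_set G (level G w)" if "j \<le> i" for j
  proof (cases j)
    case 0 then show ?thesis using f(1) assms by (simp add: level_set_def)
  next
    case (Suc j') then show ?thesis using f(3)[of j'] that by simp
  qed
  let ?ws = "map f [0..<Suc i]"
  show "u \<in> horizontal_nbhd G K i w"
    unfolding horizontal_nbhd_def
  proof (intro CollectI exI[of _ ?ws] conjI allI impI)
    show "set ?ws \<subseteq> level_set G (level G w)" using mem by auto
    show "hd ?ws = w" using f(1) by (simp add: hd_map del: upt_Suc)
    show "last ?ws = u" using f(2) by simp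
    show "K (?ws ! j) \<inter> K (?ws ! Suc j) \<noteq> {}" if "j < i" for j
      using f(3)[OF that] that by (simp del: upt_Suc)
  qed simp
qed

lemma dist_le_of_cover:
  assumes "Metric_space (topspace X) \<rho>" "ws \<noteq> []" "\<And>w. w \<in> set ws \<Longrightarrow> w \<in> verts G"
    and "\<And>w x y. w \<in> set ws \<Longrightarrow> x \<in> K w \<Longrightarrow> y \<in> K w \<Longrightarrow> \<rho> x y \<le> s"
    and "successively (\<lambda>u v. K u \<inter> K v \<noteq> {}) ws" "x \<in> K (hd ws)" "y \<in> K (last ws)"
  shows "\<rho> x y \<le> real (length ws) * s"
  using assms(2-)
proof (induction ws arbitrary: x)
  case (Cons w ws)
  interpret Metric_space "topspace X" \<rho> by (rule assms(1))
  show ?case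
  proof (cases "ws = []")
    case True
    then show ?thesis using Cons.prems by simp
  next
    case False
    then obtain z where z: "z \<in> K w" "z \<in> K (hd ws)" using Cons.prems(4) by (auto simp: successively_Cons)
    have "K w \<subseteq> topspace X" "K (last ws) \<subseteq> topspace X"
      using False Cons.prems(2) by (intro K_subset_topspace; simp)+
    then have "\<rho> x y \<le> \<rho> x z + \<rho> z y"
      using Cons.prems(5,6) z False by (intro triangle) auto
    also have "\<rho> z y \<le> real (length ws) * s"
      using Cons.prems z False by (intro Cons.IH) (auto simp: successively_Cons)
    also have "\<rho> x z \<le> s" by (rule Cons.prems(3)[of w]) (use Cons.prems(5) z in simp_all)
    finally show ?thesis by (simp add: algebra_simps)
  qed
qed simp

end

section \<open>The basic framework\<close>

sublocale basic_framework \<subseteq> partitioned_tree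
  by unfold_locales (rule partition)

context basic_framework
begin

section \<open>Consequences of the framework for the given metric\<close>

lemma metric_d: "Metric_space (topspace X) d"
  and mtopology_d: "Metric_space.mtopology (topspace X) d = X"
  and diam_d: "diam d (topspace X) = 1"
  using normalized_metric by (auto simp: normalized_metric_def)

text \<open>\<open>diam\<close> is a real supremum and bounds nothing unless the distances are
  bounded, which compactness supplies.\<close>

lemma d_le_1:
  assumes "x \<in> topspace X" "y \<in> topspace X"
  shows "d x y \<le> 1"
proof -
  interpret Metric_space "topspace X" d by (rule metric_d)
  have "mbounded (topspace X)"
    using compact_space mtopology_d by (intro compactin_imp_mbounded) (simp add: compact_space_def)
  then obtain b where "\<And>x y. x \<in> topspace X \<Longrightarrow> y \<in> topspace X \<Longrightarrow> d x y \<le> b"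
    unfolding mbounded_alt by blast
  then have "d x y \<le> diam d (topspace X)" by (rule le_diamI) (use assms in auto)
  then show ?thesis using diam_d by simp
qed

lemma dist_le_metric_weight: "w \<in> verts G \<Longrightarrow> x \<in> K w \<Longrightarrow> y \<in> K w \<Longrightarrow> d x y \<le> metric_weight K d w"
  unfolding metric_weight_def
  by (rule le_diamI[of _ _ 1]) (use d_le_1 K_subset_topspace in blast)+

lemma metric_weight_base: "metric_weight K d (base G) = 1"
  by (simp add: metric_weight_def K_base diam_d)

lemma metric_weight_le_1: "w \<in> verts G \<Longrightarrow> metric_weight K d w \<le> 1"
  unfolding metric_weight_def using K_nonempty d_le_1 K_subset_topspace
  by (intro diam_leI) blast+

text \<open>Moving to the scale \<open>\<Lambda>\<^sub>s\<close> for \<open>s\<close> comparable to \<open>r^n\<close> changes levels by a bounded amount,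
  so that uniform finiteness of the weight bounds the degree in each level.\<close>

lemma horizontal_degree_bound:
  "\<exists>b. \<forall>w\<in>verts G. card (horizontal_nbhd G K 1 w) \<le> b"
proof -
  let ?g = "metric_weight K d"
  obtain r c\<^sub>1 c\<^sub>2 where r: "0 < r" "r < 1" and c: "0 < c\<^sub>1" "0 < c\<^sub>2"
    and lo: "\<And>w. w \<in> verts G \<Longrightarrow> c\<^sub>1 * r ^ level G w \<le> ?g w"
    and up: "\<And>w. w \<in> verts G \<Longrightarrow> ?g w \<le> c\<^sub>2 * r ^ level G w"
    using geometric_diameters by metis
  obtain n\<^sub>f where uf: "\<And>s w. 0 < s \<Longrightarrow> s \<le> 1 \<Longrightarrow> w \<in> scale G ?g s \<Longrightarrow>
      finite {v \<in> scale G ?g s. K v \<inter> K w \<noteq> {}} \<and> card {v \<in> scale G ?g s. K v \<inter> K w \<noteq> {}} \<le> n\<^sub>f"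
    using uniformly_finite unfolding uniformly_finite_weight_def by blast
  obtain n\<^sub>c where nc: "\<And>w. w \<in> verts G \<Longrightarrow> card (children G w) \<le> n\<^sub>c" using bounded_children by blast
  have "(\<lambda>j. c\<^sub>2 * r ^ j) \<longlonglongrightarrow> c\<^sub>2 * 0" using r by (intro tendsto_intros LIMSEQ_realpow_zero) auto
  then have "\<forall>\<^sub>F j in sequentially. c\<^sub>2 * r ^ j < c\<^sub>1" using c order_tendstoD(2) by fastforce
  then obtain j where j: "c\<^sub>2 * r ^ j < c\<^sub>1" unfolding eventually_sequentially by blast
  define b where "b = n\<^sub>f * (\<Sum>i\<le>j. n\<^sub>c ^ i)"
  have "card (horizontal_nbhd G K 1 w) \<le> b" if w: "w \<in> verts G" for w
  proof -
    define n where "n = level G w"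
    define s where "s = min 1 (c\<^sub>2 * r ^ n)"
    have s: "0 < s" "s \<le> 1" using c r by (auto simp: s_def)
    have in_scale: "\<exists>i\<le>j. (parent G ^^ i) u \<in> scale G ?g s \<and> i \<le> level G u"
      if u: "u \<in> verts G" "level G u = n" for u
    proof -
      have gu: "?g u \<le> s" using up[OF u(1)] metric_weight_le_1[OF u(1)] u(2) by (simp add: s_def)
      have "\<exists>i. (parent G ^^ i) u \<in> scale G ?g s"
      proof (cases "s < 1")
        case True
        then show ?thesis using ancestor_in_scale[OF u(1) gu _ metric_weight_base] by blast
      next
        case False
        have "(parent G ^^ n) u = base G"
          using ancestor_eq_base[OF u(1)] u(2) by simp
        then show ?thesis using False by (intro exI[of _ n]) (simp add: scale_def)
      qed
      then obtain i' where i': "(parent G ^^ i') u \<in> scale G ?g s" by blast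
      \<comment> \<open>Iterating \<open>parent\<close> past the root stays there; capping at
        \<open>n\<close> makes \<open>i\<close> a true difference of levels.\<close>
      define i where "i = min i' n"
      have i: "(parent G ^^ i) u \<in> scale G ?g s" "i \<le> n"
      proof -
        have "(parent G ^^ i') u = (parent G ^^ n) u" if "n \<le> i'"
          using ancestor_eq_base[OF u(1)] u(2) that by simp
        then show "(parent G ^^ i) u \<in> scale G ?g s" using i' by (auto simp: i_def min_def)
      qed (simp add: i_def)
      let ?u = "(parent G ^^ i) u"
      have "?g ?u \<le> s"
        using i(1) s metric_weight_base by (auto simp: scale_def split: if_splits)
      \<comment> \<open>An ancestor of diameter at most \<open>s\<close> cannot lie far above level
        \<open>n\<close>: the two diameter bounds give
        \<open>c\<^sub>1 \<le> c\<^sub>2 * r ^ i\<close>, which fails for \<open>i\<close> at least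
        \<open>j\<close>.\<close>
      then have "c\<^sub>1 * r ^ (n - i) \<le> c\<^sub>2 * r ^ n"
        using lo[OF ancestor_in_verts[OF u(1)], of i] level_ancestor[OF u(1), of i] u(2) by (simp add: s_def)
      moreover have "r ^ n = r ^ i * r ^ (n - i)" using i(2) by (simp add: power_add[symmetric])
      ultimately have "c\<^sub>1 * r ^ (n - i) \<le> (c\<^sub>2 * r ^ i) * r ^ (n - i)" by (simp add: mult.assoc)
      then have "c\<^sub>1 \<le> c\<^sub>2 * r ^ i" using r by simp
      moreover have "c\<^sub>2 * r ^ i \<le> c\<^sub>2 * r ^ j" if "j \<le> i"
        using c r that by (intro mult_left_mono power_decreasing) auto
      ultimately have "i \<le> j" using j by force
      then show ?thesis using i u(2) by blast
    qed
    obtain i\<^sub>w where iw: "(parent G ^^ i\<^sub>w) w \<in> scale G ?g s" using in_scale[OF w] n_def by blast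
    let ?w = "(parent G ^^ i\<^sub>w) w"
    define S where "S = {v \<in> scale G ?g s. K v \<inter> K ?w \<noteq> {}}"
    have S: "finite S" "card S \<le> n\<^sub>f" using uf[OF s iw] by (auto simp: S_def)
    have SV: "S \<subseteq> verts G" using base_in_verts by (auto simp: S_def scale_def split: if_splits)
    have sub: "horizontal_nbhd G K 1 w \<subseteq> (\<Union>v\<in>S. \<Union>i\<in>{..j}. descendants G i v)"
    proof
      fix u assume "u \<in> horizontal_nbhd G K 1 w"
      then have u: "u \<in> verts G" "level G u = n" "K w \<inter> K u \<noteq> {}"
        unfolding horizontal_nbhd_iff[OF w] by (auto simp: level_set_def n_def)
      obtain i where i: "i \<le> j" "(parent G ^^ i) u \<in> scale G ?g s" "i \<le> level G u"
        using in_scale[OF u(1,2)] by blast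
      have "K ((parent G ^^ i) u) \<inter> K ?w \<noteq> {}"
        using u(3) K_subset_ancestor[OF u(1), of i] K_subset_ancestor[OF w, of i\<^sub>w] by blast
      then have "(parent G ^^ i) u \<in> S" using i(2) by (simp add: S_def)
      moreover have "u \<in> descendants G i ((parent G ^^ i) u)"
        using u i level_ancestor[OF u(1), of i] by (simp add: descendants_eq ancestor_in_verts)
      ultimately show "u \<in> (\<Union>v\<in>S. \<Union>i\<in>{..j}. descendants G i v)" using i(1) by blast
    qed
    have fin: "finite (\<Union>i\<in>{..j}. descendants G i v)" if "v \<in> S" for v
      using finite_descendants that SV by blast
    have "card (horizontal_nbhd G K 1 w) \<le> card (\<Union>v\<in>S. \<Union>i\<in>{..j}. descendants G i v)"
      by (rule card_mono[OF _ sub]) (use S fin in blast)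
    also have "\<dots> \<le> (\<Sum>v\<in>S. card (\<Union>i\<in>{..j}. descendants G i v))" by (rule card_UN_le[OF S(1)])
    also have "\<dots> \<le> (\<Sum>v\<in>S. \<Sum>i\<le>j. n\<^sub>c ^ i)"
    proof (rule sum_mono)
      fix v assume "v \<in> S"
      then have v: "v \<in> verts G" using SV by blast
      have "card (\<Union>i\<in>{..j}. descendants G i v) \<le> (\<Sum>i\<le>j. card (descendants G i v))"
        by (rule card_UN_le) simp
      also have "\<dots> \<le> (\<Sum>i\<le>j. n\<^sub>c ^ i)" by (intro sum_mono card_descendants_le nc v)
      finally show "card (\<Union>i\<in>{..j}. descendants G i v) \<le> (\<Sum>i\<le>j. n\<^sub>c ^ i)" .
    qed
    also have "\<dots> \<le> b" using S(2) by (simp add: b_def mult_right_mono)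
    finally show ?thesis .
  qed
  then show ?thesis by blast
qed

lemma card_horizontal_nbhd_le:
  assumes "w \<in> verts G"
  shows "card (horizontal_nbhd G K 1 w) \<le> Lstar G K"
proof -
  obtain b where b: "\<forall>w\<in>verts G. card (horizontal_nbhd G K 1 w) \<le> b" using horizontal_degree_bound by blast
  show ?thesis unfolding Lstar_def
    by (rule cSUP_upper[OF assms]) (use b in \<open>auto intro!: bdd_aboveI[of _ b]\<close>)
qed

text \<open>Adaptedness joins the points by cells of the scale \<sigma>. These are so small that
  their levels exceed \<open>n\<close>, and replacing each by its ancestor on level \<open>n\<close>
  preserves all intersections.\<close>

lemma near_path:
  assumes r: "0 < r" "r < 1" and c\<^sub>1: "0 < c\<^sub>1"
    and lo: "\<And>w. w \<in> verts G \<Longrightarrow> c\<^sub>1 * r ^ level G w \<le> metric_weight K d w"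
  shows "\<exists>a>0. \<forall>n. \<forall>x\<in>topspace X. \<forall>y\<in>topspace X. d x y < a * r ^ n \<longrightarrow>
    (\<exists>u v. u \<in> level_set G n \<and> x \<in> K u \<and> y \<in> K v \<and> v \<in> horizontal_nbhd G K Mstar u)"
proof -
  let ?g = "metric_weight K d"
  interpret Metric_space "topspace X" d by (rule metric_d)
  obtain \<alpha>\<^sub>2 where \<alpha>: "0 < \<alpha>\<^sub>2" "\<And>x s. x \<in> topspace X \<Longrightarrow> s > 0 \<Longrightarrow> mball x s \<subseteq> nbhd G K ?g Mstar x (\<alpha>\<^sub>2 * s)"
    using adapted unfolding adapted_metric_def by blast
  \<comment> \<open>Makes \<sigma> equal to \<open>min c\<^sub>1 1 / 2 * r ^ n\<close>: below 1, so
    that \<open>scale\<close> is not just the root, and below every diameter on levels up to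
    \<open>n\<close>.\<close>
  define a where "a = min c\<^sub>1 1 / (2 * \<alpha>\<^sub>2)"
  have a: "a > 0" using \<alpha> c\<^sub>1 by (simp add: a_def)
  have "\<exists>u v. u \<in> level_set G n \<and> x \<in> K u \<and> y \<in> K v \<and> v \<in> horizontal_nbhd G K Mstar u"
    if x: "x \<in> topspace X" and y: "y \<in> topspace X" and xy: "d x y < a * r ^ n" for n x y
  proof -
    define \<sigma> where "\<sigma> = \<alpha>\<^sub>2 * (a * r ^ n)"
    have \<sigma>_eq: "\<sigma> = min c\<^sub>1 1 / 2 * r ^ n" using \<alpha>(1) by (simp add: \<sigma>_def a_def)
    have rn: "0 < r ^ n" "r ^ n \<le> 1" using r by (auto intro: power_le_one)
    have "min c\<^sub>1 1 / 2 * r ^ n \<le> min c\<^sub>1 1 / 2 * 1" using rn c\<^sub>1 by (intro mult_left_mono) auto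
    then have \<sigma>1: "\<sigma> < 1" unfolding \<sigma>_eq by linarith
    have "min c\<^sub>1 1 / 2 * r ^ n < c\<^sub>1 * r ^ n" using rn c\<^sub>1 by (intro mult_strict_right_mono) auto
    then have \<sigma>2: "\<sigma> < c\<^sub>1 * r ^ n" unfolding \<sigma>_eq .
    have "y \<in> mball x (a * r ^ n)" using x y xy by simp
    then have "y \<in> nbhd G K ?g Mstar x \<sigma>"
      using \<alpha>(2)[OF x, of "a * r ^ n"] a rn unfolding \<sigma>_def by auto
    then obtain ws where ws: "length ws = Mstar + 1" "set ws \<subseteq> scale G ?g \<sigma>" "x \<in> K (hd ws)" "y \<in> K (last ws)"
      "\<forall>i<Mstar. K (ws ! i) \<inter> K (ws ! Suc i) \<noteq> {}"
      unfolding nbhd_def by blast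
    have ne: "ws \<noteq> []" using ws(1) by auto
    have mem: "w \<in> verts G" "n < level G w" if "w \<in> set ws" for w
    proof -
      have w: "w \<in> verts G" "?g w \<le> \<sigma>" using ws(2) that \<sigma>1 by (auto simp: scale_def)
      have "c\<^sub>1 * r ^ level G w < c\<^sub>1 * r ^ n" using lo[OF w(1)] w(2) \<sigma>2 by linarith
      then have "r ^ level G w < r ^ n" using c\<^sub>1 by simp
      moreover have "r ^ n \<le> r ^ level G w" if "level G w \<le> n" using that r by (intro power_decreasing) auto
      ultimately show "w \<in> verts G" "n < level G w" using w by force+
    qed
    define f where "f = (\<lambda>i. (parent G ^^ (level G (ws ! i) - n)) (ws ! i))"
    have f: "f i \<in> level_set G n" "K (ws ! i) \<subseteq> K (f i)" if "i \<le> Mstar" for i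
    proof -
      have i: "ws ! i \<in> set ws" using ws(1) that by simp
      show "f i \<in> level_set G n"
        using mem[OF i] by (simp add: f_def level_set_def ancestor_in_verts level_ancestor)
      show "K (ws ! i) \<subseteq> K (f i)" unfolding f_def by (rule K_subset_ancestor[OF mem(1)[OF i]])
    qed
    let ?us = "map f [0..<Suc Mstar]"
    have lf0: "level G (f 0) = n" using f(1)[of 0] by (simp add: level_set_def)
    have "f Mstar \<in> horizontal_nbhd G K Mstar (f 0)"
      unfolding horizontal_nbhd_def lf0
    proof (intro CollectI exI[of _ ?us] conjI allI impI)
      show "set ?us \<subseteq> level_set G n" using f(1) by auto
      show "hd ?us = f 0" by (simp add: hd_map del: upt_Suc)
      show "last ?us = f Mstar" by simp
      show "K (?us ! i) \<inter> K (?us ! Suc i) \<noteq> {}" if "i < Mstar" for i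
        using ws(5) that f(2)[of i] f(2)[of "Suc i"] by (simp del: upt_Suc) blast
    qed simp
    moreover have "x \<in> K (f 0)" using ws(3) f(2)[of 0] ne by (auto simp: hd_conv_nth)
    moreover have "y \<in> K (f Mstar)" using ws(1,4) f(2)[of Mstar] ne by (auto simp: last_conv_nth)
    ultimately show ?thesis using f(1)[of 0] by blast
  qed
  then show ?thesis using a by blast
qed

lemma closedin_K: "w \<in> verts G \<Longrightarrow> closedin X (K w)"
  using compactin_imp_closedin[OF metrizable_imp_Hausdorff_space[OF metrizable_space] compactin_K] .

end

text \<open>One inclusion is the triangle inequality along \<open>m + 1\<close> cells. For the
  other, each cell of the given short path is enlarged to an ancestor in the required scale, which
  keeps consecutive cells intersecting.\<close>

lemma (in basic_framework) adapted_of_comparable: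
  fixes \<rho> :: "'x \<Rightarrow> 'x \<Rightarrow> real"
  assumes \<rho>: "Metric_space (topspace X) \<rho>" "diam \<rho> (topspace X) = 1"
    and le_1: "\<And>x y. x \<in> topspace X \<Longrightarrow> y \<in> topspace X \<Longrightarrow> \<rho> x y \<le> 1"
    and E: "0 < E" "\<And>x y r. x \<in> topspace X \<Longrightarrow> y \<in> topspace X \<Longrightarrow> \<rho> x y < r \<Longrightarrow>
      \<exists>f. x \<in> K (f 0) \<and> y \<in> K (f m)
        \<and> (\<forall>i\<le>m. f i \<in> verts G \<and> metric_weight K \<rho> (f i) \<le> E * r)
        \<and> (\<forall>i<m. K (f i) \<inter> K (f (Suc i)) \<noteq> {})"
  shows "adapted_metric G X K m \<rho>"
proof -
  interpret Metric_space "topspace X" \<rho> by (rule \<rho>(1))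
  let ?g = "metric_weight K \<rho>"
  have g_base: "?g (base G) = 1" using \<rho>(2) K_base by (simp add: metric_weight_def)
  have \<rho>_le_g: "\<rho> x y \<le> ?g w" if "w \<in> verts G" "x \<in> K w" "y \<in> K w" for x y w
    unfolding metric_weight_def
    by (rule le_diamI[of _ _ 1]) (use le_1 K_subset_topspace that in blast)+
  \<comment> \<open>The denominator exceeds the number \<open>m + 1\<close> of cells, so the bound
    stays strictly below the radius of the open ball.\<close>
  define \<alpha> where "\<alpha> = 1 / (real m + 2)"
  have sub1: "nbhd G K ?g m x (\<alpha> * r) \<subseteq> mball x r" if x: "x \<in> topspace X" and r: "r > 0" for x r
  proof
    fix y assume "y \<in> nbhd G K ?g m x (\<alpha> * r)"
    then obtain ws where ws: "length ws = m + 1" "set ws \<subseteq> scale G ?g (\<alpha> * r)" "x \<in> K (hd ws)" "y \<in> K (last ws)"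
      "\<forall>i<m. K (ws ! i) \<inter> K (ws ! Suc i) \<noteq> {}"
      unfolding nbhd_def by blast
    have ne: "ws \<noteq> []" using ws(1) by auto
    have mem: "w \<in> verts G" "?g w \<le> \<alpha> * r" if "w \<in> set ws" for w
      using ws(2) that g_base base_in_verts by (auto simp: scale_def split: if_splits)
    have "successively (\<lambda>u v. K u \<inter> K v \<noteq> {}) ws"
      unfolding successively_conv_nth using ws(1,5) by simp
    then have "\<rho> x y \<le> real (length ws) * (\<alpha> * r)"
      using ws(3,4) mem(1) order_trans[OF \<rho>_le_g mem(2)]
      by (intro dist_le_of_cover[OF \<rho>(1) ne]) blast+
    also have "\<dots> < r" using ws(1) r by (simp add: \<alpha>_def field_simps)
    finally have "\<rho> x y < r" .
    moreover have "y \<in> topspace X" using ws(4) mem(1) K_subset_topspace ne last_in_set by blast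
    ultimately show "y \<in> mball x r" using x by simp
  qed
  have sub2: "mball x r \<subseteq> nbhd G K ?g m x (E * r)" if x: "x \<in> topspace X" and r: "r > 0" for x r
  proof
    fix y assume "y \<in> mball x r"
    then have y: "y \<in> topspace X" "\<rho> x y < r" by auto
    obtain f where f: "x \<in> K (f 0)" "y \<in> K (f m)"
      "\<And>i. i \<le> m \<Longrightarrow> f i \<in> verts G" "\<And>i. i \<le> m \<Longrightarrow> ?g (f i) \<le> E * r"
      "\<And>i. i < m \<Longrightarrow> K (f i) \<inter> K (f (Suc i)) \<noteq> {}"
      using E(2)[OF x y] by blast
    have "\<exists>u. u \<in> scale G ?g (E * r) \<and> K (f i) \<subseteq> K u" if "i \<le> m" for i
    proof (cases "E * r < 1")
      case True
      then show ?thesis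
        using ancestor_in_scale[OF f(3)[OF that] f(4)[OF that] True g_base] K_subset_ancestor[OF f(3)[OF that]]
        by blast
    next
      case False
      then show ?thesis using K_base K_subset_topspace[OF f(3)[OF that]] by (auto simp: scale_def)
    qed
    then obtain h where h: "\<And>i. i \<le> m \<Longrightarrow> h i \<in> scale G ?g (E * r)" "\<And>i. i \<le> m \<Longrightarrow> K (f i) \<subseteq> K (h i)"
      by metis
    let ?us = "map h [0..<Suc m]"
    show "y \<in> nbhd G K ?g m x (E * r)"
      unfolding nbhd_def
    proof (intro CollectI exI[of _ ?us] conjI allI impI)
      show "set ?us \<subseteq> scale G ?g (E * r)" using h(1) by auto
      show "x \<in> K (hd ?us)" using f(1) h(2)[of 0] by (auto simp: hd_map simp del: upt_Suc)
      show "y \<in> K (last ?us)" using f(2) h(2)[of m] by auto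
      show "K (?us ! i) \<inter> K (?us ! Suc i) \<noteq> {}" if "i < m" for i
        using f(5)[OF that] h(2)[of i] h(2)[of "Suc i"] that by (simp del: upt_Suc) blast
    qed simp
  qed
  have "\<alpha> > 0" by (simp add: \<alpha>_def)
  then show ?thesis unfolding adapted_metric_def using E(1) sub1 sub2 by blast
qed

locale crossing_framework = basic_framework +
  fixes M\<^sub>1 k :: nat and p r c\<^sub>1 c\<^sub>2 a :: real and N :: nat and \<phi> :: "'a \<Rightarrow> real"
  assumes M\<^sub>1: "M\<^sub>1 \<ge> 1" and p: "p > 0" and k: "k \<ge> 1"
    and inner: "\<And>w. w \<in> verts G \<Longrightarrow> \<exists>v\<in>descendants G k w. horizontal_nbhd G K 1 v \<subseteq> descendants G k w"
    and contract: "\<And>v m. m \<in> {M\<^sub>1, Mstar} \<Longrightarrow> v \<in> verts G \<Longrightarrow>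
        (parent G ^^ k) ` horizontal_nbhd G K (m + Mstar) v \<subseteq> horizontal_nbhd G K Mstar ((parent G ^^ k) v)"
    and \<phi>: "\<And>w. w \<in> level_multiples G k \<Longrightarrow> 0 < \<phi> w \<and> \<phi> w \<le> 1"
    and \<phi>_crossing: "\<And>w ws. w \<in> level_multiples G k \<Longrightarrow> ws \<in> crossing_jpaths G K w k 0 M\<^sub>1 M\<^sub>1 \<Longrightarrow>
        (\<Sum>i<length ws. \<phi> (ws ! i)) \<ge> 1"
    and \<phi>_sum: "\<And>w. w \<in> level_multiples G k \<Longrightarrow> (\<Sum>v\<in>descendants G k w. \<phi> v powr p)
        < 1 / 2 * real (Lstar G K) powi (- 2 * (int M\<^sub>1 + 2 * int Mstar))"
    and r: "0 < r" "r < 1" and c: "0 < c\<^sub>1" "0 < c\<^sub>2"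
    and diam_ge: "\<And>w. w \<in> verts G \<Longrightarrow> c\<^sub>1 * r ^ level G w \<le> metric_weight K d w"
    and diam_le: "\<And>w. w \<in> verts G \<Longrightarrow> metric_weight K d w \<le> c\<^sub>2 * r ^ level G w"
    and a: "0 < a" "\<And>n x y. x \<in> topspace X \<Longrightarrow> y \<in> topspace X \<Longrightarrow> d x y < a * r ^ n \<Longrightarrow>
        \<exists>u v. u \<in> level_set G n \<and> x \<in> K u \<and> y \<in> K v \<and> v \<in> horizontal_nbhd G K Mstar u"
    and N: "\<And>w. w \<in> verts G \<Longrightarrow> card (children G w) \<le> N"
begin

section \<open>Passage to the sparse tree \<open>level_multiples G k\<close>\<close>

abbreviation V :: "'a set" where "V \<equiv> level_multiples G k"
abbreviation lev :: "'a \<Rightarrow> nat" where "lev v \<equiv> level G v div k"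
abbreviation P :: "'a \<Rightarrow> 'a" where "P \<equiv> parent G ^^ k"

lemma V_verts: "v \<in> V \<Longrightarrow> v \<in> verts G"
  by (simp add: level_multiples_iff)

lemma level_V: "v \<in> V \<Longrightarrow> level G v = k * lev v"
  by (simp add: level_multiples_iff)

lemma level_set_V: "level_set G (k * n) = {v \<in> V. lev v = n}"
  using k by (auto simp: level_set_def level_multiples_iff)

lemma descendants_V:
  assumes "w \<in> V"
  shows "{v \<in> V. lev v = Suc (lev w) \<and> P v = w} = descendants G k w"
proof -
  have "v \<in> V \<and> lev v = Suc (lev w) \<longleftrightarrow> v \<in> verts G \<and> level G v = level G w + k" for v
  proof
    assume v: "v \<in> V \<and> lev v = Suc (lev w)"
    then have "level G v = k * Suc (lev w)" using level_V[of v] by simp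
    then show "v \<in> verts G \<and> level G v = level G w + k" using v V_verts level_V[OF assms] by simp
  next
    assume v: "v \<in> verts G \<and> level G v = level G w + k"
    then show "v \<in> V \<and> lev v = Suc (lev w)"
      using assms k by (simp add: level_multiples_iff)
  qed
  then show ?thesis unfolding descendants_eq[OF V_verts[OF assms]] by blast
qed

lemma P_V:
  assumes "v \<in> V" "lev v = Suc n"
  shows "P v \<in> V" "lev (P v) = n"
proof -
  have "level G (P v) = k * n"
    using level_ancestor[OF V_verts[OF assms(1)], of k] level_V[OF assms(1)] assms(2) by simp
  then show "P v \<in> V" "lev (P v) = n"
    using k V_verts[OF assms(1)] by (simp_all add: level_multiples_iff ancestor_in_verts)
qed

lemma r_power: "v \<in> V \<Longrightarrow> (r ^ k) ^ lev v = r ^ level G v"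
  by (metis level_V power_mult)

sublocale T: scaled_tree V lev P "base G" K "topspace X" d "r ^ k" a "c\<^sub>1 / 2" c\<^sub>2 Mstar "N ^ k"
proof (rule scaled_tree.intro)
  show "base G \<in> V" "lev (base G) = 0"
    by (simp_all add: level_multiples_iff base_in_verts level_base)
  show "v = base G" if "v \<in> V" "lev v = 0" for v
    using level_V[OF that(1)] level_eq_0_iff[OF V_verts[OF that(1)]] that(2) by simp
  show "P v \<in> V" "lev (P v) = n" if "v \<in> V" "lev v = Suc n" for v n
    using P_V[OF that] by auto
  show "K (base G) = topspace X" by (rule K_base)
  show "K v \<noteq> {}" if "v \<in> V" for v using K_nonempty V_verts that by blast
  show "K w = (\<Union>v\<in>{v \<in> V. lev v = Suc (lev w) \<and> P v = w}. K v)" if "w \<in> V" for w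
    unfolding descendants_V[OF that] by (rule K_descendants[OF V_verts[OF that]])
  show "finite {v \<in> V. lev v = Suc (lev w) \<and> P v = w}" if "w \<in> V" for w
    unfolding descendants_V[OF that] by (rule finite_descendants[OF V_verts[OF that]])
  show "card {v \<in> V. lev v = Suc (lev w) \<and> P v = w} \<le> N ^ k" if "w \<in> V" for w
    unfolding descendants_V[OF that] by (rule card_descendants_le[OF N V_verts[OF that]])
  show "Metric_space (topspace X) d" by (rule metric_d)
  show "0 < r ^ k" "r ^ k < 1" using r k by (auto simp: power_less_one_iff)
  show "0 < a" "0 < c\<^sub>1 / 2" "1 \<le> Mstar" using a c Mstar_ge_1 by auto
  show "d x y \<le> c\<^sub>2 * (r ^ k) ^ lev w" if "w \<in> V" "x \<in> K w" "y \<in> K w" for w x y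
    using dist_le_metric_weight[OF V_verts[OF that(1)] that(2,3)] diam_le[OF V_verts[OF that(1)]]
      r_power[OF that(1)] by simp
  \<comment> \<open>The diameter is a supremum; asking for half of the lower bound gives an actual
    pair of points, hence \<open>c\<^sub>1 / 2\<close> in the instance.\<close>
  show "\<exists>x\<in>K w. \<exists>y\<in>K w. c\<^sub>1 / 2 * (r ^ k) ^ lev w \<le> d x y" if w: "w \<in> V" for w
  proof (rule ccontr)
    assume "\<not> ?thesis"
    then have "metric_weight K d w \<le> c\<^sub>1 / 2 * r ^ level G w"
      unfolding metric_weight_def using K_nonempty[OF V_verts[OF w]] r_power[OF w]
      by (intro diam_leI) (auto simp: not_le less_imp_le)
    moreover have "c\<^sub>1 / 2 * r ^ level G w < c\<^sub>1 * r ^ level G w" using c r by simp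
    ultimately show False using diam_ge[OF V_verts[OF w]] by linarith
  qed
qed

text \<open>\<open>T.R\<close> relates vertices on all levels of \<open>V\<close>, but a walk from
  \<open>w\<close> never changes level, so the restricted relation has the same walks from
  \<open>w\<close>.\<close>

lemma relpow_R_iff:
  assumes w: "w \<in> V"
  shows "(w, u) \<in> T.R ^^ i \<longleftrightarrow> u \<in> horizontal_nbhd G K i w"
proof -
  define S where "S = {(u, v). u \<in> level_set G (level G w) \<and> v \<in> level_set G (level G w) \<and> K u \<inter> K v \<noteq> {}}"
  have lw: "level_set G (level G w) = {v \<in> V. lev v = lev w}"
    using level_set_V[of "lev w"] level_V[OF w] by simp
  have "S \<subseteq> T.R" by (auto simp: S_def T.R_def lw)
  then have 1: "(w, u) \<in> T.R ^^ i" if "(w, u) \<in> S ^^ i"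
    using that by (induction i arbitrary: u) (auto elim!: relpow_Suc_E simp del: relpow.simps(2) intro: relpow_Suc_I)
  have 2: "(w, u) \<in> S ^^ i" if "(w, u) \<in> T.R ^^ i"
    using that
  proof (induction i arbitrary: u)
    case (Suc i)
    then obtain y where y: "(w, y) \<in> T.R ^^ i" "(y, u) \<in> T.R" by (elim relpow_Suc_E)
    have "(y, u) \<in> S"
      using y(2) T.relpow_R_invariants[OF y(1) w] by (auto simp: S_def T.R_def lw)
    then show ?case using Suc.IH[OF y(1)] relpow_Suc_I by metis
  qed simp
  show ?thesis
    unfolding horizontal_nbhd_iff[OF V_verts[OF w]] S_def[symmetric] using 1 2 by blast
qed

lemma ch_eq: "w \<in> V \<Longrightarrow> T.ch w = descendants G k w"
  unfolding T.ch_def by (rule descendants_V)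

text \<open>For inner radius 0 the start condition asks for a descendant of \<open>w\<close> itself,
  namely \<open>u\<close>. The exit witness is \<open>t\<close>: as a descendant of the
  M_1-neighbourhood it would have \<open>P t\<close> there.\<close>

lemma crossing_jpathI:
  assumes w: "w \<in> V" and vs: "vs \<noteq> []"
    "\<And>v. v \<in> set vs \<Longrightarrow> v \<in> V \<and> lev v = Suc (lev w) \<and> (w, P v) \<in> T.R ^^ M\<^sub>1"
    "successively (\<lambda>u v. (u, v) \<in> T.R ^^ M\<^sub>1) vs"
    and ends: "u \<in> T.ch w" "(u, hd vs) \<in> T.R ^^ M\<^sub>1" "(last vs, t) \<in> T.R ^^ M\<^sub>1" "(w, P t) \<notin> T.R ^^ M\<^sub>1"
  shows "vs \<in> crossing_jpaths G K w k 0 M\<^sub>1 M\<^sub>1"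
proof -
  have "set vs \<subseteq> level_set G (k * Suc (lev w))" unfolding level_set_V using vs(2) by blast
  then have j: "horizontal_jpath G K M\<^sub>1 vs"
    unfolding horizontal_jpath_def
  proof (intro conjI exI allI impI vs(1))
    fix i assume i: "Suc i < length vs"
    then have "(vs ! i, vs ! Suc i) \<in> T.R ^^ M\<^sub>1" using vs(3) by (simp add: successively_conv_nth)
    then show "vs ! Suc i \<in> horizontal_nbhd G K M\<^sub>1 (vs ! i)"
      using relpow_R_iff vs(2) i nth_mem[of i vs] by simp
  qed
  have in_desc: "v \<in> descendants_of_set G k (horizontal_nbhd G K M\<^sub>1 w)" if "v \<in> set vs" for v
  proof -
    have v: "v \<in> V" "lev v = Suc (lev w)" "(w, P v) \<in> T.R ^^ M\<^sub>1" using vs(2)[OF that] by auto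
    have "v \<in> descendants G k (P v)"
      using T.ch_P[OF v(1,2)] ch_eq[OF P_V(1)[OF v(1,2)]] by simp
    moreover have "P v \<in> horizontal_nbhd G K M\<^sub>1 w" using relpow_R_iff[OF w] v(3) by simp
    ultimately show ?thesis unfolding descendants_of_set_def by blast
  qed
  have hl: "hd vs \<in> V" "last vs \<in> V" using vs(1,2) by simp_all
  have "u \<in> horizontal_nbhd G K M\<^sub>1 (hd vs)"
    using relpow_R_iff[OF hl(1)] T.relpow_R_sym[OF ends(2)] by simp
  moreover have "u \<in> descendants_of_set G k (horizontal_nbhd G K 0 w)"
  proof -
    have "w \<in> horizontal_nbhd G K 0 w" using relpow_R_iff[OF w, of w 0] by simp
    then show ?thesis using ends(1) ch_eq[OF w] unfolding descendants_of_set_def by blast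
  qed
  ultimately have s: "horizontal_nbhd G K M\<^sub>1 (hd vs) \<inter> descendants_of_set G k (horizontal_nbhd G K 0 w) \<noteq> {}" by blast
  have "t \<notin> descendants_of_set G k (horizontal_nbhd G K M\<^sub>1 w)"
  proof
    assume "t \<in> descendants_of_set G k (horizontal_nbhd G K M\<^sub>1 w)"
    then obtain w' where w': "(w, w') \<in> T.R ^^ M\<^sub>1" "t \<in> descendants G k w'"
      unfolding descendants_of_set_def using relpow_R_iff[OF w] by blast
    have "w' \<in> V" using T.relpow_R_invariants[OF w'(1) w] by simp
    then have "P t = w'" using w'(2) descendants_eq[OF V_verts] by blast
    then show False using w'(1) ends(4) by simp
  qed
  moreover have "t \<in> horizontal_nbhd G K M\<^sub>1 (last vs)" using relpow_R_iff[OF hl(2)] ends(3) by simp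
  ultimately show ?thesis
    unfolding crossing_jpaths_def using j in_desc s by blast
qed

sublocale T: admissible_weight V lev P "base G" K "topspace X" d "r ^ k" a "c\<^sub>1 / 2" c\<^sub>2 Mstar "N ^ k"
  M\<^sub>1 "Lstar G K" \<phi> p
proof (rule admissible_weight.intro[OF T.scaled_tree_axioms admissible_weight_axioms.intro])
  show "1 \<le> M\<^sub>1" "0 < p" by (rule M\<^sub>1 p)+
  show "(P u, P v) \<in> T.R ^^ Mstar" if uv: "(u, v) \<in> T.R ^^ (Mstar + Mstar)" "u \<in> V" "lev u = Suc n" for u v n
    using contract[of Mstar u] relpow_R_iff[OF uv(2)] relpow_R_iff[OF P_V(1)[OF uv(2,3)]] uv(1) V_verts[OF uv(2)]
    by blast
  show "(P u, P v) \<in> T.R ^^ Mstar" if uv: "(u, v) \<in> T.R ^^ (M\<^sub>1 + Mstar)" "u \<in> V" "lev u = Suc n" for u v n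
    using contract[of M\<^sub>1 u] relpow_R_iff[OF uv(2)] relpow_R_iff[OF P_V(1)[OF uv(2,3)]] uv(1) V_verts[OF uv(2)]
    by blast
  have R1: "T.R `` {u} = horizontal_nbhd G K 1 u" if "u \<in> V" for u
    using relpow_R_iff[OF that, of _ 1] by auto
  show "card (T.R `` {u}) \<le> Lstar G K" if "u \<in> V" for u
    unfolding R1[OF that] by (rule card_horizontal_nbhd_le[OF V_verts[OF that]])
  show "\<exists>v\<in>T.ch w. T.R `` {v} \<subseteq> T.ch w" if w: "w \<in> V" for w
  proof -
    obtain v where v: "v \<in> descendants G k w" "horizontal_nbhd G K 1 v \<subseteq> descendants G k w"
      using inner[OF V_verts[OF w]] by blast
    then have "v \<in> V" using descendants_V[OF w] by blast
    then show ?thesis using v R1 ch_eq[OF w] by auto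
  qed
  show "0 < \<phi> v" "\<phi> v \<le> 1" if "v \<in> V" for v using \<phi>[OF that] by auto
  show "1 \<le> sum_list (map \<phi> vs)"
    if "w \<in> V" "vs \<noteq> []"
      "\<And>v. v \<in> set vs \<Longrightarrow> v \<in> V \<and> lev v = Suc (lev w) \<and> (w, P v) \<in> T.R ^^ M\<^sub>1"
      "successively (\<lambda>u v. (u, v) \<in> T.R ^^ M\<^sub>1) vs"
      "u \<in> T.ch w" "(u, hd vs) \<in> T.R ^^ M\<^sub>1" "(last vs, t) \<in> T.R ^^ M\<^sub>1" "(w, P t) \<notin> T.R ^^ M\<^sub>1"
    for w vs u t
    using \<phi>_crossing[OF that(1) crossing_jpathI[OF that]]
    by (simp add: sum_list_sum_nth atLeast0LessThan)
  show "(\<Sum>v\<in>T.ch w. \<phi> v powr p) \<le> 1 / 2 / real (Lstar G K) ^ (2 * (M\<^sub>1 + 2 * Mstar))" if "w \<in> V" for w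
  proof -
    have "real (Lstar G K) powi (- 2 * (int M\<^sub>1 + 2 * int Mstar))
      = inverse (real (Lstar G K) powi int (2 * (M\<^sub>1 + 2 * Mstar)))"
      by (simp add: power_int_minus[symmetric])
    then have "1 / 2 * real (Lstar G K) powi (- 2 * (int M\<^sub>1 + 2 * int Mstar))
      = 1 / 2 / real (Lstar G K) ^ (2 * (M\<^sub>1 + 2 * Mstar))"
      by (simp only: power_int_of_nat divide_inverse mult_1)
    then show ?thesis using \<phi>_sum[OF that] ch_eq[OF that] by simp
  qed
  show "\<exists>u v. (u, v) \<in> T.R ^^ Mstar \<and> u \<in> V \<and> lev u = n \<and> x \<in> K u \<and> y \<in> K v"
    if xy: "x \<in> topspace X" "y \<in> topspace X" "d x y < a * (r ^ k) ^ n" for x y n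
  proof -
    have "d x y < a * r ^ (k * n)" using xy(3) by (simp add: power_mult)
    then obtain u v where u: "u \<in> level_set G (k * n)" "x \<in> K u" "y \<in> K v" "v \<in> horizontal_nbhd G K Mstar u"
      using a(2)[OF xy(1,2)] by blast
    have "u \<in> V" "lev u = n" using u(1) unfolding level_set_V by auto
    then show ?thesis using u relpow_R_iff by blast
  qed
  show K_cl: "closedin (Metric_space.mtopology (topspace X) d) (K w)" if "w \<in> V" for w
    unfolding mtopology_d by (rule closedin_K[OF V_verts[OF that]])
  show "(\<Inter>n. K (\<omega> n)) \<noteq> {}" if \<omega>: "\<omega> 0 = base G" "\<And>n. \<omega> (Suc n) \<in> T.ch (\<omega> n)" for \<omega>
  proof (rule compact_space_imp_nest[OF compact_space])
    have V: "\<omega> n \<in> V" for n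
      using \<omega> T.root_in_V by (cases n) (auto simp: T.ch_def)
    show "closedin X (K (\<omega> n))" for n by (rule closedin_K[OF V_verts[OF V]])
    show "K (\<omega> n) \<noteq> {}" for n by (rule T.K_nonempty[OF V])
    show "decseq (\<lambda>n. K (\<omega> n))"
      using T.K_ch[OF V] \<omega>(2) by (intro decseq_SucI) blast
  qed
qed

lemma conclusion:
  "\<exists>\<rho> \<mu>. \<rho> \<in> adapted_exponential_metrics G X K \<and> prob_space \<mu> \<and> borel_regular X \<mu>
     \<and> quasisymmetric_to X \<rho> d \<and> ahlfors_regular X p \<rho> \<mu>"
proof -
  obtain g \<epsilon> B where g: "0 < \<epsilon>" "\<epsilon> \<le> 1" "1 \<le> B" "g (base G) = 1" "\<forall>v\<in>V. 0 < g v"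
    "\<forall>v n. v \<in> V \<longrightarrow> lev v = Suc n \<longrightarrow> \<epsilon> * g (P v) \<le> g v"
    "\<forall>u v. (u, v) \<in> T.R \<longrightarrow> g u \<le> B * g v"
    "\<forall>w\<in>V. (\<Sum>v\<in>T.ch w. g v powr p) = g w powr p"
    "\<forall>u v n. u \<in> V \<longrightarrow> lev u = Suc n \<longrightarrow> (u, v) \<in> T.R ^^ (M\<^sub>1 + Mstar) \<longrightarrow> \<phi> u * g (P v) \<le> g v"
    using T.weight_exists by (elim exE conjE) (rule that; assumption)
  interpret T: balanced_weight V lev P "base G" K "topspace X" d "r ^ k" a "c\<^sub>1 / 2" c\<^sub>2 Mstar "N ^ k"
    M\<^sub>1 "Lstar G K" \<phi> p g \<epsilon> B
    by (rule balanced_weight.intro[OF T.admissible_weight_axioms balanced_weight_axioms.intro])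
      (use g in blast)+
  obtain D \<theta> where D: "0 < D" "0 < \<theta>" "\<theta> < 1"
    "\<forall>v n j. v \<in> V \<longrightarrow> lev v = n + j \<longrightarrow> g v \<le> D * \<theta> ^ j * g ((P ^^ j) v)"
    using T.g_decay by (elim exE conjE) (rule that; assumption)
  interpret T: decaying_weight V lev P "base G" K "topspace X" d "r ^ k" a "c\<^sub>1 / 2" c\<^sub>2 Mstar "N ^ k"
    M\<^sub>1 "Lstar G K" \<phi> p g \<epsilon> B D \<theta>
    by (rule decaying_weight.intro[OF T.balanced_weight_axioms decaying_weight_axioms.intro])
      (use D in blast)+
  obtain \<rho> C where \<rho>: "Metric_space (topspace X) \<rho>" "diam \<rho> (topspace X) = 1" "C \<ge> 1"
    "\<forall>w\<in>V. \<forall>x\<in>K w. \<forall>y\<in>K w. \<rho> x y \<le> C * g w"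
    "\<forall>x y w. w \<in> V \<longrightarrow> x \<in> K w \<longrightarrow> y \<in> topspace X \<longrightarrow> d x y \<le> (r ^ k) ^ lev w \<or> lev w = 0 \<longrightarrow> \<rho> x y \<le> C * g w"
    "\<forall>b>0. \<exists>c>0. \<forall>x y w. w \<in> V \<longrightarrow> x \<in> K w \<longrightarrow> y \<in> topspace X \<longrightarrow> b * (r ^ k) ^ lev w < d x y
        \<longrightarrow> c * g w \<le> \<rho> x y"
    using T.normalized_metric_exists by (elim exE conjE) (rule that; assumption)
  interpret T: comparable_metric V lev P "base G" K "topspace X" d "r ^ k" a "c\<^sub>1 / 2" c\<^sub>2 Mstar "N ^ k"
    M\<^sub>1 "Lstar G K" \<phi> p g \<epsilon> B D \<theta> \<rho> C
    by (rule comparable_metric.intro[OF T.decaying_weight_axioms comparable_metric_axioms.intro])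
      (use \<rho> in blast)+
  let ?gr = "metric_weight K \<rho>"
  have le_C: "\<rho> x y \<le> C" if "x \<in> topspace X" "y \<in> topspace X" for x y
    using T.\<rho>_le_K[OF T.root_in_V] that K_base g(4) by simp
  have le_1: "\<rho> x y \<le> 1" if "x \<in> topspace X" "y \<in> topspace X" for x y
    using le_diamI[of "topspace X" \<rho> C x y] le_C that \<rho>(2) by simp
  have le_gr: "\<rho> x y \<le> ?gr w" if "w \<in> verts G" "x \<in> K w" "y \<in> K w" for x y w
    unfolding metric_weight_def
    by (rule le_diamI[of _ _ 1]) (use le_1 K_subset_topspace that in blast)+
  have gr_le: "?gr w \<le> b" if "w \<in> verts G" "\<And>x y. x \<in> K w \<Longrightarrow> y \<in> K w \<Longrightarrow> \<rho> x y \<le> b" for w b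
    unfolding metric_weight_def using K_nonempty[OF that(1)] that(2) by (rule diam_leI)
  have gr_mono: "?gr v \<le> ?gr w" if "v \<in> verts G" "w \<in> verts G" "K v \<subseteq> K w" for v w
    by (rule gr_le[OF that(1)]) (use le_gr[OF that(2)] that(3) in blast)
  have gr_V: "?gr w \<le> C * g w" if "w \<in> V" for w
    by (rule gr_le[OF V_verts[OF that]]) (rule T.\<rho>_le_K[OF that])
  \<comment> \<open>A quarter, because \<open>T.\<rho>_ge\<close> wants a strict inequality and
    \<open>T.dist_ge\<close> yields only a weak one with \<open>c\<^sub>1 / 2\<close>.\<close>
  obtain c\<^sub>0 where c\<^sub>0: "c\<^sub>0 > 0" "\<And>x y w. w \<in> V \<Longrightarrow> x \<in> K w \<Longrightarrow> y \<in> topspace X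
      \<Longrightarrow> c\<^sub>1 / 4 * (r ^ k) ^ lev w < d x y \<Longrightarrow> c\<^sub>0 * g w \<le> \<rho> x y"
    using T.\<rho>_ge[of "c\<^sub>1 / 4"] c(1) by auto
  have gr_ge_V: "c\<^sub>0 * g w \<le> ?gr w" if w: "w \<in> V" for w
  proof -
    obtain x y where xy: "x \<in> K w" "y \<in> K w" "c\<^sub>1 / 2 * (r ^ k) ^ lev w \<le> d x y"
      using T.dist_ge[OF w] by blast
    have "c\<^sub>1 / 4 * (r ^ k) ^ lev w < c\<^sub>1 / 2 * (r ^ k) ^ lev w"
      using c(1) r by (intro mult_strict_right_mono) auto
    then have "c\<^sub>1 / 4 * (r ^ k) ^ lev w < d x y" using xy(3) by linarith
    then have "c\<^sub>0 * g w \<le> \<rho> x y"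
      using c\<^sub>0(2)[OF w xy(1)] xy(2) K_subset_topspace[OF V_verts[OF w]] by blast
    then show ?thesis using le_gr[OF V_verts[OF w] xy(1,2)] by linarith
  qed
  have lower: "c\<^sub>0 * \<epsilon> * g (truncate k w) \<le> ?gr w" if w: "w \<in> verts G" for w
  proof -
    have tw: "truncate k w \<in> V" by (rule truncate_in_level_multiples[OF w])
    obtain x where x: "x \<in> K w" using K_nonempty[OF w] by blast
    \<comment> \<open>Descends to the next multiple of \<open>k\<close>. The vertex reached has
      \<open>truncate k w\<close> as its \<open>P\<close>-parent and its cell lies inside
      \<open>K w\<close>, so its lower bound passes to \<open>w\<close>.\<close>
    define j where "j = k - level G w mod k"
    have jk: "level G w mod k + j = k" using k mod_less_divisor[of k "level G w"] by (simp add: j_def)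
    obtain v where v: "v \<in> descendants G j w" using K_descendants[OF w, of j] x by blast
    then have v': "v \<in> verts G" "level G v = level G w + j" "(parent G ^^ j) v = w"
      unfolding descendants_eq[OF w] by auto
    have lv: "level G v = k * Suc (lev w)"
      unfolding mult_Suc_right using v'(2) jk mult_div_mod_eq[of k "level G w"] by linarith
    then have vV: "v \<in> V" "lev v = Suc (lev w)" using v'(1) k by (simp_all add: level_multiples_iff)
    have "P v = (parent G ^^ (level G w mod k)) ((parent G ^^ j) v)"
      using jk by (metis funpow_add o_apply)
    then have Pv: "P v = truncate k w" using v'(3) by (simp add: truncate_def)
    have "c\<^sub>0 * (\<epsilon> * g (P v)) \<le> c\<^sub>0 * g v"
      using T.g_ge[OF vV] c\<^sub>0(1) by (intro mult_left_mono) auto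
    also have "\<dots> \<le> ?gr v" by (rule gr_ge_V[OF vV(1)])
    also have "\<dots> \<le> ?gr w"
      using K_subset_ancestor[OF v'(1), of j] v'(3) by (intro gr_mono v'(1) w) simp
    finally show ?thesis by (simp add: Pv mult.assoc)
  qed
  have upper: "?gr w \<le> C * g (truncate k w)" if w: "w \<in> verts G" for w
  proof -
    have "?gr w \<le> ?gr (truncate k w)"
      using K_subset_ancestor[OF w] by (intro gr_mono w truncate_in_verts) (simp add: truncate_def)
    then show ?thesis using gr_V[OF truncate_in_level_multiples[OF w]] by linarith
  qed
  have "exponential_weight G ?gr"
  proof (rule exponential_weight_of_comparable[where A = "c\<^sub>0 * \<epsilon>" and C = C and g = g and D = D and \<theta> = \<theta> and \<epsilon> = \<epsilon> and k = k])
    show "?gr (base G) = 1" using \<rho>(2) K_base by (simp add: metric_weight_def)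
    show "?gr w \<le> ?gr (parent G w)" if "w \<in> verts G" for w
      using that by (intro gr_mono parent_in_verts K_subset_parent)
    show "?gr w \<le> 1" if "w \<in> verts G" for w
      by (rule gr_le[OF that]) (use le_1 K_subset_topspace[OF that] in blast)
    show "level_set G m \<noteq> {}" for m
    proof -
      obtain x where "x \<in> topspace X" using K_nonempty[OF base_in_verts] K_base by blast
      then show ?thesis using covering by blast
    qed
    show "g v \<le> D * \<theta> ^ j * g ((parent G ^^ (k * j)) v)" if "v \<in> V" "level G v = k * (n + j)" for v n j
      using T.g_le_decay[of v n j] that k by (simp add: funpow_mult)
    show "\<epsilon> * g (P v) \<le> g v" if "v \<in> V" "level G v = k * Suc n" for v n
      using T.g_ge[of v n] that k by simp
  qed (use k lower upper c\<^sub>0(1) g \<rho>(3) D in auto)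
  moreover obtain E where E: "E > 0" "\<And>x y s. x \<in> topspace X \<Longrightarrow> y \<in> topspace X \<Longrightarrow> \<rho> x y < s \<Longrightarrow>
     \<exists>u v. u \<in> V \<and> (u, v) \<in> T.R ^^ Mstar \<and> x \<in> K u \<and> y \<in> K v \<and> g u \<le> E * s"
    using T.fine_path by blast
  have "adapted_metric G X K Mstar \<rho>"
  proof (rule adapted_of_comparable[OF \<rho>(1,2) le_1])
    \<comment> \<open>\<open>C\<close> compares diameters with weights, \<open>B ^ Mstar\<close> the
      weights along the path with its first one, and \<open>E\<close> that one with the
      radius.\<close>
    show "0 < C * B ^ Mstar * E" using E(1) \<rho>(3) g(3) by simp
    fix x y s assume xy: "x \<in> topspace X" "y \<in> topspace X" "\<rho> x y < s"
    obtain u v where u: "u \<in> V" "(u, v) \<in> T.R ^^ Mstar" "x \<in> K u" "y \<in> K v" "g u \<le> E * s"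
      using E(2)[OF xy] by blast
    obtain f where f: "f 0 = u" "f Mstar = v" "\<And>i. i < Mstar \<Longrightarrow> (f i, f (Suc i)) \<in> T.R"
      using u(2) unfolding relpow_fun_conv by blast
    have "f i \<in> verts G \<and> ?gr (f i) \<le> C * B ^ Mstar * E * s" if "i \<le> Mstar" for i
    proof -
      have ui: "(u, f i) \<in> T.R ^^ i" unfolding relpow_fun_conv using f that by (intro exI[of _ f]) auto
      then have fV: "f i \<in> V" using T.relpow_R_invariants u(1) by blast
      have "g (f i) \<le> B ^ i * g u" by (rule T.g_bal_relpow[OF T.relpow_R_sym[OF ui]])
      also have "\<dots> \<le> B ^ Mstar * (E * s)"
        using that g(3) u(5) T.g_pos[OF u(1)] by (intro mult_mono power_increasing) auto
      finally have "C * g (f i) \<le> C * (B ^ Mstar * (E * s))" using \<rho>(3) by (intro mult_left_mono) auto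
      then show ?thesis using gr_V[OF fV] V_verts[OF fV] by (simp add: mult.assoc)
    qed
    moreover have "K (f i) \<inter> K (f (Suc i)) \<noteq> {}" if "i < Mstar" for i
      using f(3)[OF that] by (simp add: T.R_def)
    ultimately show "\<exists>f. x \<in> K (f 0) \<and> y \<in> K (f Mstar)
        \<and> (\<forall>i\<le>Mstar. f i \<in> verts G \<and> ?gr (f i) \<le> C * B ^ Mstar * E * s)
        \<and> (\<forall>i<Mstar. K (f i) \<inter> K (f (Suc i)) \<noteq> {})"
      using u(3,4) f(1,2) by blast
  qed
  moreover have "normalized_metric X \<rho>"
    using \<rho>(1,2) T.mtopology_eq mtopology_d by (simp add: normalized_metric_def)
  ultimately have "\<rho> \<in> adapted_exponential_metrics G X K"
    by (auto simp: adapted_exponential_metrics_def)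
  moreover have "borel_regular X T.mu"
    using T.sets_mu T.space_mu mtopology_d by (auto simp: borel_regular_def)
  moreover have "quasisymmetric_to X \<rho> d"
    using T.quasisymmetric by (simp add: quasisymmetric_to_def)
  moreover have "ahlfors_regular X p \<rho> T.mu"
    using T.ahlfors by (simp add: ahlfors_regular_def)
  ultimately show ?thesis using T.mu.prob_space_axioms by blast
qed

end

theorem theorem18p1:
  fixes G :: "'t rooted_graph"
    and X :: "'x topology"
    and K :: "'t \<Rightarrow> 'x set"
    and d :: "'x \<Rightarrow> 'x \<Rightarrow> real"
    and Mstar M\<^sub>1 m\<^sub>0 k :: nat
    and kk :: "nat \<Rightarrow> nat"
    and p :: real
  assumes framework: "basic_framework G X K d Mstar"
    and "M\<^sub>1 \<ge> 1"
    and "p > 0"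
    and "\<forall>m\<ge>m\<^sub>0. \<forall>w\<in>verts G. \<exists>v\<in>descendants G m w. horizontal_nbhd G K 1 v \<subseteq> descendants G m w"
    and "\<forall>M\<in>{M\<^sub>1, Mstar}. kk M \<ge> 1 \<and> (\<forall>v\<in>verts G. \<forall>j\<ge>kk M.
           (parent G ^^ j) ` horizontal_nbhd G K (M + Mstar) v
             \<subseteq> horizontal_nbhd G K Mstar ((parent G ^^ j) v))"
    and "k \<ge> Max {m\<^sub>0, kk M\<^sub>1, kk Mstar}"
    and "\<exists>\<phi>::'t \<Rightarrow> real.
           (\<forall>w\<in>level_multiples G k. 0 < \<phi> w \<and> \<phi> w \<le> 1)
         \<and> (\<forall>w\<in>level_multiples G k. \<forall>ws\<in>crossing_jpaths G K w k 0 M\<^sub>1 M\<^sub>1.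
              (\<Sum>i<length ws. \<phi> (ws ! i)) \<ge> 1)
         \<and> (\<forall>w\<in>level_multiples G k. (\<Sum>v\<in>descendants G k w. \<phi> v powr p)
              < 1 / 2 * real (Lstar G K) powi (- 2 * (int M\<^sub>1 + 2 * int Mstar)))"
  shows "\<exists>\<rho> \<mu>. \<rho> \<in> adapted_exponential_metrics G X K
           \<and> prob_space \<mu> \<and> borel_regular X \<mu>
           \<and> quasisymmetric_to X \<rho> d
           \<and> ahlfors_regular X p \<rho> \<mu>"
proof -
  interpret basic_framework G X K d Mstar by (rule framework)
  obtain \<phi> :: "'t \<Rightarrow> real" where \<phi>: "\<forall>w\<in>level_multiples G k. 0 < \<phi> w \<and> \<phi> w \<le> 1"
    "\<forall>w\<in>level_multiples G k. \<forall>ws\<in>crossing_jpaths G K w k 0 M\<^sub>1 M\<^sub>1. (\<Sum>i<length ws. \<phi> (ws ! i)) \<ge> 1"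
    "\<forall>w\<in>level_multiples G k. (\<Sum>v\<in>descendants G k w. \<phi> v powr p)
       < 1 / 2 * real (Lstar G K) powi (- 2 * (int M\<^sub>1 + 2 * int Mstar))"
    using assms(7) by blast
  obtain r c\<^sub>1 c\<^sub>2 where r: "0 < r" "r < 1" "0 < c\<^sub>1" "0 < c\<^sub>2"
    and lo: "\<And>w. w \<in> verts G \<Longrightarrow> c\<^sub>1 * r ^ level G w \<le> metric_weight K d w"
    and up: "\<And>w. w \<in> verts G \<Longrightarrow> metric_weight K d w \<le> c\<^sub>2 * r ^ level G w"
    using geometric_diameters by metis
  obtain a where a: "a > 0" "\<forall>n. \<forall>x\<in>topspace X. \<forall>y\<in>topspace X. d x y < a * r ^ n \<longrightarrow>
    (\<exists>u v. u \<in> level_set G n \<and> x \<in> K u \<and> y \<in> K v \<and> v \<in> horizontal_nbhd G K Mstar u)"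
    using near_path[OF r(1-3) lo] by blast
  obtain N where N: "\<forall>w\<in>verts G. card (children G w) \<le> N" using bounded_children by blast
  have k: "m\<^sub>0 \<le> k" "kk M\<^sub>1 \<le> k" "kk Mstar \<le> k" using assms(6) by simp_all
  have kk: "1 \<le> kk Mstar" using assms(5) by blast
  interpret crossing_framework G X K d Mstar M\<^sub>1 k p r c\<^sub>1 c\<^sub>2 a N \<phi>
  proof (rule crossing_framework.intro[OF framework crossing_framework_axioms.intro])
    show "k \<ge> 1" using k(3) kk by linarith
    show "\<exists>v\<in>descendants G k w. horizontal_nbhd G K 1 v \<subseteq> descendants G k w" if "w \<in> verts G" for w
      using assms(4) k(1) that by blast
    show "(parent G ^^ k) ` horizontal_nbhd G K (m + Mstar) v \<subseteq> horizontal_nbhd G K Mstar ((parent G ^^ k) v)"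
      if "m \<in> {M\<^sub>1, Mstar}" "v \<in> verts G" for m v
    proof -
      have "kk m \<le> k" using that(1) k by blast
      then show ?thesis using assms(5) that by blast
    qed
  qed (use assms(2,3) \<phi> r lo up a N in blast)+
  show ?thesis by (rule conclusion)
qed

end
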